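(* Let $\mathbb{H}^n=\mathbb{W}\rtimes\mathbb{V}$ be a semidirect factorization of the Heisenberg group with $\mathbb{W}$ vertical and $\mathbb{V}$ horizontal of dimension $k$, let $\Omega\subset\mathbb{H}^n$ be open, $f\in C^1_h(\Omega,\mathbb{R}^k)$, and let $d$ be a homogeneous distance on $\mathbb{H}^n$. Fix $x_0\in\Omega$ and the level set $\Sigma=f^{-1}(f(x_0))$, and assume that $J_{\mathbb{V}}f(x)>0$ for all $x\in\Sigma$. Choose orthonormal bases $(v_1,\dots,v_k)$ of $\mathbb{V}$ and $(w_{k+1},\dots,w_{2n},e_{2n+1})$ of $\mathbb{W}$, and set $V=v_1\wedge\cdots\wedge v_k$, $N=w_{k+1}\wedge\cdots\wedge w_{2n}\wedge e_{2n+1}$. Then: (1) $\Sigma$ is a parametrized $\mathbb{H}$-regular surface with respect to $(\mathbb{W},\mathbb{V})$. (2) If $\phi:U\to\mathbb{V}$ denotes the parametrization of $\Sigma$, $\Phi(n)=n\phi(n)$, and $$\mu(B)=\|V\wedge N\|_g\int_{\Phi^{-1}(B)}\frac{J_Hf(\Phi(n))}{J_{\mathbb{V}}f(\Phi(n))}\,d\mathcal{H}^{2n+1-k}_E(n)$$ for every Borel set $B\subset\mathbb{H}^n$, then for every $x\in\Sigma$ $$\theta^{2n+2-k}(\mu,x)=\beta_d(\mathrm{Tan}(\Sigma,x)).$$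
   Context: Heisenberg group: $\mathbb{H}^n=H_1\oplus H_2$ is a real vector space, $\dim H_1=2n$, $\dim H_2=1$, with a symplectic form $\omega$ on $H_1$ and a fixed $0\ne e_{2n+1}\in H_2$; $\pi_{H_1}$ is the projection on $H_1$, $[p,q]=\omega(\pi_{H_1}p,\pi_{H_1}q)e_{2n+1}$ and $pq=p+q+\frac12[p,q]$ (identity $0$). Dilations: $\delta_t$ is linear with $\delta_t w=t^iw$ for $w\in H_i$, $t>0$. Fix a basis $(e_1,\dots,e_{2n})$ of $H_1$ with $\omega(e_i,e_{n+j})=\delta_{ij}$, $\omega(e_i,e_j)=\omega(e_{n+i},e_{n+j})=0$ for $1\le i,j\le n$, and the scalar product $\langle\cdot,\cdot\rangle$ making $(e_1,\dots,e_{2n+1})$ orthonormal; this identifies $\mathbb{H}^n$ with $\mathbb{R}^{2n+1}$. $\|\cdot\|_g$ on multivectors is the norm induced by $\langle\cdot,\cdot\rangle$. $\mathcal{H}^p_E$ is the $p$-dimensional Hausdorff measure for the Euclidean distance (normalized to agree with Lebesgue measure on $p$-dimensional subspaces). A homogeneous distance $d$ is a distance with $d(zx,zy)=d(x,y)$ and $d(\delta_tx,\delta_ty)=t\,d(x,y)$; $\|x\|=d(x,0)$; $\mathbb{B}(x,r)=\{y:d(x,y)\le r\}$. Homogeneous subgroups are Lie subgroups closed under all $\delta_t$; vertical ones contain $H_2$, horizontal ones are contained in $H_1$. $\mathbb{H}^n=\mathbb{W}\rtimes\mathbb{V}$ means $\mathbb{W}$ vertical, $\mathbb{V}$ horizontal,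 $\mathbb{H}^n=\mathbb{W}\mathbb{V}$, $\mathbb{W}\cap\mathbb{V}=\{0\}$; then $x=\pi_{\mathbb{W}}(x)\pi_{\mathbb{V}}(x)$ uniquely. An h-homomorphism is a homogeneous (commuting with dilations) group homomorphism; on $\mathbb{R}^k$ dilations are $y\mapsto ty$. $f\in C^1_h(\Omega,\mathbb{R}^k)$ means that at each $x\in\Omega$ there is an h-homomorphism $Df(x):\mathbb{H}^n\to\mathbb{R}^k$ with $|f(xw)-f(x)-Df(x)(w)|=o(\|w\|)$ as $w\to0$, and $x\mapsto Df(x)$ is continuous. For scalar $f_i$, $\nabla_Hf_i(x)\in H_1$ is given by $Df_i(x)(z)=\langle\nabla_Hf_i(x),z\rangle$ for all $z$, and $\nabla_{\mathbb{V}}f_i(x)\in\mathbb{V}$ by the same identity for $z\in\mathbb{V}$. $J_Hf(x)=\|\nabla_Hf_1(x)\wedge\cdots\wedge\nabla_Hf_k(x)\|_g$, $J_{\mathbb{V}}f(x)=\|\nabla_{\mathbb{V}}f_1(x)\wedge\cdots\wedge\nabla_{\mathbb{V}}f_k(x)\|_g$. $\Sigma$ is a ($k$-codimensional, $1\le k\le n$) $\mathbb{H}$-regular surface if each $x\in\Sigma$ has an open neighbourhood $\Omega_x$ and $h\in C^1_h(\Omega_x,\mathbb{R}^k)$ with $\Sigma\cap\Omega_x=\{h=0\}$ and $\nabla_Hh_1\wedge\cdots\wedge\nabla_Hh_k\neq0$ on $\Omega_x$. For $\phi:U\to\mathbb{V}$, $U\subset\mathbb{W}$ open, $x\in\mathbb{H}^n$: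 $\sigma_x(w)=xw\,\pi_{\mathbb{V}}(x)^{-1}$ on $\mathbb{W}$, and $\phi_x(w)=\pi_{\mathbb{V}}(x)\phi(\sigma_{x^{-1}}(w))$ for $w\in\sigma_x(U)$. With $\Phi(w)=w\phi(w)$, $\phi$ is uniformly intrinsic differentiable on $U$ if for each $\bar w\in U$ there is an h-homomorphism $d\phi_{\bar w}:\mathbb{W}\to\mathbb{V}$ with $\lim_{\delta\to0}\sup_{\|\bar w^{-1}w'\|<\delta}\sup_{0<\|w\|<\delta}d(d\phi_{\bar w}(w),\phi_{\Phi(w')^{-1}}(w))/\|w\|=0$. An $\mathbb{H}$-regular surface $\Sigma$ is a parametrized $\mathbb{H}$-regular surface with respect to $(\mathbb{W},\mathbb{V})$, with parametrization $\phi$, if $\mathbb{H}^n=\mathbb{W}\rtimes\mathbb{V}$ and $\Sigma=\{u\phi(u):u\in U\}$ with $U\subset\mathbb{W}$ open and $\phi:U\to\mathbb{V}$ uniformly intrinsic differentiable. Tangent cone: $\mathrm{Tan}(\Sigma,x)$ is the set of limits $\lim_h\delta_{r_h}(x^{-1}x_h)$ with $r_h>0$, $x_h\in\Sigma$, $x_h\to x$ (here it equals $\ker Df(x)$, a $(2n+1-k)$-dimensional subspace). Spherical factor of a $p$-dimensional linear subspace $\Pi$: $\beta_d(\Pi)=\max_{z\in\mathbb{B}(0,1)}\mathcal{H}^p_E(\Pi\cap\mathbb{B}(z,1))$. Spherical $\alpha$-Federer density: $\theta^\alpha(\mu,x)=\inf_{\epsilon>0}\sup\{2^\alpha\mu(\mathbb{B}(y,r))/\mathrm{diam}(\mathbb{B}(y,r))^\alpha: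 x\in\mathbb{B}(y,r),\ 0<r<\epsilon\}$, with $\mathrm{diam}\,\mathbb{B}(y,r)=2r$.
   Formalization: (1) fails globally (f = sin of the first coordinate, Σ meets V infinitely often); proved instead: Σ is a parametrized H-regular surface near each of its points, and globally if π_W is injective on Σ (a necessary condition). (2) is proved for any parametrization of Σ or of an open part of it. *)

theory Defs
  imports "HOL-Analysis.Analysis"
begin

section \<open>The Heisenberg group\<close>

text \<open>
  \<open>\<bbbH>\<^sup>n\<close> with \<open>n = CARD('n)\<close>, in the coordinates of the fixed basis: \<open>(a, b, s)\<close> stands for
  \<open>\<Sum> a\<^sub>i e\<^sub>i + \<Sum> b\<^sub>i e\<^sub>n\<^sub>+\<^sub>i + s e\<^sub>2\<^sub>n\<^sub>+\<^sub>1\<close>. The scalar product making this basis orthonormal, the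
  Euclidean distance, the topology and the Borel sets are those of the product type.
\<close>

type_synonym 'n heis = "(real^'n) \<times> (real^'n) \<times> real"

definition H1 :: "('n::finite) heis set" where
  "H1 = {p. snd (snd p) = 0}"

definition H2 :: "('n::finite) heis set" where
  "H2 = {p. fst p = 0 \<and> fst (snd p) = 0}"

definition e_last :: "('n::finite) heis" where
  "e_last = (0, 0, 1)"

definition symp :: "('n::finite) heis \<Rightarrow> 'n heis \<Rightarrow> real" where
  "symp p q = fst p \<bullet> fst (snd q) - fst (snd p) \<bullet> fst q"

definition hmul :: "('n::finite) heis \<Rightarrow> 'n heis \<Rightarrow> 'n heis" where
  "hmul p q = p + q + (1/2) *\<^sub>R (symp p q *\<^sub>R e_last)"

definition hinv :: "('n::finite) heis \<Rightarrow> 'n heis" where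
  "hinv p = - p"

lemma hmul_hinv: "hmul p (hinv p) = 0" "hmul (hinv p) p = 0"
  by (simp_all add: hmul_def hinv_def symp_def inner_commute)

lemma hmul_assoc: "hmul (hmul p q) r = hmul p (hmul q r)"
  by (cases p; cases q; cases r)
     (simp add: hmul_def symp_def e_last_def inner_add_left inner_add_right algebra_simps
       flip: add_divide_distrib diff_divide_distrib)

definition hdil :: "real \<Rightarrow> ('n::finite) heis \<Rightarrow> 'n heis" where
  "hdil t p = (t *\<^sub>R fst p, t *\<^sub>R fst (snd p), t\<^sup>2 * snd (snd p))"

text \<open>No compatibility of \<open>d\<close> with the Euclidean topology is required: it is automatic.\<close>

definition homogeneous_distance :: "(('n::finite) heis \<Rightarrow> 'n heis \<Rightarrow> real) \<Rightarrow> bool" where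
  "homogeneous_distance d \<longleftrightarrow>
     Metric_space UNIV d \<and>
     (\<forall>x y z. d (hmul z x) (hmul z y) = d x y) \<and>
     (\<forall>t>0. \<forall>x y. d (hdil t x) (hdil t y) = t * d x y)"

definition hnorm :: "(('n::finite) heis \<Rightarrow> 'n heis \<Rightarrow> real) \<Rightarrow> 'n heis \<Rightarrow> real" where
  "hnorm d x = d x 0"

definition hcball :: "(('n::finite) heis \<Rightarrow> 'n heis \<Rightarrow> real) \<Rightarrow> 'n heis \<Rightarrow> real \<Rightarrow> 'n heis set" where
  "hcball d x r = {y. d x y \<le> r}"

definition hdiam :: "(('n::finite) heis \<Rightarrow> 'n heis \<Rightarrow> real) \<Rightarrow> 'n heis set \<Rightarrow> real" where
  "hdiam d S = (SUP (x, y)\<in>S \<times> S. d x y)"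


section \<open>Homogeneous subgroups and factorizations\<close>

text \<open>Lie subgroups are taken to be the closed subgroups.\<close>

definition homogeneous_subgroup :: "('n::finite) heis set \<Rightarrow> bool" where
  "homogeneous_subgroup S \<longleftrightarrow>
     closed S \<and> 0 \<in> S \<and> (\<forall>x\<in>S. \<forall>y\<in>S. hmul x y \<in> S) \<and> (\<forall>x\<in>S. hinv x \<in> S) \<and>
     (\<forall>t>0. \<forall>x\<in>S. hdil t x \<in> S)"

definition semidirect :: "('n::finite) heis set \<Rightarrow> 'n heis set \<Rightarrow> bool" where
  "semidirect W V \<longleftrightarrow>
     homogeneous_subgroup W \<and> H2 \<subseteq> W \<and>
     homogeneous_subgroup V \<and> V \<subseteq> H1 \<and>
     (\<forall>x. \<exists>w\<in>W. \<exists>v\<in>V. x = hmul w v) \<and> W \<inter> V = {0}"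

definition proj_W :: "('n::finite) heis set \<Rightarrow> 'n heis set \<Rightarrow> 'n heis \<Rightarrow> 'n heis" where
  "proj_W W V x = (THE w. w \<in> W \<and> (\<exists>v\<in>V. x = hmul w v))"

definition proj_V :: "('n::finite) heis set \<Rightarrow> 'n heis set \<Rightarrow> 'n heis \<Rightarrow> 'n heis" where
  "proj_V W V x = (THE v. v \<in> V \<and> (\<exists>w\<in>W. x = hmul w v))"

definition orthonormal_basis_of :: "'i set \<Rightarrow> ('i \<Rightarrow> 'a::euclidean_space) \<Rightarrow> 'a set \<Rightarrow> bool" where
  "orthonormal_basis_of I b S \<longleftrightarrow>
     (\<forall>i\<in>I. \<forall>j\<in>I. b i \<bullet> b j = (if i = j then 1 else 0)) \<and> span (b ` I) = S"


section \<open>Multivectors\<close>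

text \<open>
  An \<open>m\<close>-vector is represented, through the scalar product, by an alternating \<open>m\<close>-linear form whose
  arguments are indexed by a finite set \<open>I\<close> with \<open>m\<close> elements; \<open>wedge I u\<close> is the exterior product
  of the \<open>u i\<close>, the form \<open>z \<mapsto> det (u i \<bullet> z j)\<close>. No order of \<open>I\<close> is needed: the order in which the
  factors are listed is the order in which the arguments are listed.
  \<open>mv_norm\<close> is the norm induced by the scalar product, for which the exterior products of distinct
  elements of an orthonormal basis are orthonormal; each of them is met \<open>m!\<close> times in the sum.
\<close>

definition wedge :: "'i set \<Rightarrow> ('i \<Rightarrow> 'a::euclidean_space) \<Rightarrow> ('i \<Rightarrow> 'a) \<Rightarrow> real" where
  "wedge I u = (\<lambda>z. \<Sum>p | p permutes I. of_int (sign p) * (\<Prod>i\<in>I. u i \<bullet> z (p i)))"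

definition mv_norm :: "'i set \<Rightarrow> (('i \<Rightarrow> 'a::euclidean_space) \<Rightarrow> real) \<Rightarrow> real" where
  "mv_norm I \<xi> = sqrt ((\<Sum>z\<in>I \<rightarrow>\<^sub>E Basis. (\<xi> z)\<^sup>2) / fact (card I))"


section \<open>Horizontal differentiability\<close>

definition h_hom :: "(('n::finite) heis \<Rightarrow> 'b::real_normed_vector) \<Rightarrow> bool" where
  "h_hom L \<longleftrightarrow>
     (\<forall>x y. L (hmul x y) = L x + L y) \<and> (\<forall>t>0. \<forall>x. L (hdil t x) = t *\<^sub>R L x)"

definition has_h_derivative ::
  "(('n::finite) heis \<Rightarrow> 'n heis \<Rightarrow> real) \<Rightarrow> ('n heis \<Rightarrow> 'b::real_normed_vector)
    \<Rightarrow> ('n heis \<Rightarrow> 'b) \<Rightarrow> 'n heis \<Rightarrow> bool" where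
  "has_h_derivative d f L x \<longleftrightarrow>
     h_hom L \<and> ((\<lambda>w. norm (f (hmul x w) - f x - L w) / hnorm d w) \<longlongrightarrow> 0) (at 0)"

definition h_deriv ::
  "(('n::finite) heis \<Rightarrow> 'n heis \<Rightarrow> real) \<Rightarrow> ('n heis \<Rightarrow> 'b::real_normed_vector)
    \<Rightarrow> 'n heis \<Rightarrow> 'n heis \<Rightarrow> 'b" where
  "h_deriv d f x = (THE L. has_h_derivative d f L x)"

text \<open>Continuity of the differential is with respect to the operator norm.\<close>

definition C1h ::
  "(('n::finite) heis \<Rightarrow> 'n heis \<Rightarrow> real) \<Rightarrow> 'n heis set \<Rightarrow> ('n heis \<Rightarrow> 'b::real_normed_vector)
    \<Rightarrow> bool" where
  "C1h d \<Omega> f \<longleftrightarrow>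
     (\<forall>x\<in>\<Omega>. \<exists>L. has_h_derivative d f L x) \<and>
     (\<forall>x\<in>\<Omega>. uniform_limit {w. hnorm d w \<le> 1} (h_deriv d f) (h_deriv d f x) (at x within \<Omega>))"

definition grad_H ::
  "(('n::finite) heis \<Rightarrow> 'n heis \<Rightarrow> real) \<Rightarrow> ('n heis \<Rightarrow> real) \<Rightarrow> 'n heis \<Rightarrow> 'n heis" where
  "grad_H d f x = (THE g. g \<in> H1 \<and> (\<forall>z. h_deriv d f x z = g \<bullet> z))"

definition grad_V ::
  "(('n::finite) heis \<Rightarrow> 'n heis \<Rightarrow> real) \<Rightarrow> 'n heis set \<Rightarrow> ('n heis \<Rightarrow> real) \<Rightarrow> 'n heis \<Rightarrow> 'n heis" where
  "grad_V d V f x = (THE g. g \<in> V \<and> (\<forall>z\<in>V. h_deriv d f x z = g \<bullet> z))"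

definition J_H ::
  "(('n::finite) heis \<Rightarrow> 'n heis \<Rightarrow> real) \<Rightarrow> ('n heis \<Rightarrow> real^('k::finite)) \<Rightarrow> 'n heis \<Rightarrow> real" where
  "J_H d f x = mv_norm (UNIV::'k set) (wedge UNIV (\<lambda>i. grad_H d (\<lambda>y. f y $ i) x))"

definition J_V ::
  "(('n::finite) heis \<Rightarrow> 'n heis \<Rightarrow> real) \<Rightarrow> 'n heis set \<Rightarrow> ('n heis \<Rightarrow> real^('k::finite))
    \<Rightarrow> 'n heis \<Rightarrow> real" where
  "J_V d V f x = mv_norm (UNIV::'k set) (wedge UNIV (\<lambda>i. grad_V d V (\<lambda>y. f y $ i) x))"


section \<open>Regular surfaces and intrinsic graphs\<close>

text \<open>The codimension is \<open>CARD('k)\<close>.\<close>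

definition H_regular_surface ::
  "('k::finite) itself \<Rightarrow> (('n::finite) heis \<Rightarrow> 'n heis \<Rightarrow> real) \<Rightarrow> 'n heis set \<Rightarrow> bool" where
  "H_regular_surface _ d S \<longleftrightarrow>
     CARD('k) \<le> CARD('n) \<and>
     (\<forall>x\<in>S. \<exists>\<Omega> h. open \<Omega> \<and> x \<in> \<Omega> \<and> C1h d \<Omega> (h :: 'n heis \<Rightarrow> real^'k) \<and>
        S \<inter> \<Omega> = {y\<in>\<Omega>. h y = 0} \<and>
        (\<forall>y\<in>\<Omega>. wedge (UNIV::'k set) (\<lambda>i. grad_H d (\<lambda>z. h z $ i) y) \<noteq> (\<lambda>_. 0)))"

definition sigma_tr ::
  "('n::finite) heis set \<Rightarrow> 'n heis set \<Rightarrow> 'n heis \<Rightarrow> 'n heis \<Rightarrow> 'n heis" where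
  "sigma_tr W V x w = hmul (hmul x w) (hinv (proj_V W V x))"

definition phi_tr ::
  "('n::finite) heis set \<Rightarrow> 'n heis set \<Rightarrow> ('n heis \<Rightarrow> 'n heis) \<Rightarrow> 'n heis \<Rightarrow> 'n heis \<Rightarrow> 'n heis" where
  "phi_tr W V \<phi> x w = hmul (proj_V W V x) (\<phi> (sigma_tr W V (hinv x) w))"

definition h_hom_on ::
  "('n::finite) heis set \<Rightarrow> 'n heis set \<Rightarrow> ('n heis \<Rightarrow> 'n heis) \<Rightarrow> bool" where
  "h_hom_on W V L \<longleftrightarrow>
     L ` W \<subseteq> V \<and> (\<forall>x\<in>W. \<forall>y\<in>W. L (hmul x y) = hmul (L x) (L y)) \<and>
     (\<forall>t>0. \<forall>x\<in>W. L (hdil t x) = hdil t (L x))"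

text \<open>The suprema range over the points at which the translated function is defined.\<close>

definition unif_intrinsic_diff ::
  "(('n::finite) heis \<Rightarrow> 'n heis \<Rightarrow> real) \<Rightarrow> 'n heis set \<Rightarrow> 'n heis set \<Rightarrow> 'n heis set
    \<Rightarrow> ('n heis \<Rightarrow> 'n heis) \<Rightarrow> bool" where
  "unif_intrinsic_diff d W V U \<phi> \<longleftrightarrow>
     (\<forall>w0\<in>U. \<exists>L. h_hom_on W V L \<and>
       ((\<lambda>\<delta>. SUP w'\<in>{w'\<in>U. hnorm d (hmul (hinv w0) w') < \<delta>}.
             SUP w\<in>{w \<in> sigma_tr W V (hinv (hmul w' (\<phi> w'))) ` U. 0 < hnorm d w \<and> hnorm d w < \<delta>}.
               ennreal (d (L w) (phi_tr W V \<phi> (hinv (hmul w' (\<phi> w'))) w) / hnorm d w))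
         \<longlongrightarrow> 0) (at_right 0))"

text \<open>\<open>S\<close> is a parametrized \<open>\<bbbH>\<close>-regular surface of codimension \<open>CARD('k)\<close> with parametrization \<open>\<phi> : U \<rightarrow> V\<close>.\<close>

definition H_parametrized ::
  "('k::finite) itself \<Rightarrow> (('n::finite) heis \<Rightarrow> 'n heis \<Rightarrow> real) \<Rightarrow> 'n heis set \<Rightarrow> 'n heis set
    \<Rightarrow> 'n heis set \<Rightarrow> 'n heis set \<Rightarrow> ('n heis \<Rightarrow> 'n heis) \<Rightarrow> bool" where
  "H_parametrized K d W V S U \<phi> \<longleftrightarrow>
     H_regular_surface K d S \<and> semidirect W V \<and>
     openin (top_of_set W) U \<and> \<phi> ` U \<subseteq> V \<and> unif_intrinsic_diff d W V U \<phi> \<and>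
     S = {hmul u (\<phi> u) |u. u \<in> U}"


section \<open>Hausdorff measure, tangent cone, spherical factor, Federer density\<close>

text \<open>
  The normalizing constant \<open>unit_ball_vol p / 2 ^ p\<close> is the one for which the \<open>p\<close>-dimensional
  Hausdorff measure agrees with Lebesgue measure on \<open>p\<close>-dimensional subspaces.
  The outer measure is countably additive on Borel sets, so \<open>emeasure (hausdorff_measure p)\<close>
  agrees with it there.
\<close>

definition hausdorff_pre :: "nat \<Rightarrow> real \<Rightarrow> 'a::euclidean_space set \<Rightarrow> ennreal" where
  "hausdorff_pre p \<delta> A =
     (INF C\<in>{C :: nat \<Rightarrow> 'a set. A \<subseteq> (\<Union>i. C i) \<and> (\<forall>i. bounded (C i) \<and> diameter (C i) \<le> \<delta>)}.
        \<Sum>i. if C i = {} then 0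
             else ennreal (unit_ball_vol (real p) * (diameter (C i) / 2) ^ p))"

definition hausdorff_outer :: "nat \<Rightarrow> 'a::euclidean_space set \<Rightarrow> ennreal" where
  "hausdorff_outer p A = (SUP \<delta>\<in>{0<..}. hausdorff_pre p \<delta> A)"

definition hausdorff_measure :: "nat \<Rightarrow> 'a::euclidean_space measure" where
  "hausdorff_measure p = measure_of UNIV (sets borel) (hausdorff_outer p)"

definition Tan :: "('n::finite) heis set \<Rightarrow> 'n heis \<Rightarrow> 'n heis set" where
  "Tan S x = {v. \<exists>r X. (\<forall>h. r h > 0 \<and> X h \<in> S) \<and> X \<longlonglongrightarrow> x \<and>
                     (\<lambda>h::nat. hdil (r h) (hmul (hinv x) (X h))) \<longlonglongrightarrow> v}"

definition spherical_factor ::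
  "(('n::finite) heis \<Rightarrow> 'n heis \<Rightarrow> real) \<Rightarrow> 'n heis set \<Rightarrow> ennreal" where
  "spherical_factor d P =
     (GREATEST m. \<exists>z\<in>hcball d 0 1. m = emeasure (hausdorff_measure (dim P)) (P \<inter> hcball d z 1))"

text \<open>The measure enters only through its values on Borel sets and is given as a set function.\<close>

definition federer_density ::
  "(('n::finite) heis \<Rightarrow> 'n heis \<Rightarrow> real) \<Rightarrow> real \<Rightarrow> ('n heis set \<Rightarrow> ennreal) \<Rightarrow> 'n heis \<Rightarrow> ennreal" where
  "federer_density d \<alpha> \<mu> x =
     (INF \<epsilon>\<in>{0<..}. SUP (y, r)\<in>{(y, r). x \<in> hcball d y r \<and> 0 < r \<and> r < \<epsilon>}.
        ennreal (2 powr \<alpha>) * \<mu> (hcball d y r) / ennreal (hdiam d (hcball d y r) powr \<alpha>))"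

end

theory Submission
  imports Defs
begin

text \<open>
  Every element of the group is a product of boundedly many horizontal ones of comparable size, so
  the mean value inequality along horizontal segments makes \<open>f\<close> strictly differentiable. As \<open>Df\<close> is
  invertible on \<open>V\<close>, the Banach fixed point theorem solves \<open>f(w v) = f(x)\<close> for \<open>v \<in> V\<close> near each
  point. Strict differentiability then yields the uniform intrinsic differentiability of the
  graph map, with differential \<open>L = - (Df|V)\<^sup>-\<^sup>1 \<circ> Df|W\<close>.

  For the density, the part of the graph in a ball of radius \<open>r\<close> that contains \<open>x\<close>, once rescaled by
  \<open>1 / r\<close>, lies between the parts of \<open>P = ker Df(x)\<close> in concentric balls of radii \<open>1 - \<eta>\<close> and \<open>1 + \<eta>\<close>.
  So \<open>\<mu>\<close> of the ball, divided by \<open>r ^ Q\<close>, is close to \<open>|V \<and> N| J\<^sub>H f(x) / J\<^sub>V f(x)\<close> times the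
  Hausdorff measure of the corresponding subset of \<open>W\<close>, and the graph map \<open>z \<mapsto> z L(z)\<close> of \<open>W\<close> onto \<open>P\<close>
  turns this into the Hausdorff measure of the subset of \<open>P\<close>. The Jacobian of that map comes from
  comparing Lebesgue measures of slabs \<open>{y. \<pi> y \<in> A, |y - \<pi> y| \<le> 1}\<close> over \<open>W\<close> and over \<open>P\<close>, with
  projections along \<open>V\<close>: the slabs correspond under volume-preserving shears, and the Hausdorff
  measure of a subset of \<open>P\<close> is the volume of the slab over it divided by the volume of the frame
  formed by orthonormal bases of \<open>V\<close> and \<open>P\<close>, up to a constant that depends on dimensions only.
  The same constant occurs for \<open>W\<close>, hence its value (the isodiametric inequality) plays no role.
\<close>

section \<open>Hausdorff measure\<close>

text \<open>The parametrization \<phi> is only intrinsically differentiable, so neither Euclidean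
  Lipschitz bounds nor an area formula can be used for the graph map. Measures are computed only on
  sets with explicit models: the piece of the graph in a ball is caught between two images of
  subsets of W under a dilation followed by a group translation, and
  \<open>hausdorff_translate_dilate\<close> gives the measure of such images. As only monotonicity
  of the integral enters, no measurability of \<phi> has to be established. The density takes a
  supremum over all balls that contain x, not only over those centred at x. After rescaling, their
  centres range over the closed unit ball, so every estimate has to be uniform in the centre. In the
  limit there remains the largest section of P by a unit ball with centre in the unit ball, which is
  the spherical factor. The exponent of the density exceeds dim W by one because the dilation by r
  multiplies horizontal lengths by r but vertical ones by the square of r.\<close>

definition hausdorff_cost :: "nat \<Rightarrow> 'a::euclidean_space set \<Rightarrow> ennreal" where
  "hausdorff_cost p C = (if C = {} then 0 else ennreal (unit_ball_vol (real p) * (diameter C / 2) ^ p))"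

definition hausdorff_covers :: "real \<Rightarrow> 'a::euclidean_space set \<Rightarrow> (nat \<Rightarrow> 'a set) set" where
  "hausdorff_covers \<delta> A = {C. A \<subseteq> (\<Union>i. C i) \<and> (\<forall>i. bounded (C i) \<and> diameter (C i) \<le> \<delta>)}"

lemma hausdorff_pre_alt:
  "hausdorff_pre p \<delta> A = (INF C\<in>hausdorff_covers \<delta> A. \<Sum>i. hausdorff_cost p (C i))"
  by (simp add: hausdorff_pre_def hausdorff_cost_def hausdorff_covers_def)

lemma hausdorff_pre_le: "C \<in> hausdorff_covers \<delta> A \<Longrightarrow> hausdorff_pre p \<delta> A \<le> (\<Sum>i. hausdorff_cost p (C i))"
  unfolding hausdorff_pre_alt by (rule INF_lower)

lemma hausdorff_pre_mono: "A \<subseteq> B \<Longrightarrow> hausdorff_pre p \<delta> A \<le> hausdorff_pre p \<delta> B"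
  unfolding hausdorff_pre_alt by (intro INF_superset_mono) (auto simp: hausdorff_covers_def)

lemma hausdorff_pre_antimono: "\<delta> \<le> \<delta>' \<Longrightarrow> hausdorff_pre p \<delta>' A \<le> hausdorff_pre p \<delta> A"
  unfolding hausdorff_pre_alt
  by (intro INF_superset_mono) (auto simp: hausdorff_covers_def intro: order_trans)

lemma hausdorff_pre_empty [simp]: "0 \<le> \<delta> \<Longrightarrow> hausdorff_pre p \<delta> {} = 0"
  using hausdorff_pre_le[of "\<lambda>_. {}" \<delta> "{}" p]
  by (simp add: hausdorff_covers_def hausdorff_cost_def)

text \<open>Covers that are optimal up to \<open>e * (1/2)^Suc n\<close> are merged into one
  sequence along \<open>prod_decode\<close>; the errors add up to \<open>e\<close>. The scale
  \<delta> is inherited because it bounds each member separately.\<close>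

lemma hausdorff_pre_UN_le:
  "hausdorff_pre p \<delta> (\<Union>n::nat. A n) \<le> (\<Sum>n. hausdorff_pre p \<delta> (A n))"
proof (rule ennreal_le_epsilon)
  fix e :: real assume "0 < e" "(\<Sum>n. hausdorff_pre p \<delta> (A n)) < top"
  then have *: "hausdorff_pre p \<delta> (A n) < hausdorff_pre p \<delta> (A n) + e * (1/2)^Suc n" for n
    by (auto simp add: less_top dest!: ennreal_suminf_lessD)
  have "\<exists>C\<in>hausdorff_covers \<delta> (A n).
      (\<Sum>i. hausdorff_cost p (C i)) \<le> hausdorff_pre p \<delta> (A n) + e * (1/2)^Suc n" for n
    using *[of n] unfolding hausdorff_pre_alt INF_less_iff by (auto intro: less_imp_le)
  then obtain B where B: "B n \<in> hausdorff_covers \<delta> (A n)"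
      "(\<Sum>i. hausdorff_cost p (B n i)) \<le> hausdorff_pre p \<delta> (A n) + e * (1/2)^Suc n" for n
    by metis
  define C where "C = case_prod B o prod_decode"
  have "(\<Union>i. A i) \<subseteq> (\<Union>i. C i)"
  proof
    fix x assume "x \<in> (\<Union>i. A i)"
    then obtain n i where "x \<in> B n i" using B(1) unfolding hausdorff_covers_def by blast
    then show "x \<in> (\<Union>i. C i)" by (auto simp: C_def intro!: exI[of _ "prod_encode (n,i)"])
  qed
  then have "C \<in> hausdorff_covers \<delta> (\<Union>n. A n)"
    using B(1) by (auto simp: hausdorff_covers_def C_def split_def)
  then have "hausdorff_pre p \<delta> (\<Union>n. A n) \<le> (\<Sum>i. hausdorff_cost p (C i))"
    by (rule hausdorff_pre_le)
  also have "\<dots> = (\<Sum>i. (case_prod (\<lambda>n i. hausdorff_cost p (B n i)) \<circ> prod_decode) i)"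
    by (simp add: C_def split_def)
  also have "\<dots> = (\<Sum>n. \<Sum>i. hausdorff_cost p (B n i))"
    unfolding comp_def by (intro suminf_ennreal_2dimen) auto
  also have "\<dots> \<le> (\<Sum>n. hausdorff_pre p \<delta> (A n) + e * (1/2) ^ Suc n)"
    by (intro suminf_le allI B(2)) auto
  also have "\<dots> = (\<Sum>n. hausdorff_pre p \<delta> (A n)) + (\<Sum>n. ennreal e * ennreal ((1/2) ^ Suc n))"
    using \<open>0 < e\<close> by (subst suminf_add[symmetric])
                     (auto simp del: ennreal_suminf_cmult simp add: ennreal_mult[symmetric])
  also have "\<dots> = (\<Sum>n. hausdorff_pre p \<delta> (A n)) + e"
    unfolding ennreal_suminf_cmult
    by (subst suminf_ennreal_eq[OF zero_le_power power_half_series]) auto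
  finally show "hausdorff_pre p \<delta> (\<Union>n. A n) \<le> (\<Sum>n. hausdorff_pre p \<delta> (A n)) + e" .
qed

lemma hausdorff_outer_mono: "A \<subseteq> B \<Longrightarrow> hausdorff_outer p A \<le> hausdorff_outer p B"
  unfolding hausdorff_outer_def by (intro SUP_mono) (auto intro: hausdorff_pre_mono)

lemma hausdorff_outer_empty [simp]: "hausdorff_outer p {} = 0"
  unfolding hausdorff_outer_def by (auto intro!: antisym SUP_least)

lemma hausdorff_pre_le_outer: "0 < \<delta> \<Longrightarrow> hausdorff_pre p \<delta> A \<le> hausdorff_outer p A"
  unfolding hausdorff_outer_def by (rule SUP_upper) auto

lemma hausdorff_outer_UN_le:
  "hausdorff_outer p (\<Union>n::nat. A n) \<le> (\<Sum>n. hausdorff_outer p (A n))"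
  unfolding hausdorff_outer_def[of p "\<Union>n. A n"]
proof (rule SUP_least)
  fix \<delta> :: real assume "\<delta> \<in> {0<..}"
  then have "(\<Sum>n. hausdorff_pre p \<delta> (A n)) \<le> (\<Sum>n. hausdorff_outer p (A n))"
    by (intro suminf_le) (auto intro: hausdorff_pre_le_outer)
  with hausdorff_pre_UN_le show "hausdorff_pre p \<delta> (\<Union>n. A n) \<le> (\<Sum>n. hausdorff_outer p (A n))"
    by (rule order_trans)
qed

lemma hausdorff_pre_Un_le:
  assumes "0 \<le> \<delta>"
  shows "hausdorff_pre p \<delta> (A \<union> B) \<le> hausdorff_pre p \<delta> A + hausdorff_pre p \<delta> B"
proof -
  let ?A = "\<lambda>n::nat. if n = 0 then A else if n = 1 then B else {}"
  have "A \<union> B = (\<Union>n. ?A n)" by (auto split: if_splits)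
  then have "hausdorff_pre p \<delta> (A \<union> B) \<le> (\<Sum>n. hausdorff_pre p \<delta> (?A n))"
    using hausdorff_pre_UN_le[where A = ?A] by metis
  also have "\<dots> = (\<Sum>n\<in>{0,1}. hausdorff_pre p \<delta> (?A n))"
    using assms by (intro suminf_finite) auto
  finally show ?thesis by simp
qed

lemma hausdorff_pre_finite_UN_le:
  assumes "0 \<le> \<delta>" "finite J"
  shows "hausdorff_pre p \<delta> (\<Union>j\<in>J. A j) \<le> (\<Sum>j\<in>J. hausdorff_pre p \<delta> (A j))"
  using assms(2)
proof (induction J rule: finite_induct)
  case (insert j J)
  have "hausdorff_pre p \<delta> (\<Union>j\<in>insert j J. A j) \<le> hausdorff_pre p \<delta> (A j) + hausdorff_pre p \<delta> (\<Union>j\<in>J. A j)"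
    using hausdorff_pre_Un_le[OF assms(1)] by simp
  with insert show ?case by (simp add: order_trans[OF _ add_left_mono])
qed (use assms in simp)

lemma hausdorff_outer_Un_le: "hausdorff_outer p (A \<union> B) \<le> hausdorff_outer p A + hausdorff_outer p B"
  unfolding hausdorff_outer_def[of p "A \<union> B"]
proof (rule SUP_least)
  fix \<delta> :: real assume "\<delta> \<in> {0<..}"
  then show "hausdorff_pre p \<delta> (A \<union> B) \<le> hausdorff_outer p A + hausdorff_outer p B"
    by (intro order_trans[OF hausdorff_pre_Un_le add_mono] hausdorff_pre_le_outer) auto
qed

section \<open>Caratheodory's criterion: Borel sets are measurable for the Hausdorff outer
  measure\<close>

lemma hausdorff_covers_restrict:
  assumes "C \<in> hausdorff_covers \<delta> B" "A \<subseteq> B" "0 \<le> \<delta>"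
  shows "(\<lambda>i. if C i \<inter> A = {} then {} else C i) \<in> hausdorff_covers \<delta> A"
proof -
  have "A \<subseteq> (\<Union>i. if C i \<inter> A = {} then {} else C i)"
  proof
    fix x assume "x \<in> A"
    then obtain i where "x \<in> C i" using assms by (auto simp: hausdorff_covers_def)
    then show "x \<in> (\<Union>i. if C i \<inter> A = {} then {} else C i)"
      using \<open>x \<in> A\<close> by (intro UN_I[of i]) auto
  qed
  then show ?thesis using assms by (simp add: hausdorff_covers_def)
qed

text \<open>At a scale below the gap r no member of a cover meets both sets, so a cover of the union
  splits into a cover of each and no cost is counted twice.\<close>

lemma hausdorff_outer_separated:
  assumes "0 < r" and sep: "\<And>x y. x \<in> A \<Longrightarrow> y \<in> B \<Longrightarrow> r \<le> dist x y"
  shows "hausdorff_outer p A + hausdorff_outer p B \<le> hausdorff_outer p (A \<union> B)"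
proof -
  have pre: "hausdorff_pre p \<delta> A + hausdorff_pre p \<delta> B \<le> hausdorff_pre p \<delta> (A \<union> B)"
    if \<delta>: "0 < \<delta>" "\<delta> < r" for \<delta>
    unfolding hausdorff_pre_alt[of p \<delta> "A \<union> B"]
  proof (rule INF_greatest)
    fix C assume C: "C \<in> hausdorff_covers \<delta> (A \<union> B)"
    define CA where "CA i = (if C i \<inter> A = {} then {} else C i)" for i
    define CB where "CB i = (if C i \<inter> B = {} then {} else C i)" for i
    have "CA \<in> hausdorff_covers \<delta> A" "CB \<in> hausdorff_covers \<delta> B"
      using hausdorff_covers_restrict[OF C, of A] hausdorff_covers_restrict[OF C, of B] \<delta>
      by (simp_all add: CA_def[abs_def] CB_def[abs_def])
    then have "hausdorff_pre p \<delta> A + hausdorff_pre p \<delta> B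
        \<le> (\<Sum>i. hausdorff_cost p (CA i)) + (\<Sum>i. hausdorff_cost p (CB i))"
      by (intro add_mono hausdorff_pre_le)
    also have "\<dots> = (\<Sum>i. hausdorff_cost p (CA i) + hausdorff_cost p (CB i))"
      by (rule suminf_add) auto
    also have "\<dots> \<le> (\<Sum>i. hausdorff_cost p (C i))"
    proof (intro suminf_le allI)
      fix i
      have "C i \<inter> A = {} \<or> C i \<inter> B = {}"
      proof (rule ccontr)
        assume "\<not> ?thesis"
        then obtain x y where "x \<in> C i" "x \<in> A" "y \<in> C i" "y \<in> B" by auto
        moreover have "dist x y \<le> diameter (C i)"
          using C \<open>x \<in> C i\<close> \<open>y \<in> C i\<close> by (intro diameter_bounded_bound) (auto simp: hausdorff_covers_def)
        moreover have "diameter (C i) \<le> \<delta>" using C by (auto simp: hausdorff_covers_def)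
        ultimately show False using sep[of x y] \<delta> by linarith
      qed
      then show "hausdorff_cost p (CA i) + hausdorff_cost p (CB i) \<le> hausdorff_cost p (C i)"
        by (auto simp: CA_def CB_def hausdorff_cost_def)
    qed auto
    finally show "hausdorff_pre p \<delta> A + hausdorff_pre p \<delta> B \<le> (\<Sum>i. hausdorff_cost p (C i))" .
  qed
  \<comment> \<open>The two suprema over scales are independent of each other; by antimonotonicity
    both scales may be replaced by a common one below r.\<close>
  have "hausdorff_pre p \<delta>1 A + hausdorff_pre p \<delta>2 B \<le> hausdorff_outer p (A \<union> B)"
    if "0 < \<delta>1" "0 < \<delta>2" for \<delta>1 \<delta>2
  proof -
    define \<delta> where "\<delta> = min (r/2) (min \<delta>1 \<delta>2)"
    have "hausdorff_pre p \<delta>1 A + hausdorff_pre p \<delta>2 B \<le> hausdorff_pre p \<delta> A + hausdorff_pre p \<delta> B"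
      by (intro add_mono hausdorff_pre_antimono) (auto simp: \<delta>_def)
    also have "\<dots> \<le> hausdorff_pre p \<delta> (A \<union> B)"
      using that \<open>0 < r\<close> by (intro pre) (auto simp: \<delta>_def min_def)
    also have "\<dots> \<le> hausdorff_outer p (A \<union> B)"
      using that \<open>0 < r\<close> by (intro hausdorff_pre_le_outer) (auto simp: \<delta>_def)
    finally show ?thesis .
  qed
  then have "(SUP \<delta>1\<in>{0<..}. hausdorff_pre p \<delta>1 A + hausdorff_outer p B) \<le> hausdorff_outer p (A \<union> B)"
    unfolding hausdorff_outer_def[of p B] add.commute[of "hausdorff_pre p _ A"]
    by (subst ennreal_SUP_add_left[symmetric]) (auto intro!: SUP_least simp: add.commute)
  then show ?thesis
    unfolding hausdorff_outer_def[of p A] by (subst ennreal_SUP_add_left[symmetric]) auto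
qed

text \<open>Induction on n: \<open>R n\<close> is separated from the union of the earlier sets by
  the least of finitely many pairwise gaps.\<close>

lemma hausdorff_outer_separated_sum:
  assumes "\<And>i j. i < j \<Longrightarrow> \<exists>r>0. \<forall>x\<in>R i. \<forall>y\<in>R (j::nat). r \<le> dist x y"
  shows "(\<Sum>i<n. hausdorff_outer p (R i)) \<le> hausdorff_outer p (\<Union>i<n. R i)"
proof (induction n)
  case (Suc n)
  have "\<exists>r>0. \<forall>i<n. \<forall>x\<in>R i. \<forall>y\<in>R n. r \<le> dist x y"
  proof -
    obtain r where r: "\<And>i. i < n \<Longrightarrow> r i > 0 \<and> (\<forall>x\<in>R i. \<forall>y\<in>R n. r i \<le> dist x y)"
      using assms[of _ n] by metis
    define r0 where "r0 = Min (insert 1 (r ` {..<n}))"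
    have "r0 > 0" unfolding r0_def using r by (subst Min_gr_iff) auto
    moreover have "r0 \<le> r i" if "i < n" for i unfolding r0_def using that by (intro Min_le) auto
    ultimately show ?thesis using r by (intro exI[of _ r0]) (force intro: order_trans)
  qed
  then obtain r where "r > 0" and r: "\<And>x y i. i < n \<Longrightarrow> x \<in> R i \<Longrightarrow> y \<in> R n \<Longrightarrow> r \<le> dist x y" by blast
  have "(\<Sum>i<Suc n. hausdorff_outer p (R i)) \<le> hausdorff_outer p (\<Union>i<n. R i) + hausdorff_outer p (R n)"
    using Suc by (simp add: add_right_mono)
  also have "\<dots> \<le> hausdorff_outer p ((\<Union>i<n. R i) \<union> R n)"
    by (rule hausdorff_outer_separated[OF \<open>r > 0\<close>]) (use r in auto)
  also have "(\<Union>i<n. R i) \<union> R n = (\<Union>i<Suc n. R i)" by (auto simp: less_Suc_eq)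
  finally show ?case .
qed simp

lemma ennreal_suminf_tail_small:
  fixes r :: "nat \<Rightarrow> ennreal"
  assumes "(\<Sum>i. r i) < top" "0 < e"
  shows "\<exists>n. (\<Sum>i. r (i + n)) \<le> ennreal e"
proof -
  have "r i < top" for i using assms(1) by (rule ennreal_suminf_lessD)
  then have rr: "r i = ennreal (enn2real (r i))" for i by (simp add: less_top)
  have sm: "summable (\<lambda>i. enn2real (r i))"
    using assms(1) rr by (intro summable_suminf_not_top) (auto simp flip: rr)
  from suminf_exist_split[OF assms(2) sm] obtain n where n: "norm (\<Sum>i. enn2real (r (i+n))) < e" by auto
  have "(\<Sum>i. r (i + n)) = ennreal (\<Sum>i. enn2real (r (i+n)))"
    by (subst rr, rule suminf_ennreal2) (use summable_ignore_initial_segment[OF sm] in auto)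
  then show ?thesis using n by (auto intro!: exI[of _ n] ennreal_leI)
qed

text \<open>\<open>D n\<close> keeps a positive distance from F, and the rings \<open>R n\<close>
  exhaust the rest of A - F. Rings of equal parity are separated from each other, so the measures of
  all rings add up to at most twice that of A. Hence the tail of the rings is negligible and
  \<open>D n\<close> carries almost all of A - F.\<close>

lemma closed_hausdorff_caratheodory:
  assumes "closed F"
  shows "hausdorff_outer p (A \<inter> F) + hausdorff_outer p (A - F) \<le> hausdorff_outer p A"
proof (cases "F = {} \<or> hausdorff_outer p A = top")
  case False
  then have F: "F \<noteq> {}" and fin: "hausdorff_outer p A < top" by (auto simp: less_top)
  define D where "D n = {x\<in>A. infdist x F \<ge> 1 / (real n + 1)}" for n
  define R where "R n = {x\<in>A. 1 / (real n + 2) \<le> infdist x F \<and> infdist x F < 1 / (real n + 1)}" for n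
  have sep: "dist x y \<ge> infdist x F - infdist y F" for x y
    using infdist_triangle[of x F y] by linarith
  have Rsum: "(\<Sum>i<n. hausdorff_outer p (R (2*i+c))) \<le> hausdorff_outer p A" for n c
  proof -
    have "(\<Sum>i<n. hausdorff_outer p (R (2*i+c))) \<le> hausdorff_outer p (\<Union>i<n. R (2*i+c))"
    proof (rule hausdorff_outer_separated_sum)
      fix i j :: nat assume "i < j"
      \<comment> \<open>Since \<open>2*i+c+2 < 2*j+c+1\<close>, the ring skipped between two rings
        of equal parity leaves a gap.\<close>
      then have "1 / (real (2*i+c) + 2) > 1 / (real (2*j+c) + 1)"
        by (intro divide_strict_left_mono) auto
      then show "\<exists>r>0. \<forall>x\<in>R (2*i+c). \<forall>y\<in>R (2*j+c). r \<le> dist x y"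
        by (intro exI[of _ "1 / (real (2*i+c) + 2) - 1 / (real (2*j+c) + 1)"])
           (auto simp: R_def intro: order_trans[OF _ sep])
    qed
    also have "\<dots> \<le> hausdorff_outer p A" by (intro hausdorff_outer_mono) (auto simp: R_def)
    finally show ?thesis .
  qed
  have "(\<Sum>i<n. hausdorff_outer p (R i)) \<le> hausdorff_outer p A + hausdorff_outer p A" for n
  proof -
    have "(\<Sum>i<n. hausdorff_outer p (R i)) \<le> (\<Sum>i<2*n. hausdorff_outer p (R i))"
      by (intro sum_mono2) auto
    also have "\<dots> = (\<Sum>i<n. hausdorff_outer p (R (2*i+0))) + (\<Sum>i<n. hausdorff_outer p (R (2*i+1)))"
      by (induction n) (simp_all add: algebra_simps)
    also have "\<dots> \<le> hausdorff_outer p A + hausdorff_outer p A" by (intro add_mono Rsum)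
    finally show ?thesis .
  qed
  then have "(\<Sum>i. hausdorff_outer p (R i)) \<le> hausdorff_outer p A + hausdorff_outer p A"
    by (intro suminf_le_const) auto
  also have "\<dots> < top" using fin by simp
  finally have Rfin: "(\<Sum>i. hausdorff_outer p (R i)) < top" .
  show ?thesis
  proof (rule ennreal_le_epsilon)
    fix e :: real assume "0 < e"
    then obtain n where n: "(\<Sum>i. hausdorff_outer p (R (i + n))) \<le> ennreal e"
      using ennreal_suminf_tail_small[OF Rfin] by blast
    have "A - F \<subseteq> D n \<union> (\<Union>i. R (i + n))"
    proof
      fix x assume x: "x \<in> A - F"
      then have pos: "infdist x F > 0"
        using assms F in_closed_iff_infdist_zero[of F x] infdist_nonneg[of x F] by fastforce
      show "x \<in> D n \<union> (\<Union>i. R (i + n))"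
      proof (cases "x \<in> D n")
        case False
        obtain j0 where "inverse (real (Suc j0)) < infdist x F" using reals_Archimedean[OF pos] by auto
        then have ex: "1 / (real j0 + 1) \<le> infdist x F" by (simp add: inverse_eq_divide add.commute)
        \<comment> \<open>The first j with x in \<open>D j\<close> exceeds n; x misses
          \<open>D (j - 1)\<close> and so lies in the ring with index j - 1.\<close>
        define j where "j = (LEAST j. 1 / (real j + 1) \<le> infdist x F)"
        have j: "1 / (real j + 1) \<le> infdist x F" unfolding j_def
          by (rule LeastI[of "\<lambda>j. 1 / (real j + 1) \<le> infdist x F", OF ex])
        have "n < j"
        proof (rule ccontr)
          assume "\<not> n < j"
          then have "1 / (real n + 1) \<le> 1 / (real j + 1)" by (intro divide_left_mono) auto
          then show False using j False x by (auto simp: D_def)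
        qed
        then obtain i where i: "j = i + n + 1" by (metis add.commute less_imp_add_positive Suc_eq_plus1 gr0_conv_Suc add.assoc)
        have "\<not> 1 / (real (i+n) + 1) \<le> infdist x F"
          using not_less_Least[of "i+n" "\<lambda>j. 1 / (real j + 1) \<le> infdist x F"] i unfolding j_def by auto
        then have "x \<in> R (i + n)" using j x i by (auto simp: R_def algebra_simps)
        then show ?thesis by blast
      qed auto
    qed
    then have "hausdorff_outer p (A - F) \<le> hausdorff_outer p (D n \<union> (\<Union>i. R (i + n)))"
      by (rule hausdorff_outer_mono)
    also have "\<dots> \<le> hausdorff_outer p (D n) + hausdorff_outer p (\<Union>i. R (i + n))"
      by (rule hausdorff_outer_Un_le)
    also have "\<dots> \<le> hausdorff_outer p (D n) + ennreal e"
      by (intro add_left_mono order_trans[OF hausdorff_outer_UN_le n])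
    finally have 1: "hausdorff_outer p (A - F) \<le> hausdorff_outer p (D n) + ennreal e" .
    have "hausdorff_outer p (A \<inter> F) + hausdorff_outer p (D n) \<le> hausdorff_outer p (A \<inter> F \<union> D n)"
    proof (rule hausdorff_outer_separated)
      fix x y assume "x \<in> A \<inter> F" "y \<in> D n"
      then show "1 / (real n + 1) \<le> dist x y"
        using infdist_le[of x F y] by (auto simp: D_def dist_commute)
    qed simp
    also have "\<dots> \<le> hausdorff_outer p A" by (intro hausdorff_outer_mono) (auto simp: D_def)
    finally have 2: "hausdorff_outer p (A \<inter> F) + hausdorff_outer p (D n) \<le> hausdorff_outer p A" .
    have "hausdorff_outer p (A \<inter> F) + hausdorff_outer p (A - F)
        \<le> hausdorff_outer p (A \<inter> F) + (hausdorff_outer p (D n) + ennreal e)"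
      using 1 by (rule add_left_mono)
    also have "\<dots> \<le> hausdorff_outer p A + ennreal e"
      using 2 by (simp add: add_right_mono flip: add.assoc)
    finally show "hausdorff_outer p (A \<inter> F) + hausdorff_outer p (A - F) \<le> hausdorff_outer p A + ennreal e" .
  qed
qed auto

lemma sets_hausdorff_measure [simp, measurable_cong]: "sets (hausdorff_measure p) = sets borel"
  unfolding hausdorff_measure_def
  by (metis sets.sets_measure_of_eq space_borel)

lemma space_hausdorff_measure [simp]: "space (hausdorff_measure p) = UNIV"
  unfolding hausdorff_measure_def by (simp add: space_measure_of_conv)

text \<open>\<open>measure_of\<close> returns the given set function only if it is a measure on the
  sigma-algebra. The sets that satisfy Caratheodory's condition form a sigma-algebra on which it is
  one, and they include the closed sets, hence all Borel sets.\<close>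

lemma emeasure_hausdorff_measure:
  fixes A :: "'a::euclidean_space set"
  assumes "A \<in> sets borel"
  shows "emeasure (hausdorff_measure p) A = hausdorff_outer p A"
proof -
  let ?f = "hausdorff_outer p :: 'a set \<Rightarrow> ennreal"
  let ?L = "lambda_system UNIV (Pow UNIV) ?f"
  interpret P: sigma_algebra "UNIV :: 'a set" "Pow UNIV" by (rule sigma_algebra_Pow)
  have "outer_measure_space (Pow UNIV) ?f"
    using hausdorff_outer_UN_le[of p]
    by (auto simp: outer_measure_space_def positive_def increasing_def countably_subadditive_def
             intro: hausdorff_outer_mono)
  from P.caratheodory_lemma[OF this] have ms: "measure_space UNIV ?L ?f" .
  have "F \<in> ?L" if "closed F" for F
    unfolding lambda_system_def
  proof (intro CollectI conjI ballI)
    fix A :: "'a set"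
    have "hausdorff_outer p A \<le> hausdorff_outer p (A \<inter> F) + hausdorff_outer p (A - F)"
      by (rule order_trans[OF hausdorff_outer_mono hausdorff_outer_Un_le]) auto
    then show "?f (F \<inter> A) + ?f ((UNIV - F) \<inter> A) = ?f A"
      using closed_hausdorff_caratheodory[OF that, of p A] by (simp add: Int_commute Diff_eq)
  qed auto
  then have "sigma_sets UNIV (Collect closed) \<subseteq> ?L"
    using ms by (intro sigma_algebra.sigma_sets_subset) (auto simp: measure_space_def)
  then have "sets borel \<subseteq> ?L"
    by (simp add: borel_eq_closed)
  then have "measure_space UNIV (sets borel) ?f"
    using ms sets.sigma_algebra_axioms[of "borel :: 'a measure"]
    by (auto simp: measure_space_def positive_def countably_additive_def)
  then show ?thesis
    unfolding hausdorff_measure_def using assms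
    by (intro emeasure_measure_of_sigma) (auto simp: measure_space_def)
qed

text \<open>The images of the members of a cover form a cover at scale \<open>c * \<delta>\<close>,
  and each cost grows by at most \<open>c ^ p\<close>. The change of scale is kept explicit because
  the self-similarity of a cube compares two scales.\<close>

lemma hausdorff_pre_lipschitz:
  fixes f :: "'a::euclidean_space \<Rightarrow> 'a"
  assumes "0 < c" and lip: "\<And>x y. x \<in> A \<Longrightarrow> y \<in> A \<Longrightarrow> norm (f x - f y) \<le> c * norm (x - y)"
  shows "hausdorff_pre p (c * \<delta>) (f ` A) \<le> ennreal (c ^ p) * hausdorff_pre p \<delta> A"
proof -
  have cp: "ennreal (c ^ p) * inverse (ennreal (c ^ p)) = 1"
    using \<open>0 < c\<close> by (simp add: inverse_ennreal flip: ennreal_mult)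
  \<comment> \<open>Dividing by \<open>c ^ p\<close> first leaves a bare infimum on the right, to
    which \<open>INF_greatest\<close> applies.\<close>
  have "inverse (ennreal (c ^ p)) * hausdorff_pre p (c * \<delta>) (f ` A) \<le> hausdorff_pre p \<delta> A"
    unfolding hausdorff_pre_alt[of p \<delta> A]
  proof (rule INF_greatest)
    fix C assume C: "C \<in> hausdorff_covers \<delta> A"
    have Cb: "bounded (C i)" "diameter (C i) \<le> \<delta>" for i using C by (auto simp: hausdorff_covers_def)
    \<comment> \<open>Only the part inside A is mapped, because f is Lipschitz on A alone.\<close>
    define C' where "C' i = f ` (C i \<inter> A)" for i
    have nrm: "norm (x - y) \<le> c * diameter (C i)" if "x \<in> C' i" "y \<in> C' i" for x y i
    proof -
      obtain x' y' where *: "x = f x'" "y = f y'" "x' \<in> C i" "y' \<in> C i" "x' \<in> A" "y' \<in> A"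
        using \<open>x \<in> C' i\<close> \<open>y \<in> C' i\<close> unfolding C'_def by blast
      have "norm (x' - y') \<le> diameter (C i)"
        using diameter_bounded_bound[OF Cb(1) *(3,4)] by (simp add: dist_norm)
      with lip[OF *(5,6)] \<open>0 < c\<close> show ?thesis unfolding *(1,2)
        by (meson mult_le_cancel_left_pos order_trans)
    qed
    have diam: "diameter (C' i) \<le> c * diameter (C i)" for i
      using nrm \<open>0 < c\<close> diameter_ge_0[OF Cb(1)] by (intro diameter_le) auto
    have "bounded (C' i)" for i
      unfolding bounded_two_points using nrm[of _ i] by (auto simp: dist_norm)
    moreover have "diameter (C' i) \<le> c * \<delta>" for i
      using diam[of i] Cb(2)[of i] \<open>0 < c\<close> by (meson mult_le_cancel_left_pos order_trans)
    moreover have "f ` A \<subseteq> (\<Union>i. C' i)" using C unfolding hausdorff_covers_def C'_def by blast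
    ultimately have "C' \<in> hausdorff_covers (c * \<delta>) (f ` A)" by (auto simp: hausdorff_covers_def)
    then have "hausdorff_pre p (c * \<delta>) (f ` A) \<le> (\<Sum>i. hausdorff_cost p (C' i))"
      by (rule hausdorff_pre_le)
    also have "\<dots> \<le> (\<Sum>i. ennreal (c ^ p) * hausdorff_cost p (C i))"
    proof (intro suminf_le allI)
      fix i
      show "hausdorff_cost p (C' i) \<le> ennreal (c ^ p) * hausdorff_cost p (C i)"
      proof (cases "C' i = {}")
        case False
        have "(diameter (C' i) / 2) ^ p \<le> (c * (diameter (C i) / 2)) ^ p"
          using diam[of i] diameter_ge_0[of "C' i"] \<open>\<And>i. bounded (C' i)\<close> by (intro power_mono) auto
        then have "unit_ball_vol (real p) * (diameter (C' i) / 2) ^ p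
            \<le> c ^ p * (unit_ball_vol (real p) * (diameter (C i) / 2) ^ p)"
          by (simp add: power_mult_distrib mult.left_commute mult_left_mono del: times_divide_eq_right)
        then have "ennreal (unit_ball_vol (real p) * (diameter (C' i) / 2) ^ p)
            \<le> ennreal (c ^ p) * ennreal (unit_ball_vol (real p) * (diameter (C i) / 2) ^ p)"
          using \<open>0 < c\<close> diameter_ge_0[OF Cb(1)] by (subst ennreal_mult[symmetric]) (auto intro!: ennreal_leI)
        moreover have "C i \<noteq> {}" using False by (auto simp: C'_def)
        ultimately show ?thesis using False by (simp add: hausdorff_cost_def)
      qed (simp add: hausdorff_cost_def)
    qed auto
    also have "\<dots> = ennreal (c ^ p) * (\<Sum>i. hausdorff_cost p (C i))" by simp
    finally have "inverse (ennreal (c ^ p)) * hausdorff_pre p (c * \<delta>) (f ` A)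
       \<le> inverse (ennreal (c ^ p)) * (ennreal (c ^ p) * (\<Sum>i. hausdorff_cost p (C i)))"
      by (rule mult_left_mono) simp
    also have "\<dots> = (\<Sum>i. hausdorff_cost p (C i))"
      using cp by (simp add: mult.assoc[symmetric] mult.commute)
    finally show "inverse (ennreal (c ^ p)) * hausdorff_pre p (c * \<delta>) (f ` A) \<le> (\<Sum>i. hausdorff_cost p (C i))" .
  qed
  then have "ennreal (c ^ p) * (inverse (ennreal (c ^ p)) * hausdorff_pre p (c * \<delta>) (f ` A))
      \<le> ennreal (c ^ p) * hausdorff_pre p \<delta> A"
    by (rule mult_left_mono) simp
  then show ?thesis using cp by (simp add: mult.assoc[symmetric])
qed

lemma hausdorff_outer_lipschitz:
  fixes f :: "'a::euclidean_space \<Rightarrow> 'a"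
  assumes "0 < c" and lip: "\<And>x y. x \<in> A \<Longrightarrow> y \<in> A \<Longrightarrow> norm (f x - f y) \<le> c * norm (x - y)"
  shows "hausdorff_outer p (f ` A) \<le> ennreal (c ^ p) * hausdorff_outer p A"
  unfolding hausdorff_outer_def[of p "f ` A"]
proof (rule SUP_least)
  fix \<delta> :: real assume "\<delta> \<in> {0<..}"
  then have "hausdorff_pre p \<delta> (f ` A) \<le> ennreal (c ^ p) * hausdorff_pre p (\<delta> / c) A"
    using hausdorff_pre_lipschitz[OF assms, of A p "\<delta> / c"] \<open>0 < c\<close> by simp
  also have "\<dots> \<le> ennreal (c ^ p) * hausdorff_outer p A"
    using \<open>\<delta> \<in> {0<..}\<close> \<open>0 < c\<close> by (intro mult_left_mono hausdorff_pre_le_outer) auto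
  finally show "hausdorff_pre p \<delta> (f ` A) \<le> ennreal (c ^ p) * hausdorff_outer p A" .
qed

section \<open>Hausdorff measure on subspaces\<close>

text \<open>A cube of dimension \<open>p\<close> is covered by \<open>2 ^ p\<close> copies of itself shrunk by the factor
  \<open>1 / 2\<close>, so halving \<open>\<delta>\<close> does not increase \<open>hausdorff_pre p \<delta>\<close> of it.\<close>

lemma hausdorff_outer_subspace_finite:
  fixes P :: "'a::euclidean_space set"
  assumes "subspace P"
  shows "hausdorff_outer (dim P) (P \<inter> cball 0 r) < top"
proof -
  obtain B where B: "B \<subseteq> P" "pairwise orthogonal B" "\<And>x. x \<in> B \<Longrightarrow> norm x = 1"
      "independent B" "card B = dim P" "span B = P"
    by (rule orthonormal_basis_subspace[OF assms]) auto
  have finB: "finite B" using B(4) by (rule independent_imp_finite)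
  define p where "p = dim P"
  \<comment> \<open>The unit cube with edges in the orthonormal basis B.\<close>
  define X where "X = (\<lambda>t. \<Sum>b\<in>B. t b *\<^sub>R b) ` {t. \<forall>b\<in>B. 0 \<le> t b \<and> t b \<le> (1::real)}"
  have nX: "norm x \<le> real p" if "x \<in> X" for x
  proof -
    from that obtain t where t: "x = (\<Sum>b\<in>B. t b *\<^sub>R b)" "\<And>b. b \<in> B \<Longrightarrow> 0 \<le> t b \<and> t b \<le> 1"
      by (auto simp: X_def)
    have "norm x \<le> (\<Sum>b\<in>B. 1)"
      unfolding t(1) by (rule sum_norm_le) (use t(2) B(3) in force)
    then show ?thesis using B(5) by (simp add: p_def)
  qed
  \<comment> \<open>Vectors of X have norm at most p, so the diameter is at most
    \<open>2 * p\<close>; the summand 1 keeps the scale positive for p = 0.\<close>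
  define D where "D = 2 * real p + 1"
  have bX: "bounded X" unfolding bounded_iff using nX by blast
  have dX: "diameter X \<le> D"
  proof (intro diameter_le)
    fix x y assume "x \<in> X" "y \<in> X"
    then show "norm (x - y) \<le> D"
      using norm_triangle_ineq4[of x y] nX[of x] nX[of y] by (simp add: D_def)
  qed (simp add: D_def)
  have "(\<lambda>i::nat. if i = 0 then X else {}) \<in> hausdorff_covers D X"
    using bX dX by (auto simp: hausdorff_covers_def D_def split: if_splits)
  from hausdorff_pre_le[OF this, of p]
  have "hausdorff_pre p D X \<le> (\<Sum>i. hausdorff_cost p (if i = (0::nat) then X else {}))" .
  also have "\<dots> = (\<Sum>i\<in>{0}. hausdorff_cost p (if i = (0::nat) then X else {}))"
    by (intro suminf_finite) (auto simp: hausdorff_cost_def)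
  also have "\<dots> < top" by (simp add: hausdorff_cost_def)
  finally have fin: "hausdorff_pre p D X < top" .
  have half: "hausdorff_pre p (\<delta> / 2) X \<le> hausdorff_pre p \<delta> X" if "0 \<le> \<delta>" for \<delta>
  proof -
    \<comment> \<open>The map onto the subcube of half the size whose corner is half the sum of J.
      The first binary digits of the coordinates of a point tell which J to take.\<close>
    define g where "g J x = (1/2) *\<^sub>R (x + \<Sum>J)" for J and x :: 'a
    have "X \<subseteq> (\<Union>J\<in>Pow B. g J ` X)"
    proof
      fix x assume "x \<in> X"
      then obtain t where t: "x = (\<Sum>b\<in>B. t b *\<^sub>R b)" "\<And>b. b \<in> B \<Longrightarrow> 0 \<le> t b \<and> t b \<le> 1"
        by (auto simp: X_def)
      define J where "J = {b\<in>B. t b > 1/2}"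
      define s where "s b = 2 * t b - of_bool (b \<in> J)" for b
      have "(\<Sum>b\<in>B. s b *\<^sub>R b) = 2 *\<^sub>R x - (\<Sum>b\<in>B. of_bool (b \<in> J) *\<^sub>R b)"
        unfolding t(1) s_def by (simp add: scaleR_diff_left sum_subtractf scaleR_sum_right)
      also have "(\<Sum>b\<in>B. of_bool (b \<in> J) *\<^sub>R b) = \<Sum>J"
        using finB by (simp add: J_def sum.If_cases of_bool_def if_distrib[of "\<lambda>c. c *\<^sub>R _"] Int_def cong: if_cong)
      finally have "x = g J (\<Sum>b\<in>B. s b *\<^sub>R b)" by (simp add: g_def)
      moreover have "(\<Sum>b\<in>B. s b *\<^sub>R b) \<in> X"
        unfolding X_def by (intro imageI) (use t(2) in \<open>auto simp: s_def J_def\<close>)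
      ultimately show "x \<in> (\<Union>J\<in>Pow B. g J ` X)" by (auto simp: J_def intro!: bexI[of _ J])
    qed
    then have "hausdorff_pre p (\<delta>/2) X \<le> hausdorff_pre p (\<delta>/2) (\<Union>J\<in>Pow B. g J ` X)"
      by (rule hausdorff_pre_mono)
    also have "\<dots> \<le> (\<Sum>J\<in>Pow B. hausdorff_pre p (\<delta>/2) (g J ` X))"
      using that finB by (intro hausdorff_pre_finite_UN_le) auto
    also have "\<dots> \<le> (\<Sum>J\<in>Pow B. ennreal ((1/2) ^ p) * hausdorff_pre p \<delta> X)"
    proof (rule sum_mono)
      fix J
      have "norm (g J x - g J y) \<le> 1/2 * norm (x - y)" for x y
      proof -
        have "g J x - g J y = (1/2) *\<^sub>R (x - y)" by (simp add: g_def algebra_simps)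
        then show ?thesis by simp
      qed
      then show "hausdorff_pre p (\<delta>/2) (g J ` X) \<le> ennreal ((1/2) ^ p) * hausdorff_pre p \<delta> X"
        using hausdorff_pre_lipschitz[of "1/2" X "g J" p \<delta>] by simp
    qed
    also have "\<dots> = (of_nat (card (Pow B)) * ennreal ((1/2) ^ p)) * hausdorff_pre p \<delta> X"
      by (simp add: mult.assoc)
    also have "of_nat (card (Pow B)) * ennreal ((1/2) ^ p) = ennreal (2 ^ p * (1/2) ^ p)"
      using finB B(5) by (simp add: card_Pow p_def ennreal_mult'' ennreal_power flip: ennreal_numeral)
    also have "2 ^ p * (1/2) ^ p = (1::real)" by (simp flip: power_mult_distrib)
    finally show ?thesis by simp
  qed
  have "hausdorff_pre p (D / 2 ^ j) X \<le> hausdorff_pre p D X" for j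
  proof (induction j)
    case (Suc j)
    have "hausdorff_pre p (D / 2 ^ Suc j) X \<le> hausdorff_pre p (D / 2 ^ j) X"
      using half[of "D / 2 ^ j"] by (simp add: D_def mult.commute)
    then show ?case using Suc by (rule order_trans)
  qed simp
  moreover have "\<exists>j. D / 2 ^ j \<le> \<delta>" if "\<delta> > 0" for \<delta>
  proof -
    obtain j where "D / \<delta> < 2 ^ j" using real_arch_pow[of 2 "D / \<delta>"] by auto
    then show ?thesis using that by (intro exI[of _ j]) (simp add: field_simps)
  qed
  ultimately have "hausdorff_outer p X \<le> hausdorff_pre p D X"
    unfolding hausdorff_outer_def
    by (auto intro!: SUP_least) (meson hausdorff_pre_antimono order_trans)
  with fin have finX: "hausdorff_outer p X < top" by (rule le_less_trans[rotated])
  define R where "R = max r 1"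
  \<comment> \<open>The affine map onto the cube of side \<open>2 * R\<close> centred at 0. The
    bound R \<ge> 1 keeps its ratio positive.\<close>
  define h where "h x = (2 * R) *\<^sub>R x - R *\<^sub>R \<Sum>B" for x :: 'a
  have "P \<inter> cball 0 r \<subseteq> h ` X"
  proof
    fix x assume x: "x \<in> P \<inter> cball 0 r"
    define t where "t b = (x \<bullet> b + R) / (2 * R)" for b
    have xb: "x = (\<Sum>b\<in>B. (x \<bullet> b) *\<^sub>R b)"
    proof -
      obtain c where c: "x = (\<Sum>b\<in>B. c b *\<^sub>R b)"
        using x B(6) span_finite[OF finB] by auto
      have "x \<bullet> b = c b" if "b \<in> B" for b
      proof -
        have "x \<bullet> b = (\<Sum>b'\<in>B. c b' * (b' \<bullet> b))" unfolding c by (simp add: inner_sum_left)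
        also have "\<dots> = (\<Sum>b'\<in>B. if b' = b then c b else 0)"
          using B(2,3) that
          by (intro sum.cong) (auto simp: pairwise_def orthogonal_def norm_eq_1)
        finally show ?thesis using finB that by simp
      qed
      then have "(\<Sum>b\<in>B. (x \<bullet> b) *\<^sub>R b) = (\<Sum>b\<in>B. c b *\<^sub>R b)" by simp
      with c show ?thesis by simp
    qed
    have "\<bar>x \<bullet> b\<bar> \<le> R" if "b \<in> B" for b
      using Cauchy_Schwarz_ineq2[of x b] B(3)[OF that] x by (auto simp: R_def max_def)
    then have "(\<Sum>b\<in>B. t b *\<^sub>R b) \<in> X"
      unfolding X_def by (intro imageI) (fastforce simp: t_def R_def abs_le_iff)
    moreover have "h (\<Sum>b\<in>B. t b *\<^sub>R b) = x"
    proof -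
      have "(2 * R) *\<^sub>R (\<Sum>b\<in>B. t b *\<^sub>R b) = (\<Sum>b\<in>B. (x \<bullet> b) *\<^sub>R b + R *\<^sub>R b)"
        unfolding scaleR_sum_right by (intro sum.cong) (auto simp: t_def R_def scaleR_add_left)
      also have "\<dots> = x + R *\<^sub>R \<Sum>B" by (simp add: sum.distrib scaleR_sum_right flip: xb)
      finally show ?thesis by (simp add: h_def)
    qed
    ultimately show "x \<in> h ` X" by (metis imageI)
  qed
  then have "hausdorff_outer p (P \<inter> cball 0 r) \<le> hausdorff_outer p (h ` X)" by (rule hausdorff_outer_mono)
  also have "\<dots> \<le> ennreal ((2 * R) ^ p) * hausdorff_outer p X"
  proof (rule hausdorff_outer_lipschitz)
    fix x y
    have "h x - h y = (2 * R) *\<^sub>R (x - y)" by (simp add: h_def algebra_simps)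
    then show "norm (h x - h y) \<le> 2 * R * norm (x - y)" by (simp add: R_def)
  qed (simp add: R_def)
  also have "\<dots> < top" using finX by (simp add: ennreal_mult_less_top)
  finally show ?thesis by (simp add: p_def)
qed

text \<open>Both sides are the integral of \<open>1\<^sub>A(x) 1\<^sub>C(\<pi> y - x)\<close> over \<open>x\<close> and the slab; the substitution
  \<open>x \<mapsto> \<pi> y - x\<close> exchanges the roles of \<open>A\<close> and \<open>C\<close>.\<close>

lemma reflection_invariant_unique:
  fixes M :: "'a::euclidean_space measure"
  assumes M: "sigma_finite_measure M" "sets M = sets borel"
    and \<pi>: "linear \<pi>" "\<And>y. \<pi> y \<in> P" "\<And>x. x \<in> P \<Longrightarrow> \<pi> x = x"
    and AE: "AE x in M. x \<in> P"
    and refl: "\<And>p A. p \<in> P \<Longrightarrow> A \<in> sets borel \<Longrightarrow> emeasure M ((\<lambda>x. p - x) -` A) = emeasure M A"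
    and AC: "A \<in> sets borel" "C \<in> sets borel"
  shows "emeasure M A * emeasure lborel {y. \<pi> y \<in> C \<and> norm (y - \<pi> y) \<le> 1}
       = emeasure M C * emeasure lborel {y. \<pi> y \<in> A \<and> norm (y - \<pi> y) \<le> 1}"
proof -
  have [measurable_cong]: "sets M = sets borel" by (rule M)
  interpret sigma_finite_measure M by (rule M)
  interpret LM: pair_sigma_finite lborel M
    by (intro pair_sigma_finite.intro sigma_finite_lborel M)
  have [measurable]: "\<pi> \<in> borel_measurable borel"
    by (intro borel_measurable_continuous_onI linear_continuous_on linear_linear[THEN iffD1] \<pi>(1))
       (simp add: \<pi>(1) linear_conv_bounded_linear[symmetric])
  define L where "L C = {y. \<pi> y \<in> C \<and> norm (y - \<pi> y) \<le> 1}" for C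
  have Lm: "L C \<in> sets borel" if [measurable]: "C \<in> sets borel" for C
    unfolding L_def by measurable
  define I where "I A C = (\<integral>\<^sup>+y. \<integral>\<^sup>+x. indicator A x * (indicator C (\<pi> y - x) *
      indicator {y. norm (y - \<pi> y) \<le> 1} y) \<partial>M \<partial>lborel)" for A C :: "'a set"
  have fub: "I A C = emeasure M A * emeasure lborel (L C)"
    if [measurable]: "A \<in> sets borel" "C \<in> sets borel" for A C
  proof -
    have "I A C = (\<integral>\<^sup>+x. \<integral>\<^sup>+y. indicator A x * (indicator C (\<pi> y - x) *
      indicator {y. norm (y - \<pi> y) \<le> 1} y) \<partial>lborel \<partial>M)"
      unfolding I_def by (rule LM.Fubini'[symmetric]) measurable
    also have "\<dots> = (\<integral>\<^sup>+x. indicator A x * emeasure lborel (L C) \<partial>M)"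
    proof (rule nn_integral_cong_AE, rule AE_mp[OF AE], rule AE_I2, rule impI)
      fix x assume "x \<in> P"
      \<comment> \<open>For x in P one has \<pi> x = x, so translating y by x shifts \<pi> y by x
        and leaves y - \<pi> y unchanged: the set is a translate of the slab.\<close>
      have eq: "{y. \<pi> y - x \<in> C \<and> norm (y - \<pi> y) \<le> 1} = (+) (- x) -` L C"
        using \<open>x \<in> P\<close> \<pi> by (auto simp: L_def linear_diff algebra_simps)
      have "(\<integral>\<^sup>+y. indicator A x * (indicator C (\<pi> y - x) * indicator {y. norm (y - \<pi> y) \<le> 1} y) \<partial>lborel)
          = indicator A x * (\<integral>\<^sup>+y. indicator C (\<pi> y - x) * indicator {y. norm (y - \<pi> y) \<le> 1} y \<partial>lborel)"
        by (rule nn_integral_cmult) measurable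
      also have "(\<integral>\<^sup>+y. indicator C (\<pi> y - x) * indicator {y. norm (y - \<pi> y) \<le> 1} y \<partial>lborel)
          = (\<integral>\<^sup>+y. indicator {y. \<pi> y - x \<in> C \<and> norm (y - \<pi> y) \<le> 1} y \<partial>lborel)"
        by (intro nn_integral_cong) (auto simp: indicator_def)
      also have "\<dots> = emeasure lborel ((+) (- x) -` L C)"
        unfolding eq using measurable_sets_borel[OF _ Lm[OF that(2)], of "(+) (- x)"]
        by (intro nn_integral_indicator) simp
      also have "\<dots> = emeasure (distr lborel borel ((+) (- x))) (L C)"
        using Lm[OF that(2)] by (subst emeasure_distr) auto
      finally show "(\<integral>\<^sup>+y. indicator A x * (indicator C (\<pi> y - x) * indicator {y. norm (y - \<pi> y) \<le> 1} y) \<partial>lborel)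
          = indicator A x * emeasure lborel (L C)"
        by (simp add: lborel_distr_plus)
    qed
    also have "\<dots> = emeasure M A * emeasure lborel (L C)"
      by (simp add: nn_integral_multc)
    finally show ?thesis .
  qed
  have inner: "(\<integral>\<^sup>+x. indicator A x * (indicator C (\<pi> y - x) * k) \<partial>M) = emeasure M {x. x \<in> A \<and> \<pi> y - x \<in> C} * k"
    if [measurable]: "A \<in> sets borel" "C \<in> sets borel" for A C y and k :: ennreal
  proof -
    have "(\<integral>\<^sup>+x. indicator A x * (indicator C (\<pi> y - x) * k) \<partial>M)
        = (\<integral>\<^sup>+x. indicator {x. x \<in> A \<and> \<pi> y - x \<in> C} x * k \<partial>M)"
      by (intro nn_integral_cong) (auto simp: indicator_def)
    also have "\<dots> = emeasure M {x. x \<in> A \<and> \<pi> y - x \<in> C} * k"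
    proof -
      have "{x. x \<in> A \<and> \<pi> y - x \<in> C} \<in> sets borel" by measurable
      then show ?thesis by (simp add: nn_integral_multc M(2))
    qed
    finally show ?thesis .
  qed
  have sym: "emeasure M {x. x \<in> A \<and> \<pi> y - x \<in> C} = emeasure M {x. x \<in> C \<and> \<pi> y - x \<in> A}" for y
  proof -
    have "(\<lambda>x. \<pi> y - x) -` {x. x \<in> A \<and> \<pi> y - x \<in> C} = {x. x \<in> C \<and> \<pi> y - x \<in> A}" by auto
    moreover have "{x. x \<in> A \<and> \<pi> y - x \<in> C} \<in> sets borel" using AC by measurable
    ultimately show ?thesis using refl[OF \<pi>(2)[of y]] by metis
  qed
  have "I A C = I C A" unfolding I_def inner[OF AC] inner[OF AC(2,1)] sym ..
  then show ?thesis using fub AC by (simp add: L_def)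
qed

text \<open>The reflections of P in its points are isometries, and bounded parts of P have finite
  measure, so \<open>reflection_invariant_unique\<close> applies to the Hausdorff measure on
  P.\<close>

lemma hausdorff_subspace_unique:
  fixes P :: "'a::euclidean_space set"
  assumes P: "subspace P"
    and \<pi>: "linear \<pi>" "\<And>y. \<pi> y \<in> P" "\<And>x. x \<in> P \<Longrightarrow> \<pi> x = x"
    and AC: "A \<in> sets borel" "C \<in> sets borel"
  shows "emeasure (hausdorff_measure (dim P)) (P \<inter> A) * emeasure lborel {y. \<pi> y \<in> C \<and> norm (y - \<pi> y) \<le> 1}
       = emeasure (hausdorff_measure (dim P)) (P \<inter> C) * emeasure lborel {y. \<pi> y \<in> A \<and> norm (y - \<pi> y) \<le> 1}"
proof -
  let ?H = "hausdorff_measure (dim P) :: 'a measure"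
  have [measurable]: "P \<in> sets borel" using closed_subspace[OF P] by simp
  \<comment> \<open>Cut down to P because on the whole space the measure is not sigma-finite when P
    is a proper subspace.\<close>
  define M where "M = density ?H (indicator P)"
  have sM: "sets M = sets borel" by (simp add: M_def)
  have eM: "emeasure M A = hausdorff_outer (dim P) (P \<inter> A)" if [measurable]: "A \<in> sets borel" for A
  proof -
    have "emeasure M A = (\<integral>\<^sup>+x. indicator P x * indicator A x \<partial>?H)"
      unfolding M_def by (rule emeasure_density) measurable
    also have "\<dots> = (\<integral>\<^sup>+x. indicator (P \<inter> A) x \<partial>?H)"
      by (simp only: indicator_inter_arith)
    also have "\<dots> = emeasure ?H (P \<inter> A)" by (rule nn_integral_indicator) simp
    finally show ?thesis by (simp add: emeasure_hausdorff_measure)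
  qed
  have "sigma_finite_measure M"
  proof
    show "\<exists>A. countable A \<and> A \<subseteq> sets M \<and> \<Union> A = space M \<and> (\<forall>a\<in>A. emeasure M a \<noteq> \<infinity>)"
    proof (intro exI conjI ballI)
      show "countable (range (\<lambda>n. cball (0::'a) (real n)))" by simp
      show "range (\<lambda>n. cball (0::'a) (real n)) \<subseteq> sets M" by (auto simp: sM)
      show "\<Union> (range (\<lambda>n. cball (0::'a) (real n))) = space M"
        using real_arch_simple by (auto simp: M_def)
      fix a assume "a \<in> range (\<lambda>n. cball (0::'a) (real n))"
      then show "emeasure M a \<noteq> \<infinity>"
        using hausdorff_outer_subspace_finite[OF P] by (auto simp: eM less_top)
    qed
  qed
  moreover have "AE x in M. x \<in> P"
    unfolding M_def by (subst AE_density) (auto simp: indicator_def)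
  moreover have "emeasure M ((\<lambda>x. p - x) -` B) = emeasure M B" if "p \<in> P" "B \<in> sets borel" for p B
  proof -
    have im: "(\<lambda>x. p - x) ` (P \<inter> B') = P \<inter> (\<lambda>x. p - x) -` B'" for B'
    proof (intro set_eqI iffI)
      fix x assume "x \<in> P \<inter> (\<lambda>x. p - x) -` B'"
      then show "x \<in> (\<lambda>x. p - x) ` (P \<inter> B')"
        using that(1) P by (intro image_eqI[of _ _ "p - x"]) (auto simp: subspace_diff)
    qed (use that(1) P in \<open>auto simp: subspace_diff\<close>)
    have le: "hausdorff_outer (dim P) ((\<lambda>x. p - x) ` S) \<le> hausdorff_outer (dim P) S" for S
      using hausdorff_outer_lipschitz[of 1 S "\<lambda>x. p - x" "dim P"] by (simp add: norm_minus_commute)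
    \<comment> \<open>The reflection is its own inverse, so the Lipschitz bound applied to the image
      yields the reverse inequality.\<close>
    have "hausdorff_outer (dim P) (P \<inter> B) \<le> hausdorff_outer (dim P) ((\<lambda>x. p - x) ` (P \<inter> B))"
      using le[of "(\<lambda>x. p - x) ` (P \<inter> B)"] by (simp add: image_image)
    then have "hausdorff_outer (dim P) (P \<inter> (\<lambda>x. p - x) -` B) = hausdorff_outer (dim P) (P \<inter> B)"
      using le[of "P \<inter> B"] by (simp add: im)
    moreover have "(\<lambda>x. p - x) -` B \<in> sets borel"
      using that(2) by (intro measurable_sets_borel[of _ borel]) auto
    ultimately show ?thesis using that(2) by (simp add: eM)
  qed
  ultimately show ?thesis
    using reflection_invariant_unique[OF _ sM \<pi> _ _ AC] AC by (simp add: eM emeasure_hausdorff_measure)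
qed

text \<open>A linear isometry carries one subspace onto the other. This makes the factor between
  Hausdorff measure and slab volume the same for all subspaces of one dimension.\<close>

lemma hausdorff_unit_ball_subspace:
  fixes P W :: "'a::euclidean_space set"
  assumes "subspace P" "subspace W" "dim P = dim W"
  shows "hausdorff_outer p (P \<inter> cball 0 r) = hausdorff_outer p (W \<inter> cball 0 r)"
proof -
  have le: "hausdorff_outer p (P \<inter> cball 0 r) \<le> hausdorff_outer p (W \<inter> cball 0 r)"
    if PW: "subspace P" "subspace W" "dim P = dim W" for P W :: "'a set"
  proof -
    obtain f where f: "linear f" "f ` W = P" "\<And>x. x \<in> W \<Longrightarrow> norm (f x) = norm x"
      using isometry_subspaces[of W P] PW by metis
    have "P \<inter> cball 0 r \<subseteq> f ` (W \<inter> cball 0 r)" using f(2,3) by force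
    then have "hausdorff_outer p (P \<inter> cball 0 r) \<le> hausdorff_outer p (f ` (W \<inter> cball 0 r))"
      by (rule hausdorff_outer_mono)
    also have "\<dots> \<le> ennreal (1 ^ p) * hausdorff_outer p (W \<inter> cball 0 r)"
      by (rule hausdorff_outer_lipschitz)
         (use f PW in \<open>auto simp: linear_diff[symmetric] subspace_diff\<close>)
    finally show ?thesis by simp
  qed
  show ?thesis using le[of P W] le[of W P] assms by (intro antisym) auto
qed

section \<open>Volumes of frames\<close>

text \<open>A determinant indexed by a finite set rather than by a type, to match
  \<open>wedge\<close>; \<open>leib_det\<close> ties it to \<open>det\<close>.\<close>

definition leib :: "'i set \<Rightarrow> ('i \<Rightarrow> 'i \<Rightarrow> real) \<Rightarrow> real" where
  "leib I a = (\<Sum>p | p permutes I. of_int (sign p) * (\<Prod>i\<in>I. a i (p i)))"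

text \<open>Conjugation by h turns permutations of the type into permutations of I and preserves
  signs, so the two Leibniz sums agree term by term.\<close>

lemma leib_det:
  fixes h :: "'j::finite \<Rightarrow> 'i"
  assumes h: "bij_betw h UNIV I"
  shows "leib I a = det (\<chi> i j. a (h i) (h j))"
proof -
  have inj: "inj h" using h by (auto simp: bij_betw_def)
  have finI: "finite I" using bij_betw_finite[OF h] by simp
  let ?m = "map_permutation UNIV h"
  have bij: "bij_betw ?m {p. p permutes UNIV} {p. p permutes I}"
  proof (rule bij_betw_byWitness[where f' = "map_permutation I (inv h)"])
    show "\<forall>p\<in>{p. p permutes UNIV}. map_permutation I (inv h) (?m p) = p"
      using map_permutation_compose_inv[OF h] inj by auto
    have h': "bij_betw (inv h) I UNIV" using h by (rule bij_betw_inv_into)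
    show "\<forall>p\<in>{p. p permutes I}. ?m (map_permutation I (inv h) p) = p"
      using map_permutation_compose_inv[OF h'] h by (auto simp: bij_betw_inv_into_right)
    show "?m ` {p. p permutes UNIV} \<subseteq> {p. p permutes I}"
      using map_permutation_permutes[OF h] by auto
    show "map_permutation I (inv h) ` {p. p permutes I} \<subseteq> {p. p permutes UNIV}"
      using map_permutation_permutes[OF h'] by auto
  qed
  have "leib I a = (\<Sum>p | p permutes (UNIV :: 'j set). of_int (sign (?m p)) * (\<Prod>i\<in>I. a i (?m p i)))"
    unfolding leib_def by (rule sum.reindex_bij_betw[OF bij, symmetric])
  also have "\<dots> = (\<Sum>p | p permutes (UNIV :: 'j set). of_int (sign p) * (\<Prod>i\<in>UNIV. a (h i) (h (p i))))"
  proof (rule sum.cong[OF refl])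
    fix p :: "'j \<Rightarrow> 'j" assume "p \<in> {p. p permutes UNIV}"
    then have "sign (?m p) = sign p" using inj by (intro sign_map_permutation) auto
    moreover have "(\<Prod>i\<in>I. a i (?m p i)) = (\<Prod>i\<in>UNIV. a (h i) (?m p (h i)))"
      by (rule prod.reindex_bij_betw[OF h, symmetric])
    moreover have "?m p (h i) = h (p i)" for i using inj by (intro map_permutation_apply) auto
    ultimately show "of_int (sign (?m p)) * (\<Prod>i\<in>I. a i (?m p i))
      = of_int (sign p) * (\<Prod>i\<in>UNIV. a (h i) (h (p i)))" by simp
  qed
  finally show ?thesis by (simp add: det_def)
qed

lemma leib_cong: "(\<And>i j. i \<in> I \<Longrightarrow> j \<in> I \<Longrightarrow> a i j = b i j) \<Longrightarrow> leib I a = leib I b"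
  unfolding leib_def by (intro sum.cong refl arg_cong2[where f = "(*)"] prod.cong)
    (auto simp: permutes_in_image)

lemma leib_transpose:
  fixes h :: "'j::finite \<Rightarrow> 'i"
  assumes h: "bij_betw h UNIV I"
  shows "leib I (\<lambda>i j. a j i) = leib I a"
  using det_transpose[of "\<chi> i j. a (h i) (h j)"] by (simp add: leib_det[OF h] transpose_def)

lemma leib_mult:
  fixes h :: "'j::finite \<Rightarrow> 'i"
  assumes h: "bij_betw h UNIV I"
  shows "leib I (\<lambda>i j. \<Sum>l\<in>I. a i l * b l j) = leib I a * leib I b"
proof -
  have "(\<Sum>l\<in>I. a i l * b l j) = (\<Sum>l\<in>UNIV. a i (h l) * b (h l) j)" for i j
    by (rule sum.reindex_bij_betw[OF h, symmetric])
  then show ?thesis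
    using det_mul[of "\<chi> i j. a (h i) (h j)" "\<chi> i j. b (h i) (h j)"]
    by (simp add: leib_det[OF h] matrix_matrix_mult_def)
qed

text \<open>Multiplication on both sides by a diagonal matrix, which is how the Gram matrix of a
  frame changes when its vectors are rescaled.\<close>

lemma leib_scale: "finite I \<Longrightarrow> leib I (\<lambda>i j. c i * c j * a i j) = (\<Prod>i\<in>I. c i)\<^sup>2 * leib I a"
  unfolding leib_def sum_distrib_left
proof (rule sum.cong[OF refl])
  fix p assume "finite I" "p \<in> {p. p permutes I}"
  then have "(\<Prod>i\<in>I. c (p i)) = prod c I"
    using prod.permute[of p I c] by (simp add: comp_def)
  then show "of_int (sign p) * (\<Prod>i\<in>I. c i * c (p i) * a i (p i))
      = (\<Prod>i\<in>I. c i)\<^sup>2 * (of_int (sign p) * (\<Prod>i\<in>I. a i (p i)))"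
    by (simp add: prod.distrib power2_eq_square)
qed

text \<open>The rows indexed by J are rows of the identity, so a permutation that moves a point of J
  contributes a zero factor and only permutations of I survive.\<close>

lemma leib_block:
  assumes fin: "finite I" "finite J" and "I \<inter> J = {}"
    and a: "\<And>i j. j \<in> J \<Longrightarrow> i \<in> I \<union> J \<Longrightarrow> a j i = (if i = j then 1 else 0)"
  shows "leib (I \<union> J) a = leib I a"
proof -
  have "leib (I \<union> J) a = (\<Sum>p | p permutes I. of_int (sign p) * (\<Prod>i\<in>I\<union>J. a i (p i)))"
    unfolding leib_def
  proof (rule sum.mono_neutral_right)
    show "finite {p. p permutes I \<union> J}" using fin by (simp add: finite_permutations)
    show "{p. p permutes I} \<subseteq> {p. p permutes I \<union> J}" by (auto intro: permutes_subset)
    show "\<forall>p\<in>{p. p permutes I \<union> J} - {p. p permutes I}. of_int (sign p) * (\<Prod>i\<in>I\<union>J. a i (p i)) = 0"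
    proof
      fix p assume p: "p \<in> {p. p permutes I \<union> J} - {p. p permutes I}"
      then have pp: "p permutes I \<union> J" by simp
      have "\<exists>j\<in>J. p j \<noteq> j"
      proof (rule ccontr)
        assume *: "\<not> (\<exists>j\<in>J. p j \<noteq> j)"
        have "p permutes I"
          by (rule permutes_superset[OF pp]) (use * in auto)
        then show False using p by simp
      qed
      then obtain j where "j \<in> J" "p j \<noteq> j" by blast
      then have "a j (p j) = 0" using a[of j "p j"] permutes_in_image[OF pp, of j] by auto
      then have "(\<Prod>i\<in>I\<union>J. a i (p i)) = 0" using fin \<open>j \<in> J\<close> by (intro prod_zero) auto
      then show "of_int (sign p) * (\<Prod>i\<in>I\<union>J. a i (p i)) = 0" by simp
    qed
  qed
  also have "\<dots> = leib I a"
    unfolding leib_def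
  proof (rule sum.cong[OF refl])
    fix p assume "p \<in> {p. p permutes I}"
    then have "(\<Prod>j\<in>J. a j (p j)) = (\<Prod>j\<in>J. 1)"
    proof (intro prod.cong refl)
      fix j assume "j \<in> J"
      then have "j \<notin> I" using assms(3) by auto
      then have "p j = j" using \<open>p \<in> _\<close> by (simp add: permutes_not_in)
      then show "a j (p j) = 1" using a[OF \<open>j \<in> J\<close>, of j] \<open>j \<in> J\<close> by simp
    qed
    then show "of_int (sign p) * (\<Prod>i\<in>I \<union> J. a i (p i)) = of_int (sign p) * (\<Prod>i\<in>I. a i (p i))"
      using fin assms(3) by (simp add: prod.union_disjoint)
  qed
  finally show ?thesis .
qed

text \<open>Gram's formula. The squared wedge is a double sum over permutations p and q, and
  summation over all choices of basis vectors factorizes into the inner products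
  \<open>u i \<bullet> u (inv q (p i))\<close>. These depend on p and q only through their quotient,
  so each p yields the same determinant and the number of permutations cancels
  \<open>fact (card I)\<close>.\<close>

lemma mv_norm_wedge:
  fixes u :: "'i \<Rightarrow> 'a::euclidean_space"
  assumes fin: "finite I"
  shows "mv_norm I (wedge I u) = sqrt (leib I (\<lambda>i j. u i \<bullet> u j))"
proof -
  let ?S = "{p. p permutes I}"
  let ?s = "\<lambda>p. real_of_int (sign p)"
  have perm: "permutation p" if "p \<in> ?S" for p
    using that fin by (auto simp: permutation_permutes)
  have inner: "(\<Sum>z\<in>I \<rightarrow>\<^sub>E Basis. (\<Prod>i\<in>I. u i \<bullet> z (p i)) * (\<Prod>i\<in>I. u i \<bullet> z (q i)))
      = (\<Prod>i\<in>I. u i \<bullet> u (inv q (p i)))" if p: "p \<in> ?S" and q: "q \<in> ?S" for p q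
  proof -
    have re: "(\<Prod>i\<in>I. u i \<bullet> z (r i)) = (\<Prod>j\<in>I. u (inv r j) \<bullet> z j)" if "r \<in> ?S" for r and z :: "'i \<Rightarrow> 'a"
    proof -
      from that have r: "r permutes I" by simp
      show ?thesis
        using prod.permute[OF r, of "\<lambda>j. u (inv r j) \<bullet> z j"] permutes_inverses(2)[OF r]
        by (simp add: comp_def)
    qed
    have "(\<Sum>z\<in>I \<rightarrow>\<^sub>E Basis. (\<Prod>i\<in>I. u i \<bullet> z (p i)) * (\<Prod>i\<in>I. u i \<bullet> z (q i)))
        = (\<Sum>z\<in>I \<rightarrow>\<^sub>E Basis. \<Prod>j\<in>I. (u (inv p j) \<bullet> z j) * (u (inv q j) \<bullet> z j))"
      unfolding re[OF p] re[OF q] by (simp add: prod.distrib)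
    also have "\<dots> = (\<Prod>j\<in>I. \<Sum>b\<in>Basis. (u (inv p j) \<bullet> b) * (u (inv q j) \<bullet> b))"
      using fin by (intro prod_sum_PiE[symmetric]) auto
    also have "\<dots> = (\<Prod>j\<in>I. u (inv p j) \<bullet> u (inv q j))"
      by (intro prod.cong refl euclidean_inner[symmetric])
    also have "\<dots> = (\<Prod>i\<in>I. u i \<bullet> u (inv q (p i)))"
      using prod.permute[of p I "\<lambda>j. u (inv p j) \<bullet> u (inv q j)"] p permutes_inverses(2)[of p I]
      by (simp add: comp_def)
    finally show ?thesis .
  qed
  have "(\<Sum>z\<in>I \<rightarrow>\<^sub>E Basis. (wedge I u z)\<^sup>2)
      = (\<Sum>z\<in>I \<rightarrow>\<^sub>E Basis. \<Sum>p\<in>?S. \<Sum>q\<in>?S. ?s p * ?s q *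
          ((\<Prod>i\<in>I. u i \<bullet> z (p i)) * (\<Prod>i\<in>I. u i \<bullet> z (q i))))"
    unfolding wedge_def power2_eq_square sum_product by (simp add: mult_ac)
  also have "\<dots> = (\<Sum>p\<in>?S. \<Sum>q\<in>?S. \<Sum>z\<in>I \<rightarrow>\<^sub>E Basis. ?s p * ?s q *
          ((\<Prod>i\<in>I. u i \<bullet> z (p i)) * (\<Prod>i\<in>I. u i \<bullet> z (q i))))"
    by (subst sum.swap, rule sum.cong[OF refl], rule sum.swap)
  also have "\<dots> = (\<Sum>p\<in>?S. \<Sum>q\<in>?S. ?s p * ?s q * (\<Prod>i\<in>I. u i \<bullet> u (inv q (p i))))"
    by (intro sum.cong refl) (simp add: inner flip: sum_distrib_left)
  also have "\<dots> = (\<Sum>p\<in>?S. leib I (\<lambda>i j. u i \<bullet> u j))"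
  proof (rule sum.cong[OF refl])
    fix p assume p: "p \<in> ?S"
    have "(\<Sum>q\<in>?S. ?s p * ?s q * (\<Prod>i\<in>I. u i \<bullet> u (inv q (p i))))
        = (\<Sum>q\<in>?S. ?s p * ?s (inv q) * (\<Prod>i\<in>I. u i \<bullet> u (inv (inv q) (p i))))"
      by (rule sum_permutations_inverse)
    also have "\<dots> = (\<Sum>q\<in>?S. ?s (q \<circ> p) * (\<Prod>i\<in>I. u i \<bullet> u ((q \<circ> p) i)))"
    proof (rule sum.cong[OF refl])
      fix q assume q: "q \<in> ?S"
      then have "inv (inv q) = q" by (metis mem_Collect_eq permutes_inv_inv)
      then show "?s p * ?s (inv q) * (\<Prod>i\<in>I. u i \<bullet> u (inv (inv q) (p i)))
          = ?s (q \<circ> p) * (\<Prod>i\<in>I. u i \<bullet> u ((q \<circ> p) i))"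
        using perm[OF p] perm[OF q] by (simp add: sign_compose sign_inverse)
    qed
    also have "\<dots> = leib I (\<lambda>i j. u i \<bullet> u j)"
      using p unfolding leib_def by (intro sum_permutations_compose_right[symmetric]) auto
    finally show "(\<Sum>q\<in>?S. ?s p * ?s q * (\<Prod>i\<in>I. u i \<bullet> u (inv q (p i)))) = leib I (\<lambda>i j. u i \<bullet> u j)" .
  qed
  also have "\<dots> = fact (card I) * leib I (\<lambda>i j. u i \<bullet> u j)"
    using card_permutations[OF refl fin] by simp
  finally show ?thesis by (simp add: mv_norm_def)
qed

lemma orthonormal_basis_expand:
  assumes "orthonormal_basis_of I b S" "finite I" "x \<in> S"
  shows "x = (\<Sum>l\<in>I. (x \<bullet> b l) *\<^sub>R b l)"
proof -
  have on: "b i \<bullet> b j = (if i = j then 1 else 0)" if "i \<in> I" "j \<in> I" for i j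
    using assms(1) that by (auto simp: orthonormal_basis_of_def)
  have "x \<in> span (b ` I)" using assms by (auto simp: orthonormal_basis_of_def)
  then show ?thesis
  proof (induction rule: span_induct_alt)
    case (step c y z)
    then obtain i where i: "i \<in> I" "y = b i" by auto
    have "(\<Sum>l\<in>I. ((c *\<^sub>R y + z) \<bullet> b l) *\<^sub>R b l) = (\<Sum>l\<in>I. (c * (b i \<bullet> b l)) *\<^sub>R b l) + (\<Sum>l\<in>I. (z \<bullet> b l) *\<^sub>R b l)"
      by (simp add: i inner_add_left scaleR_add_left sum.distrib)
    also have "(\<Sum>l\<in>I. (c * (b i \<bullet> b l)) *\<^sub>R b l) = (\<Sum>l\<in>I. if l = i then c *\<^sub>R b i else 0)"
      using i by (intro sum.cong) (auto simp: on)
    also have "\<dots> = c *\<^sub>R y" using assms(2) i by simp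
    finally show ?case using step by simp
  qed simp
qed

lemma orthonormal_basis_inner:
  assumes "orthonormal_basis_of I b S" "finite I" "x \<in> S"
  shows "x \<bullet> y = (\<Sum>l\<in>I. (x \<bullet> b l) * (b l \<bullet> y))"
  by (subst orthonormal_basis_expand[OF assms]) (simp add: inner_sum_left)

text \<open>In coordinates with respect to b the Gram matrix is M times its transpose, and the
  square root of its determinant is the absolute value of det M.\<close>

lemma mv_norm_wedge_basis:
  fixes h :: "'j::finite \<Rightarrow> 'i"
  assumes h: "bij_betw h UNIV I" and b: "orthonormal_basis_of I b S" and u: "\<And>i. i \<in> I \<Longrightarrow> u i \<in> S"
  shows "mv_norm I (wedge I u) = \<bar>leib I (\<lambda>i j. u i \<bullet> b j)\<bar>"
proof -
  have fin: "finite I" using bij_betw_finite[OF h] by simp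
  have "leib I (\<lambda>i j. u i \<bullet> u j) = leib I (\<lambda>i j. \<Sum>l\<in>I. (u i \<bullet> b l) * (b l \<bullet> u j))"
    by (intro leib_cong orthonormal_basis_inner[OF b fin] u)
  also have "\<dots> = leib I (\<lambda>i j. u i \<bullet> b j) * leib I (\<lambda>i j. u j \<bullet> b i)"
    by (subst leib_mult[OF h]) (simp add: inner_commute)
  also have "leib I (\<lambda>i j. u j \<bullet> b i) = leib I (\<lambda>i j. u i \<bullet> b j)"
    by (rule leib_transpose[OF h])
  finally show ?thesis by (simp add: mv_norm_wedge[OF fin] flip: power2_eq_square)
qed

section \<open>Lebesgue measure under isometries, linear maps and shears\<close>

lemma lborel_reflection:
  fixes p :: "'a::euclidean_space"
  assumes "A \<in> sets borel"
  shows "emeasure lborel ((\<lambda>x. p - x) -` A) = emeasure lborel A"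
proof -
  have "lborel = distr lborel borel (\<lambda>x. p - x)"
    using lborel_affine[of "-1" p] by (simp add: density_1)
  then have "emeasure lborel A = emeasure (distr lborel borel (\<lambda>x. p - x)) A" by simp
  also have "\<dots> = emeasure lborel ((\<lambda>x. p - x) -` A)" using assms by (subst emeasure_distr) auto
  finally show ?thesis ..
qed

text \<open>The image measure is a multiple of Lebesgue measure, and it has the same value on the unit ball.\<close>

lemma emeasure_lborel_isometry:
  fixes f :: "'a::euclidean_space \<Rightarrow> 'b::euclidean_space" and g :: "'b \<Rightarrow> 'a"
  assumes lin: "linear f" "linear g" and inv: "\<And>x. g (f x) = x" "\<And>y. f (g y) = y"
    and iso: "\<And>x. norm (f x) = norm x" and A: "A \<in> sets borel"
  shows "emeasure lborel (f ` A) = emeasure lborel A"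
proof -
  have meas: "f \<in> borel_measurable borel" "g \<in> borel_measurable borel"
    using lin by (auto intro!: borel_measurable_continuous_onI linear_continuous_on simp: linear_conv_bounded_linear)
  define M where "M = distr lborel borel g"
  have im: "f ` B = g -` B" for B using inv by (auto intro: image_eqI[of _ f "g _"])
  have M: "emeasure M B = emeasure lborel (g -` B)" if "B \<in> sets borel" for B
    unfolding M_def using that meas by (subst emeasure_distr) auto
  have gB: "g -` B \<in> sets borel" if "B \<in> sets borel" for B using measurable_sets_borel[OF meas(2) that] .
  have ball: "f ` cball 0 r = cball 0 r" for r
    unfolding im using iso inv by (auto simp: mem_cball dist_norm) (metis iso)+
  \<comment> \<open>Equal dimensions give the unit balls of both types the same volume, which fixes
    the proportionality constant.\<close>
  have dim: "DIM('a) = DIM('b)"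
  proof (rule antisym)
    have "inj f" "inj g" using inv by (metis injI)+
    then show "DIM('a) \<le> DIM('b)" "DIM('b) \<le> DIM('a)"
      using lin dim_image_eq[of f UNIV] dim_image_eq[of g UNIV] dim_subset_UNIV
      by (metis dim_UNIV inj_on_subset subset_UNIV)+
  qed
  have "sigma_finite_measure M"
  proof
    show "\<exists>A. countable A \<and> A \<subseteq> sets M \<and> \<Union> A = space M \<and> (\<forall>a\<in>A. emeasure M a \<noteq> \<infinity>)"
    proof (intro exI conjI ballI)
      show "countable (range (\<lambda>n. cball (0::'a) (real n)))" by simp
      show "range (\<lambda>n. cball (0::'a) (real n)) \<subseteq> sets M" by (auto simp: M_def)
      show "\<Union> (range (\<lambda>n. cball (0::'a) (real n))) = space M"
        using real_arch_simple by (auto simp: M_def)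
      fix a assume "a \<in> range (\<lambda>n. cball (0::'a) (real n))"
      then show "emeasure M a \<noteq> \<infinity>"
        by (auto simp: M im[symmetric] ball emeasure_cball)
    qed
  qed
  moreover have "sets M = sets borel" by (simp add: M_def)
  moreover have "emeasure M ((\<lambda>x. p - x) -` B) = emeasure M B" if "B \<in> sets borel" for p B
  proof -
    have "(\<lambda>x. p - x) -` B \<in> sets borel" using that by (intro measurable_sets_borel[of _ borel]) auto
    moreover have "g -` (\<lambda>x. p - x) -` B = (\<lambda>y. f p - y) -` g -` B"
      using inv lin by (auto simp: linear_diff)
    ultimately show ?thesis using that gB by (simp add: M lborel_reflection)
  qed
  \<comment> \<open>With P the whole space and \<pi> the identity, the slab over A is A
    itself.\<close>
  ultimately have "emeasure M A * emeasure lborel {y::'a. y \<in> cball 0 1 \<and> norm (y - y) \<le> 1}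
      = emeasure M (cball 0 1) * emeasure lborel {y. y \<in> A \<and> norm (y - y) \<le> 1}"
    by (intro reflection_invariant_unique[where P = UNIV and \<pi> = "\<lambda>x. x"]) (use A linear_id in \<open>auto simp: id_def\<close>)
  moreover have "emeasure M (cball 0 1) = emeasure lborel (cball (0::'a) 1)"
    using dim by (simp add: M im[symmetric] ball emeasure_cball)
  ultimately have "emeasure lborel (cball (0::'a) 1) * emeasure M A = emeasure lborel (cball (0::'a) 1) * emeasure lborel A"
    by (simp add: mult.commute cball_def)
  moreover have "emeasure lborel (cball (0::'a) 1) \<noteq> 0" "emeasure lborel (cball (0::'a) 1) \<noteq> top"
    using unit_ball_vol_pos[of "real DIM('a)"] by (simp_all add: emeasure_cball less_imp_neq[symmetric])
  ultimately show ?thesis using M[OF A] by (simp add: ennreal_mult_cancel_left im)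
qed

lemma ex_heis_isometry:
  "\<exists>(f :: ('n::finite) heis \<Rightarrow> real^('n bit1)) g. linear f \<and> linear g \<and>
     (\<forall>x. norm (f x) = norm x) \<and> (\<forall>x. g (f x) = x) \<and> (\<forall>y. f (g y) = y)"
proof -
  have "dim (UNIV :: 'n heis set) = dim (UNIV :: (real^('n bit1)) set)" by (simp add: dim_UNIV)
  from isometries_subspaces[OF subspace_UNIV subspace_UNIV this] show ?thesis by (metis UNIV_I)
qed

text \<open>The library has the change of variables formula for linear maps only on \<open>real^'m\<close>
  with a wellordered index type \<open>'m\<close>; the type \<open>'n bit1\<close> has \<open>2 * CARD('n) + 1\<close> elements.\<close>

definition heis_to_vec :: "('n::finite) heis \<Rightarrow> real^('n bit1)" where
  "heis_to_vec = (SOME f. \<exists>g. linear f \<and> linear g \<and>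
     (\<forall>x. norm (f x) = norm x) \<and> (\<forall>x. g (f x) = x) \<and> (\<forall>y. f (g y) = y))"

definition vec_to_heis :: "real^('n bit1) \<Rightarrow> ('n::finite) heis" where
  "vec_to_heis = inv heis_to_vec"

lemma
  shows linear_heis_to_vec: "linear (heis_to_vec :: ('n::finite) heis \<Rightarrow> _)"
    and linear_vec_to_heis: "linear (vec_to_heis :: _ \<Rightarrow> 'n heis)"
    and norm_heis_to_vec: "norm (heis_to_vec (x :: 'n heis)) = norm x"
    and heis_to_vec_inverse [simp]: "vec_to_heis (heis_to_vec x) = x"
    and vec_to_heis_inverse [simp]: "heis_to_vec (vec_to_heis y :: 'n heis) = y"
proof -
  let ?f = "heis_to_vec :: 'n heis \<Rightarrow> _"
  have *: "\<exists>g. linear ?f \<and> linear g \<and> (\<forall>x. norm (?f x) = norm x) \<and>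
      (\<forall>x. g (?f x) = x) \<and> (\<forall>y. ?f (g y) = y)"
    using someI_ex[OF ex_heis_isometry] by (simp only: heis_to_vec_def)
  then obtain g where g: "linear ?f" "linear g" "\<And>x. norm (?f x) = norm x"
      "\<And>x. g (?f x) = x" "\<And>y. ?f (g y) = y" by blast
  have "vec_to_heis = g" unfolding vec_to_heis_def using g(4,5) by (metis inv_equality ext)
  then show "linear (heis_to_vec :: 'n heis \<Rightarrow> _)" "linear (vec_to_heis :: _ \<Rightarrow> 'n heis)"
    "norm (heis_to_vec x) = norm x" "vec_to_heis (heis_to_vec x) = x" "heis_to_vec (vec_to_heis y :: 'n heis) = y"
    using g by auto
qed

lemma inner_heis_to_vec: "heis_to_vec x \<bullet> heis_to_vec y = x \<bullet> y"
  by (simp add: dot_norm norm_heis_to_vec linear_add[OF linear_heis_to_vec, symmetric])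

lemma inner_vec_to_heis: "vec_to_heis x \<bullet> y = x \<bullet> heis_to_vec y"
  using inner_heis_to_vec[of "vec_to_heis x" y] by simp

lemma bij_heis_index:
  "\<exists>h :: ('n bit1) \<Rightarrow> nat. bij_betw h UNIV {1..2 * CARD('n::finite) + 1}"
  by (rule finite_same_card_bij) auto

text \<open>The determinant formula is transported along the isometry \<open>heis_to_vec\<close>.
  Compactness is preserved by linear maps and keeps all images Borel.\<close>

lemma emeasure_linear_heis:
  fixes T :: "('n::finite) heis \<Rightarrow> 'n heis"
  assumes T: "linear T" and A: "compact A"
  shows "emeasure lborel (T ` A)
    = ennreal \<bar>det (matrix (heis_to_vec \<circ> T \<circ> vec_to_heis))\<bar> * emeasure lborel A"
proof -
  let ?T = "heis_to_vec \<circ> T \<circ> vec_to_heis"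
  have lin: "linear ?T"
    by (intro linear_compose linear_vec_to_heis linear_heis_to_vec T)
  have iso: "emeasure lborel (heis_to_vec ` B) = emeasure lborel B" if "compact B" for B :: "'n heis set"
    using that borel_compact
    by (intro emeasure_lborel_isometry[OF linear_heis_to_vec linear_vec_to_heis]) (auto simp: norm_heis_to_vec)
  have cont: "continuous_on B F" if "linear F" for B and F :: "'x::euclidean_space \<Rightarrow> 'y::euclidean_space"
    using that by (simp add: linear_continuous_on linear_conv_bounded_linear)
  have cT: "compact (T ` A)" using A T by (intro compact_continuous_image cont)
  have cA: "compact (heis_to_vec ` A)" using A by (intro compact_continuous_image cont linear_heis_to_vec)
  have cTA: "compact (?T ` heis_to_vec ` A)" by (intro compact_continuous_image cont lin cA)
  have ms: "emeasure lborel B = ennreal (measure lebesgue B)" if "compact B" for B :: "(real^('n bit1)) set"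
    using emeasure_eq_measure2[OF lmeasurable_compact[OF that]] borel_compact[OF that] by simp
  have "emeasure lborel (T ` A) = emeasure lborel (heis_to_vec ` T ` A)" using iso[OF cT] by simp
  also have "heis_to_vec ` T ` A = ?T ` heis_to_vec ` A" by (simp add: image_image)
  also have "emeasure lborel \<dots> = ennreal (\<bar>det (matrix ?T)\<bar> * measure lebesgue (heis_to_vec ` A))"
    using ms[OF cTA] measure_linear_image[OF lin lmeasurable_compact[OF cA]] by simp
  also have "\<dots> = ennreal \<bar>det (matrix ?T)\<bar> * emeasure lborel A"
    using ms[OF cA] iso[OF A] by (simp add: ennreal_mult)
  finally show ?thesis .
qed

text \<open>The linear map that sends each \<open>s i\<close> to \<open>u i\<close> has the
  coordinates \<open>u j \<bullet> s i\<close> as matrix entries, so by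
  \<open>mv_norm_wedge_basis\<close> its determinant is the norm of the wedge up to sign. This links
  multivector norms to Lebesgue measure.\<close>

lemma volume_of_frame:
  obtains s :: "nat \<Rightarrow> ('n::finite) heis" where
    "orthonormal_basis_of {1..2 * CARD('n) + 1} s UNIV"
    "\<And>(u :: nat \<Rightarrow> 'n heis) A. compact A \<Longrightarrow>
       emeasure lborel ((\<lambda>y. \<Sum>i\<in>{1..2 * CARD('n) + 1}. (y \<bullet> s i) *\<^sub>R u i) ` A)
       = ennreal (mv_norm {1..2 * CARD('n) + 1} (wedge {1..2 * CARD('n) + 1} u)) * emeasure lborel A"
proof -
  let ?I = "{1..2 * CARD('n) + 1}"
  obtain h :: "('n bit1) \<Rightarrow> nat" where h: "bij_betw h UNIV ?I" using bij_heis_index by blast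
  define s :: "nat \<Rightarrow> 'n heis" where "s i = vec_to_heis (axis (inv h i) 1)" for i
  have sh: "s (h j) = vec_to_heis (axis j 1)" for j
    using h by (simp add: s_def bij_betw_def)
  have on: "s i \<bullet> s j = (if i = j then 1 else 0)" if ij: "i \<in> ?I" "j \<in> ?I" for i j
  proof -
    have "range h = ?I" using h by (simp add: bij_betw_def)
    then obtain i' j' where i: "i = h i'" and j: "j = h j'" using ij by (metis rangeE)
    have "h i' = h j' \<longleftrightarrow> i' = j'" using h by (auto simp: bij_betw_def inj_eq)
    then show ?thesis by (simp add: i j sh inner_vec_to_heis inner_axis_axis)
  qed
  have sp: "x \<in> span (s ` ?I)" for x
  proof -
    have "vec_to_heis y = (\<Sum>j\<in>UNIV. y $ j *\<^sub>R vec_to_heis (axis j 1))" for y :: "real^('n bit1)"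
      by (subst basis_expansion[symmetric, of y])
         (simp add: linear_sum[OF linear_vec_to_heis] linear_scale[OF linear_vec_to_heis] scalar_mult_eq_scaleR)
    from this[of "heis_to_vec x"]
    have "x = (\<Sum>j\<in>UNIV. (heis_to_vec x $ j) *\<^sub>R s (h j))" by (simp add: sh)
    moreover have "s (h j) \<in> s ` ?I" for j
      using h by (intro imageI) (auto simp: bij_betw_def)
    ultimately show ?thesis by (metis (no_types, lifting) span_base span_scale span_sum)
  qed
  have onb: "orthonormal_basis_of ?I s UNIV"
    using on sp by (auto simp: orthonormal_basis_of_def)
  moreover have "emeasure lborel ((\<lambda>y. \<Sum>i\<in>?I. (y \<bullet> s i) *\<^sub>R u i) ` A)
       = ennreal (mv_norm ?I (wedge ?I u)) * emeasure lborel A" if "compact A" for u :: "nat \<Rightarrow> 'n heis" and A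
  proof -
    define T where "T y = (\<Sum>i\<in>?I. (y \<bullet> s i) *\<^sub>R u i)" for y
    have lin: "linear T"
      unfolding T_def
      by (rule linearI)
         (simp_all add: inner_add_left scaleR_add_left sum.distrib scaleR_sum_right del: sum.cl_ivl_Suc)
    have Ts: "T (s i) = u i" if "i \<in> ?I" for i
    proof -
      have "T (s i) = (\<Sum>j\<in>?I. if j = i then u i else 0)"
        unfolding T_def using on[OF that] by (intro sum.cong) auto
      then show ?thesis using that by simp
    qed
    have "\<bar>det (matrix (heis_to_vec \<circ> T \<circ> vec_to_heis))\<bar> = \<bar>det (\<chi> i j. u (h j) \<bullet> s (h i))\<bar>"
    proof -
      have "matrix (heis_to_vec \<circ> T \<circ> vec_to_heis) = (\<chi> i j. u (h j) \<bullet> s (h i))"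
      proof (simp only: vec_eq_iff vec_lambda_beta, intro allI)
        fix i j
        have "h j \<in> ?I" using h by (auto simp: bij_betw_def)
        have "matrix (heis_to_vec \<circ> T \<circ> vec_to_heis) $ i $ j = heis_to_vec (T (s (h j))) \<bullet> axis i 1"
          by (simp add: matrix_def sh inner_axis)
        also have "\<dots> = u (h j) \<bullet> s (h i)"
          using inner_vec_to_heis[of "axis i 1"] Ts[OF \<open>h j \<in> ?I\<close>] by (simp add: sh inner_commute)
        finally show "matrix (heis_to_vec \<circ> T \<circ> vec_to_heis) $ i $ j = u (h j) \<bullet> s (h i)" .
      qed
      then show ?thesis by simp
    qed
    also have "\<dots> = \<bar>leib ?I (\<lambda>i j. u j \<bullet> s i)\<bar>" by (simp only: leib_det[OF h])
    also have "\<dots> = \<bar>leib ?I (\<lambda>i j. u i \<bullet> s j)\<bar>" by (simp only: leib_transpose[OF h, of "\<lambda>i j. u i \<bullet> s j"])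
    also have "\<dots> = mv_norm ?I (wedge ?I u)" by (rule mv_norm_wedge_basis[OF h onb, symmetric]) simp
    finally show ?thesis using emeasure_linear_heis[OF lin that] by (simp add: T_def[abs_def])
  qed
  ultimately show ?thesis by (rule that)
qed

text \<open>The relation \<open>T R T = R\<close> forces \<open>\<bar>det T\<bar> = 1\<close>.\<close>

lemma emeasure_linear_involutive_shear:
  fixes T R :: "('n::finite) heis \<Rightarrow> 'n heis"
  assumes T: "linear T" and R: "linear R" and RR: "\<And>x. R (R x) = x" and TRT: "\<And>x. T (R (T x)) = R x"
    and A: "compact A"
  shows "emeasure lborel (T ` A) = emeasure lborel A"
proof -
  define mT where "mT = \<bar>det (matrix (heis_to_vec \<circ> T \<circ> vec_to_heis))\<bar>"
  define mR where "mR = \<bar>det (matrix (heis_to_vec \<circ> R \<circ> vec_to_heis))\<bar>"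
  have eT: "emeasure lborel (T ` A) = ennreal mT * emeasure lborel A" if "compact A" for A
    unfolding mT_def by (rule emeasure_linear_heis[OF T that])
  have eR: "emeasure lborel (R ` A) = ennreal mR * emeasure lborel A" if "compact A" for A
    unfolding mR_def by (rule emeasure_linear_heis[OF R that])
  have cont: "continuous_on B F" if "linear F" for B and F :: "'n heis \<Rightarrow> 'n heis"
    using that by (simp add: linear_continuous_on linear_conv_bounded_linear)
  \<comment> \<open>A test set of positive finite volume turns relations between the maps into
    relations between their determinants.\<close>
  define B where "B = cball (0::'n heis) 1"
  have cB: "compact B" by (simp add: B_def)
  have cTB: "compact (T ` B)" "compact (R ` B)" using cB T R by (auto intro!: compact_continuous_image cont)
  have cRTB: "compact (R ` T ` B)" using cTB R by (auto intro!: compact_continuous_image cont)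
  obtain b where b: "emeasure lborel B = ennreal b" "b > 0"
    unfolding B_def by (simp add: emeasure_cball)
  have m0: "mT \<ge> 0" "mR \<ge> 0" by (auto simp: mT_def mR_def)
  have "R ` R ` B = B" by (simp add: image_image RR)
  then have "ennreal (mR * (mR * b)) = ennreal b"
    using eR[OF cB] eR[OF cTB(2)] b m0 by (simp add: ennreal_mult)
  then have "mR \<noteq> 0" using b(2) by auto
  have "T ` R ` T ` B = R ` B" by (simp add: image_image TRT)
  then have "ennreal (mT * (mR * (mT * b))) = ennreal (mR * b)"
    using eR[OF cB] eT[OF cB] eR[OF cTB(1)] eT[OF cRTB] b m0 by (simp add: ennreal_mult)
  then have "mT * (mR * (mT * b)) = mR * b" using b m0 by (subst (asm) ennreal_inj) auto
  then have "mT * mT = 1" using \<open>mR \<noteq> 0\<close> b(2) by (simp add: field_simps)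
  then have "mT = 1" using m0 by (metis abs_of_nonneg abs_1 square_eq_1_iff abs_minus)
  then show ?thesis using eT[OF A] by simp
qed

text \<open>Every vertical line is translated by an amount that is constant on the line, so Fubini
  applies. The shift h may be nonlinear: the vertical term of the product \<open>z L(z)\<close> is
  quadratic in z.\<close>

lemma emeasure_vertical_shear:
  fixes h :: "('n::finite) heis \<Rightarrow> real"
  assumes h: "continuous_on UNIV h" "\<And>a b s. h (a, b, s) = h (a, b, 0)" and A: "compact A"
  shows "emeasure lborel ((\<lambda>x. x + h x *\<^sub>R e_last) ` A) = emeasure lborel A"
proof -
  let ?F = "\<lambda>x. x + h x *\<^sub>R e_last"
  have "compact (?F ` A)" using A by (intro compact_continuous_image continuous_intros continuous_on_subset[OF h(1)]) auto
  then have FA: "?F ` A \<in> sets borel" by (rule borel_compact)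
  have sA: "A \<in> sets borel" using A by (rule borel_compact)
  have sec: "emeasure lborel B = (\<integral>\<^sup>+a. \<integral>\<^sup>+b. emeasure lborel {s. (a, b, s) \<in> B} \<partial>lborel \<partial>lborel)"
    if "B \<in> sets borel" for B :: "'n heis set"
  proof -
    have B1: "B \<in> sets (lborel \<Otimes>\<^sub>M (lborel :: ((real^'n) \<times> real) measure))" using that by (metis lborel_prod sets_lborel)
    have "emeasure lborel B = emeasure (lborel \<Otimes>\<^sub>M (lborel :: ((real^'n) \<times> real) measure)) B" by (simp add: lborel_prod)
    also have "\<dots> = (\<integral>\<^sup>+a. emeasure lborel (Pair a -` B) \<partial>lborel)"
      by (rule lborel.emeasure_pair_measure_alt[OF B1])
    also have "\<dots> = (\<integral>\<^sup>+a. \<integral>\<^sup>+b. emeasure lborel {s. (a, b, s) \<in> B} \<partial>lborel \<partial>lborel)"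
    proof (rule nn_integral_cong)
      fix a :: "real^'n"
      have "Pair a -` B \<in> sets (lborel :: ((real^'n) \<times> real) measure)"
        using sets_Pair1[OF B1] by simp
      then have B2: "Pair a -` B \<in> sets ((lborel :: (real^'n) measure) \<Otimes>\<^sub>M (lborel :: real measure))" by (metis lborel_prod sets_lborel)
      have "emeasure lborel (Pair a -` B) = emeasure ((lborel :: (real^'n) measure) \<Otimes>\<^sub>M (lborel :: real measure)) (Pair a -` B)"
        by (simp add: lborel_prod)
      also have "\<dots> = (\<integral>\<^sup>+b. emeasure lborel (Pair b -` Pair a -` B) \<partial>lborel)"
        by (rule lborel.emeasure_pair_measure_alt[OF B2])
      finally show "emeasure lborel (Pair a -` B) = (\<integral>\<^sup>+b. emeasure lborel {s. (a, b, s) \<in> B} \<partial>lborel)"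
        by (simp add: vimage_def)
    qed
    finally show ?thesis .
  qed
  have slice: "emeasure lborel {s. (a, b, s) \<in> ?F ` A} = emeasure lborel {s. (a, b, s) \<in> A}" for a b
  proof -
    have FA_iff: "(a, b, s) \<in> ?F ` A \<longleftrightarrow> (a, b, s - h (a, b, 0)) \<in> A" for s
    proof
      assume "(a, b, s) \<in> ?F ` A"
      then obtain x where x: "x \<in> A" "(a, b, s) = x + h x *\<^sub>R e_last" by blast
      obtain a' b' s' where [simp]: "x = (a', b', s')" by (cases x)
      show "(a, b, s - h (a, b, 0)) \<in> A" using x h(2)[of a' b' s'] by (simp add: e_last_def)
    next
      assume "(a, b, s - h (a, b, 0)) \<in> A"
      then show "(a, b, s) \<in> ?F ` A"
        by (intro image_eqI[of _ _ "(a, b, s - h (a, b, 0))"]) (simp_all add: e_last_def h(2)[of a b "s - h (a, b, 0)"])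
    qed
    have "{s. (a, b, s) \<in> ?F ` A} = (+) (- h (a, b, 0)) -` {s. (a, b, s) \<in> A}"
      by (auto simp: FA_iff)
    moreover have "{s. (a, b, s) \<in> A} \<in> sets borel"
    proof -
      have "(\<lambda>s. (a, b, s)) -` A \<in> sets borel"
        using sA by (intro measurable_sets_borel[of _ borel]) (auto intro!: borel_measurable_continuous_onI continuous_intros)
      then show ?thesis by (simp add: vimage_def)
    qed
    ultimately have "emeasure lborel {s. (a, b, s) \<in> ?F ` A}
        = emeasure (distr lborel borel ((+) (- h (a, b, 0)))) {s. (a, b, s) \<in> A}"
      by (subst emeasure_distr) auto
    then show ?thesis by (simp add: lborel_distr_plus)
  qed
  show ?thesis unfolding sec[OF FA] sec[OF sA] slice ..
qed

section \<open>Homogeneous distances\<close>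

declare split_paired_All [simp del] split_paired_Ex [simp del]

lemma hmul_alt:
  "hmul p q = (fst p + fst q, fst (snd p) + fst (snd q), snd (snd p) + snd (snd q) + symp p q / 2)"
  by (simp add: hmul_def e_last_def prod_eq_iff)

lemma hmul_Pair:
  "hmul (a, b, s) (a', b', s') = (a + a', b + b', s + s' + (a \<bullet> b' - b \<bullet> a') / 2)"
  by (simp add: hmul_alt symp_def)

lemma hinv_eq: "hinv p = - p" by (simp add: hinv_def)

lemma hmul_0 [simp]: "hmul 0 x = x" "hmul x 0 = x"
  by (simp_all add: hmul_def symp_def)

lemma hmul_uminus [simp]: "hmul (- x) x = 0" "hmul x (- x) = 0"
  using hmul_hinv[of x] by (simp_all add: hinv_eq)

lemma hmul_cancel [simp]: "hmul (- x) (hmul x y) = y" "hmul x (hmul (- x) y) = y"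
  by (simp_all flip: hmul_assoc)

lemma uminus_hmul: "- hmul x y = hmul (- y) (- x)"
  by (cases x; cases y) (simp add: hmul_Pair inner_commute field_simps)

lemma hmul_e_last: "hmul x (s *\<^sub>R e_last) = x + s *\<^sub>R e_last"
  by (cases x) (simp add: hmul_def symp_def e_last_def)

lemma linear_hdil: "linear (hdil t)"
  by (rule linearI) (simp_all add: hdil_def algebra_simps)

lemma hdil_hmul: "hdil t (hmul x y) = hmul (hdil t x) (hdil t y)"
  by (cases x; cases y) (simp add: hdil_def hmul_Pair algebra_simps power2_eq_square)

lemma hdil_hdil: "hdil s (hdil t x) = hdil (s * t) x"
  by (simp add: hdil_def power_mult_distrib)

lemma hdil_1 [simp]: "hdil 1 x = x" by (simp add: hdil_def)

lemma hdil_inverse: "t \<noteq> 0 \<Longrightarrow> hdil (1 / t) (hdil t x) = x" "t \<noteq> 0 \<Longrightarrow> hdil t (hdil (1 / t) x) = x"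
  by (simp_all add: hdil_hdil)

lemma hdil_0 [simp]: "hdil 0 x = 0" "hdil t 0 = 0" by (simp_all add: hdil_def prod_eq_iff)

lemma hdil_uminus: "hdil t (- x) = - hdil t x" by (simp add: hdil_def prod_eq_iff)

lemma hdil_H1: "x \<in> H1 \<Longrightarrow> hdil t x = t *\<^sub>R x" by (simp add: hdil_def H1_def prod_eq_iff)

lemma H1_scaleR: "x \<in> H1 \<Longrightarrow> t *\<^sub>R x \<in> H1" by (simp add: H1_def)

lemma hmul_scaleR: "hmul (s *\<^sub>R x) (t *\<^sub>R x) = (s + t) *\<^sub>R x" if "x \<in> H1"
  using that by (cases x) (simp add: hmul_Pair H1_def scaleR_add_left inner_commute)

lemma continuous_on_symp [continuous_intros]:
  "continuous_on A f \<Longrightarrow> continuous_on A g \<Longrightarrow> continuous_on A (\<lambda>x. symp (f x) (g x))"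
  unfolding symp_def by (intro continuous_intros)

lemma continuous_on_hmul [continuous_intros]:
  "continuous_on A f \<Longrightarrow> continuous_on A g \<Longrightarrow> continuous_on A (\<lambda>x. hmul (f x) (g x))"
  unfolding hmul_def by (intro continuous_intros)

lemma continuous_on_hdil [continuous_intros]:
  "continuous_on A t \<Longrightarrow> continuous_on A f \<Longrightarrow> continuous_on A (\<lambda>x. hdil (t x) (f x))"
  unfolding hdil_def by (intro continuous_intros)

lemma tendsto_hmul [tendsto_intros]:
  "(f \<longlongrightarrow> a) F \<Longrightarrow> (g \<longlongrightarrow> b) F \<Longrightarrow> ((\<lambda>x. hmul (f x) (g x)) \<longlongrightarrow> hmul a b) F"
  unfolding hmul_def symp_def by (intro tendsto_intros)

lemma tendsto_hdil [tendsto_intros]: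
  "(t \<longlongrightarrow> s) F \<Longrightarrow> (g \<longlongrightarrow> b) F \<Longrightarrow> ((\<lambda>x. hdil (t x) (g x)) \<longlongrightarrow> hdil s b) F"
  unfolding hdil_def by (intro tendsto_intros)

text \<open>A concrete gauge with the same scaling under \<open>hdil\<close> as the norm of any
  homogeneous distance; it serves as the go-between from d to the Euclidean norm.\<close>

definition hgauge :: "('n::finite) heis \<Rightarrow> real" where
  "hgauge x = norm (fst x) + norm (fst (snd x)) + sqrt \<bar>snd (snd x)\<bar>"

lemma hgauge_nonneg: "0 \<le> hgauge x" by (simp add: hgauge_def)

lemma hgauge_eq_0: "hgauge x = 0 \<longleftrightarrow> x = 0"
proof
  assume "hgauge x = 0"
  moreover have "0 \<le> norm (fst x)" "0 \<le> norm (fst (snd x))" "0 \<le> sqrt \<bar>snd (snd x)\<bar>" by simp_all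
  ultimately have "norm (fst x) = 0 \<and> norm (fst (snd x)) = 0 \<and> sqrt \<bar>snd (snd x)\<bar> = 0"
    unfolding hgauge_def by linarith
  then show "x = 0" by (simp add: prod_eq_iff)
qed (simp add: hgauge_def)

lemma hgauge_hdil: "0 \<le> t \<Longrightarrow> hgauge (hdil t x) = t * hgauge x"
  by (simp add: hgauge_def hdil_def abs_mult real_sqrt_mult algebra_simps)

lemma continuous_on_hgauge [continuous_intros]:
  "continuous_on A f \<Longrightarrow> continuous_on A (\<lambda>x. hgauge (f x))"
  unfolding hgauge_def by (intro continuous_intros)

lemma tendsto_hgauge [tendsto_intros]: "(f \<longlongrightarrow> a) F \<Longrightarrow> ((\<lambda>x. hgauge (f x)) \<longlongrightarrow> hgauge a) F"
  unfolding hgauge_def by (intro tendsto_intros)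

lemma norm_le_hgauge: "norm x \<le> hgauge x + (hgauge x)\<^sup>2"
proof -
  obtain a b s where [simp]: "x = (a, b, s)" by (cases x)
  have "norm x \<le> norm a + norm b + \<bar>s\<bar>"
    using norm_Pair_le[of a "(b, s)"] norm_Pair_le[of b s] by simp
  also have "\<bar>s\<bar> \<le> (hgauge x)\<^sup>2"
    using power_mono[of "sqrt \<bar>s\<bar>" "hgauge x" 2] by (simp add: hgauge_def)
  finally have "norm x \<le> norm a + norm b + (hgauge x)\<^sup>2" by simp
  moreover have "norm a + norm b \<le> hgauge x" by (simp add: hgauge_def)
  ultimately show ?thesis by linarith
qed

section \<open>Comparison of a homogeneous distance with the Euclidean structure\<close>

locale homdist =
  fixes d :: "('n::finite) heis \<Rightarrow> 'n heis \<Rightarrow> real"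
  assumes hd: "homogeneous_distance d"
begin

abbreviation N :: "'n heis \<Rightarrow> real" where "N \<equiv> hnorm d"

lemma d_nonneg [simp]: "0 \<le> d x y"
  and d_sym: "d x y = d y x"
  and d_0 [simp]: "d x y = 0 \<longleftrightarrow> x = y"
  and d_tri: "d x z \<le> d x y + d y z"
  and d_left [simp]: "d (hmul z x) (hmul z y) = d x y"
  and d_dil: "0 < t \<Longrightarrow> d (hdil t x) (hdil t y) = t * d x y"
  using hd unfolding homogeneous_distance_def Metric_space_def by blast+

lemma d_refl [simp]: "d x x = 0" by (subst d_0) simp

lemma N_nonneg [simp]: "0 \<le> N x" by (simp add: hnorm_def)

lemma N_0 [simp]: "N 0 = 0" by (simp add: hnorm_def)

lemma N_eq_0 [simp]: "N x = 0 \<longleftrightarrow> x = 0" by (simp add: hnorm_def)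

lemma N_pos [simp]: "0 < N x \<longleftrightarrow> x \<noteq> 0" using N_nonneg[of x] N_eq_0[of x] by linarith

lemma d_N: "d x y = N (hmul (- x) y)"
  using d_left[of "- x" x y] by (simp add: hnorm_def d_sym)

lemma N_uminus [simp]: "N (- x) = N x"
  using d_left[of x "- x" 0] by (simp add: hnorm_def d_sym)

lemma N_hmul: "N (hmul x y) \<le> N x + N y"
  using d_N[of "- x" y] d_tri[of "- x" y 0] N_uminus[of x] by (simp add: hnorm_def d_sym)

lemma N_dil: "0 \<le> t \<Longrightarrow> N (hdil t x) = t * N x"
  using d_dil[of t x 0] by (cases "t = 0") (simp_all add: hnorm_def)

lemma N_scaleR: "x \<in> H1 \<Longrightarrow> N (t *\<^sub>R x) = \<bar>t\<bar> * N x"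
  using N_dil[of t x] N_dil[of "- t" x] N_uminus[of "t *\<^sub>R x"] by (cases "0 \<le> t") (simp_all add: hdil_H1)

lemma d_hmul_right: "d x (hmul x y) = N y" by (simp add: d_N)

text \<open>Continuity of d is not known at this point, so the bound is algebraic: every element is
  a product of multiples of basis vectors, and N is subadditive under products and homogeneous under
  dilations. Continuity of N is then a consequence.\<close>

lemma ex_N_le_hgauge: "\<exists>C>0. \<forall>x. N x \<le> C * hgauge x"
proof -
  \<comment> \<open>For vectors with vanishing symplectic products the sum coincides with the group
    product.\<close>
  have sum_le: "N (\<Sum>i\<in>A. g i) \<le> (\<Sum>i\<in>A. N (g i))"
    if "finite A" "\<And>i j. symp (g i) (g j) = 0" for A :: "'n set" and g :: "'n \<Rightarrow> 'n heis"
    using that(1)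
  proof (induction A rule: finite_induct)
    case (insert i A)
    have "symp (g i) (\<Sum>j\<in>A. g j) = (\<Sum>j\<in>A. symp (g i) (g j))"
      by (simp add: symp_def fst_sum snd_sum inner_sum_left inner_sum_right sum_subtractf)
    then have "symp (g i) (\<Sum>j\<in>A. g j) = 0" by (simp add: that(2))
    then have "(\<Sum>j\<in>insert i A. g j) = hmul (g i) (\<Sum>j\<in>A. g j)" using insert by (simp add: hmul_def)
    then show ?case using insert N_hmul[of "g i" "\<Sum>j\<in>A. g j"] by simp
  qed simp
  have ax: "axis i (t :: real) = t *\<^sub>R axis i 1" for i :: 'n and t by (simp add: axis_def vec_eq_iff)
  define C1 where "C1 = (\<Sum>i\<in>UNIV. N (axis i 1, 0, 0))"
  define C2 where "C2 = (\<Sum>i\<in>UNIV. N (0, axis i 1, 0))"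
  have C12: "0 \<le> C1" "0 \<le> C2" by (auto simp: C1_def C2_def intro!: sum_nonneg)
  have N1: "N (a, 0, 0) \<le> C1 * norm a" for a
  proof -
    have "(a, 0, 0) = (\<Sum>i\<in>UNIV. (axis i (a $ i), 0, 0) :: 'n heis)"
      by (simp add: prod_eq_iff fst_sum snd_sum vec_eq_iff axis_def if_distrib cong: if_cong)
    then have "N (a, 0, 0) \<le> (\<Sum>i\<in>UNIV. N ((a $ i) *\<^sub>R (axis i 1, 0, 0)))"
      using sum_le[of UNIV "\<lambda>i. (axis i (a $ i), 0, 0)"] by (simp add: symp_def flip: ax)
    also have "\<dots> = (\<Sum>i\<in>UNIV. \<bar>a $ i\<bar> * N (axis i 1, 0, 0))"
      by (intro sum.cong refl N_scaleR) (simp add: H1_def)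
    also have "\<dots> \<le> (\<Sum>i\<in>UNIV. norm a * N (axis i 1, 0, 0))"
      by (intro sum_mono mult_right_mono component_le_norm_cart) auto
    finally show ?thesis by (simp add: C1_def sum_distrib_left mult.commute)
  qed
  have N2: "N (0, b, 0) \<le> C2 * norm b" for b
  proof -
    have "(0, b, 0) = (\<Sum>i\<in>UNIV. (0, axis i (b $ i), 0) :: 'n heis)"
      by (simp add: prod_eq_iff fst_sum snd_sum vec_eq_iff axis_def if_distrib cong: if_cong)
    then have "N (0, b, 0) \<le> (\<Sum>i\<in>UNIV. N ((b $ i) *\<^sub>R (0, axis i 1, 0)))"
      using sum_le[of UNIV "\<lambda>i. (0, axis i (b $ i), 0)"] by (simp add: symp_def flip: ax)
    also have "\<dots> = (\<Sum>i\<in>UNIV. \<bar>b $ i\<bar> * N (0, axis i 1, 0))"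
      by (intro sum.cong refl N_scaleR) (simp add: H1_def)
    also have "\<dots> \<le> (\<Sum>i\<in>UNIV. norm b * N (0, axis i 1, 0))"
      by (intro sum_mono mult_right_mono component_le_norm_cart) auto
    finally show ?thesis by (simp add: C2_def sum_distrib_left mult.commute)
  qed
  have N3: "N (0, 0, s) = sqrt \<bar>s\<bar> * N (0, 0, 1)" for s
  proof -
    have "hdil (sqrt \<bar>s\<bar>) (0, 0, 1) = ((0, 0, \<bar>s\<bar>) :: 'n heis)" by (simp add: hdil_def)
    then have "N (0, 0, \<bar>s\<bar>) = sqrt \<bar>s\<bar> * N (0, 0, 1)" using N_dil[of "sqrt \<bar>s\<bar>" "(0,0,1)"] by simp
    then show ?thesis using N_uminus[of "(0, 0, s)"] by (simp add: abs_if split: if_splits)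
  qed
  define C where "C = C1 + C2 + N (0,0,1) + 1"
  have "N x \<le> (2 * C) * hgauge x" for x
  proof -
    obtain a b s where [simp]: "x = (a, b, s)" by (cases x)
    \<comment> \<open>The first two factors produce the vertical coordinate
      \<open>a \<bullet> b / 2\<close>, which the last one corrects.\<close>
    have "x = hmul (hmul (a, 0, 0) (0, b, 0)) (0, 0, s - a \<bullet> b / 2)" by (simp add: hmul_Pair)
    then have "N x \<le> N (a, 0, 0) + N (0, b, 0) + N (0, 0, s - a \<bullet> b / 2)"
      using N_hmul[of "hmul (a, 0, 0) (0, b, 0)" "(0, 0, s - a \<bullet> b / 2)"] N_hmul[of "(a, 0, 0)" "(0, b, 0)"] by simp
    also have "\<dots> \<le> C1 * norm a + C2 * norm b + sqrt \<bar>s - a \<bullet> b / 2\<bar> * N (0, 0, 1)"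
      using N1[of a] N2[of b] N3[of "s - a \<bullet> b / 2"] by linarith
    also have "sqrt \<bar>s - a \<bullet> b / 2\<bar> \<le> hgauge x"
    proof (rule real_le_lsqrt)
      have "\<bar>s - a \<bullet> b / 2\<bar> \<le> (sqrt \<bar>s\<bar>)\<^sup>2 + norm a * norm b"
        using Cauchy_Schwarz_ineq2[of a b] by (simp add: abs_if split: if_splits)
      also have "\<dots> \<le> (hgauge x)\<^sup>2"
        by (simp add: hgauge_def power2_eq_square algebra_simps)
      finally show "\<bar>s - a \<bullet> b / 2\<bar> \<le> (hgauge x)\<^sup>2" .
    qed (simp add: hgauge_nonneg)
    also have "C1 * norm a + C2 * norm b + hgauge x * N (0,0,1) \<le> C1 * hgauge x + C2 * hgauge x + hgauge x * N (0,0,1)"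
      using C12 by (intro add_mono mult_left_mono) (auto simp: hgauge_def)
    also have "\<dots> \<le> (2 * C) * hgauge x"
      using C12 hgauge_nonneg[of x] N_nonneg[of "(0,0,1)"] unfolding C_def
      by (simp add: algebra_simps add_increasing)
    finally show ?thesis by (simp add: mult_right_mono)
  qed
  moreover have "0 < C" unfolding C_def using C12 by (intro add_nonneg_pos add_nonneg_nonneg) auto
  ultimately show ?thesis by (intro exI[of _ "2 * C"]) auto
qed

lemma N_diff_le: "\<bar>N x - N y\<bar> \<le> N (hmul (- x) y)"
proof -
  have "d x 0 \<le> d x y + d y 0" "d y 0 \<le> d x y + d x 0" using d_tri[of x 0 y] d_tri[of y 0 x] by (simp_all add: d_sym)
  then show ?thesis unfolding d_N[symmetric] by (simp add: hnorm_def)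
qed

lemma isCont_N: "isCont N x"
proof -
  obtain C where C: "C > 0" "\<And>x. N x \<le> C * hgauge x" using ex_N_le_hgauge by blast
  have "((\<lambda>y. C * hgauge (hmul (- x) y)) \<longlongrightarrow> C * hgauge (hmul (- x) x)) (at x)"
    by (intro tendsto_intros)
  then have "((\<lambda>y. C * hgauge (hmul (- x) y)) \<longlongrightarrow> 0) (at x)" by (simp add: hgauge_def)
  then have "((\<lambda>y. N y - N x) \<longlongrightarrow> 0) (at x)"
  proof (rule Lim_null_comparison[rotated], intro always_eventually allI)
    fix y
    show "norm (N y - N x) \<le> C * hgauge (hmul (- x) y)"
      using N_diff_le[of x y] C(2)[of "hmul (- x) y"] by simp
  qed
  then show ?thesis unfolding isCont_def by (rule LIM_zero_cancel)
qed

lemma continuous_on_N [continuous_intros]: "continuous_on A f \<Longrightarrow> continuous_on A (\<lambda>x. N (f x))"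
  by (rule continuous_on_compose2[of UNIV N A f]) (auto intro: continuous_at_imp_continuous_on isCont_N)

lemma tendsto_N [tendsto_intros]: "(f \<longlongrightarrow> a) F \<Longrightarrow> ((\<lambda>x. N (f x)) \<longlongrightarrow> N a) F"
  using isCont_tendsto_compose[OF isCont_N] .

lemma continuous_on_d [continuous_intros]:
  "continuous_on A f \<Longrightarrow> continuous_on A g \<Longrightarrow> continuous_on A (\<lambda>x. d (f x) (g x))"
  by (subst d_N) (rule continuous_on_N[OF continuous_on_hmul[OF continuous_on_minus]])

lemma tendsto_d [tendsto_intros]:
  "(f \<longlongrightarrow> a) F \<Longrightarrow> (g \<longlongrightarrow> b) F \<Longrightarrow> ((\<lambda>x. d (f x) (g x)) \<longlongrightarrow> d a b) F"
  by (subst d_N, subst d_N) (rule tendsto_N[OF tendsto_hmul[OF tendsto_minus]])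

text \<open>N is continuous and positive on the compact unit sphere of the gauge, hence bounded
  below there; dilations carry the bound to all points.\<close>

lemma ex_hgauge_le_N: "\<exists>C>0. \<forall>x. hgauge x \<le> C * N x"
proof -
  define K where "K = {x :: 'n heis. hgauge x = 1}"
  have "closed K" unfolding K_def by (intro closed_Collect_eq continuous_intros)
  moreover have "bounded K"
    unfolding bounded_iff
  proof (intro exI[of _ 2] ballI)
    fix x assume "x \<in> K"
    then show "norm x \<le> 2" using norm_le_hgauge[of x] by (simp add: K_def)
  qed
  ultimately have "compact K" by (simp add: compact_eq_bounded_closed)
  moreover have "(0, 0, 1) \<in> K" by (simp add: K_def hgauge_def)
  ultimately have "\<exists>x0\<in>K. \<forall>x\<in>K. N x0 \<le> N x"
    by (intro continuous_attains_inf continuous_on_N continuous_on_id) auto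
  then obtain x0 where x0: "x0 \<in> K" "\<And>x. x \<in> K \<Longrightarrow> N x0 \<le> N x" by blast
  have "x0 \<noteq> 0" using x0(1) by (auto simp: K_def hgauge_def)
  then have pos: "N x0 > 0" by simp
  have "hgauge x \<le> (1 / N x0) * N x" for x
  proof (cases "x = 0")
    case False
    then have g: "hgauge x > 0" using hgauge_nonneg[of x] hgauge_eq_0[of x] by linarith
    then have "hdil (1 / hgauge x) x \<in> K" by (simp add: K_def hgauge_hdil)
    from x0(2)[OF this] g have "N x0 \<le> 1 / hgauge x * N x" by (simp add: N_dil)
    then show ?thesis using g pos by (simp add: field_simps)
  qed (simp add: hgauge_def)
  then show ?thesis using pos by (intro exI[of _ "1 / N x0"]) auto
qed

text \<open>The square accounts for the vertical coordinate, on which dilations act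
  quadratically.\<close>

lemma ex_norm_le_N: "\<exists>C>0. \<forall>x. norm x \<le> C * (N x + (N x)\<^sup>2)"
proof -
  obtain C where C: "C > 0" "\<And>x. hgauge x \<le> C * N x" using ex_hgauge_le_N by blast
  have "norm x \<le> (C + C\<^sup>2) * (N x + (N x)\<^sup>2)" for x
  proof -
    have "norm x \<le> C * N x + (C * N x)\<^sup>2"
      using norm_le_hgauge[of x] C power_mono[OF C(2)[of x] hgauge_nonneg, of 2] by (smt (verit))
    also have "\<dots> \<le> (C + C\<^sup>2) * (N x + (N x)\<^sup>2)" using C by (simp add: algebra_simps)
    finally show ?thesis .
  qed
  moreover have "C + C\<^sup>2 > 0" using C by (simp add: add_pos_pos)
  ultimately show ?thesis by blast
qed

lemma N_small: "0 < e \<Longrightarrow> \<exists>\<delta>>0. \<forall>x. N x < \<delta> \<longrightarrow> norm x < e"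
proof -
  assume "0 < e"
  obtain C where C: "C > 0" "\<And>x. norm x \<le> C * (N x + (N x)\<^sup>2)" using ex_norm_le_N by blast
  define \<delta> where "\<delta> = min 1 (e / (2 * C))"
  have "norm x < e" if "N x < \<delta>" for x
  proof -
    have "(N x)\<^sup>2 \<le> N x * 1" unfolding power2_eq_square using that by (intro mult_left_mono) (auto simp: \<delta>_def)
    then have "norm x \<le> C * (2 * N x)" using C(2)[of x] C(1) by (smt (verit) mult_left_mono)
    also have "\<dots> < C * (2 * (e / (2 * C)))" using that C(1) by (intro mult_strict_left_mono) (auto simp: \<delta>_def)
    finally show ?thesis using C(1) by simp
  qed
  moreover have "\<delta> > 0" using \<open>0 < e\<close> C by (simp add: \<delta>_def)
  ultimately show ?thesis by blast
qed

text \<open>Left translation reduces the claim to neighbourhoods of 0, where small N forces small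
  Euclidean norm. With continuity of d this identifies the two topologies.\<close>

lemma d_small:
  assumes "open A" "x \<in> A"
  shows "\<exists>\<delta>>0. \<forall>y. d x y < \<delta> \<longrightarrow> y \<in> A"
proof -
  have "continuous_on UNIV (hmul x)" by (intro continuous_intros)
  then have "open (hmul x -` A)" using assms(1) by (intro open_vimage) auto
  moreover have "0 \<in> hmul x -` A" using assms by simp
  ultimately obtain e where "e > 0" "ball 0 e \<subseteq> hmul x -` A" by (meson open_contains_ball)
  moreover obtain \<delta> where "\<delta> > 0" "\<And>z. N z < \<delta> \<Longrightarrow> norm z < e" using N_small[OF \<open>e > 0\<close>] by blast
  moreover have "y \<in> A" if "norm (hmul (- x) y) < e" "ball 0 e \<subseteq> hmul x -` A" for y
    using subsetD[OF that(2), of "hmul (- x) y"] that(1) by simp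
  ultimately show ?thesis by (intro exI[of _ \<delta>] conjI allI impI) (simp_all add: d_N)
qed

lemma open_d_ball: "open {y. d x y < r}"
  by (intro open_Collect_less continuous_intros)

lemma compact_hcball: "compact (hcball d x r)"
proof -
  have "closed (hcball d x r)" unfolding hcball_def by (intro closed_Collect_le continuous_intros)
  moreover have "bounded (hcball d x r)"
  proof -
    obtain C where C: "C > 0" "\<And>x. norm x \<le> C * (N x + (N x)\<^sup>2)" using ex_norm_le_N by blast
    have "norm y \<le> C * ((N x + r) + (N x + r)\<^sup>2)" if "y \<in> hcball d x r" for y
    proof -
      have "N y \<le> N x + r" using that d_tri[of y 0 x] by (simp add: hcball_def hnorm_def d_sym)
      then have "N y + (N y)\<^sup>2 \<le> (N x + r) + (N x + r)\<^sup>2" by (intro add_mono power_mono) auto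
      then show ?thesis using C by (meson mult_le_cancel_left_pos order_trans)
    qed
    then show ?thesis unfolding bounded_iff by blast
  qed
  ultimately show ?thesis by (simp add: compact_eq_bounded_closed)
qed

lemma ex_N_le_norm_H1: "\<exists>C>0. \<forall>x\<in>H1. N x \<le> C * norm x"
proof -
  obtain C where C: "C > 0" "\<And>x. N x \<le> C * hgauge x" using ex_N_le_hgauge by blast
  have "N x \<le> (2 * C) * norm x" if "x \<in> H1" for x
  proof -
    have "hgauge x \<le> 2 * norm x"
    proof -
      have "snd (snd x) = 0" using that by (simp add: H1_def)
      then obtain a b where x: "x = (a, b, 0)" by (metis prod.collapse)
      have "norm a \<le> norm x" "norm (b, 0 :: real) \<le> norm x"
        unfolding x by (rule norm_fst_le, rule norm_snd_le)
      then show ?thesis by (simp add: x hgauge_def)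
    qed
    then have "C * hgauge x \<le> C * (2 * norm x)" using C(1) by (intro mult_left_mono) auto
    then show ?thesis using C(2)[of x] by simp
  qed
  then show ?thesis using C(1) by (intro exI[of _ "2 * C"]) auto
qed

end

section \<open>Strict differentiability\<close>

text \<open>Vertical vectors are commutators, and a homomorphism into an abelian group kills
  commutators.\<close>

lemma h_hom_e_last:
  fixes L :: "('n::finite) heis \<Rightarrow> 'b::real_normed_vector"
  assumes "h_hom L"
  shows "L (s *\<^sub>R e_last) = 0"
proof -
  have add: "L (hmul x y) = L x + L y" for x y using assms by (auto simp: h_hom_def)
  have "L 0 = 0" using add[of 0 0] by simp
  then have neg: "L (- x) = - L x" for x using add[of x "- x"] by (simp add: eq_neg_iff_add_eq_0 add.commute)
  define i :: 'n where "i = undefined"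
  define x :: "'n heis" where "x = (axis i s, 0, 0)"
  define y :: "'n heis" where "y = (0, axis i 1, 0)"
  have "s *\<^sub>R e_last = hmul (hmul x y) (hmul (- x) (- y))"
    by (simp add: x_def y_def hmul_Pair e_last_def inner_axis_axis)
  then show ?thesis by (simp add: add neg)
qed

text \<open>Product and sum, and likewise dilation and scalar multiplication, differ only by
  multiples of \<open>e_last\<close>, which L annihilates.\<close>

lemma h_hom_linear:
  assumes "h_hom L"
  shows "linear L"
proof -
  have add: "L (hmul x y) = L x + L y" for x y using assms by (auto simp: h_hom_def)
  have dil: "0 < t \<Longrightarrow> L (hdil t x) = t *\<^sub>R L x" for t x using assms by (auto simp: h_hom_def)
  have L0: "L 0 = 0" using add[of 0 0] by simp
  then have neg: "L (- x) = - L x" for x using add[of x "- x"] by (simp add: eq_neg_iff_add_eq_0 add.commute)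
  have vert: "L (x + s *\<^sub>R e_last) = L x" for x s
    using add[of x "s *\<^sub>R e_last"] h_hom_e_last[OF assms, of s] by (simp add: hmul_e_last)
  have plus: "L (x + y) = L x + L y" for x y
  proof -
    have "hmul x y = (x + y) + ((1/2) * symp x y) *\<^sub>R e_last" by (simp add: hmul_def)
    then show ?thesis using add[of x y] vert[of "x + y"] by simp
  qed
  have pos: "L (t *\<^sub>R x) = t *\<^sub>R L x" if "0 < t" for t x
  proof -
    have "hdil t x = t *\<^sub>R x + ((t\<^sup>2 - t) * snd (snd x)) *\<^sub>R e_last"
      by (simp add: hdil_def e_last_def prod_eq_iff algebra_simps)
    then show ?thesis using vert dil[OF that] by metis
  qed
  have "L (t *\<^sub>R x) = t *\<^sub>R L x" for t x
  proof (cases t "0::real" rule: linorder_cases)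
    case less
    then show ?thesis using pos[of "- t" x] neg[of "t *\<^sub>R x"] by simp
  qed (use pos L0 in auto)
  with plus show ?thesis by (rule linearI)
qed

context homdist begin

text \<open>Only the horizontal part of x enters \<open>L x\<close>. Its Euclidean norm is bounded
  linearly by N, whereas the full Euclidean norm is not.\<close>

lemma h_hom_bounded:
  fixes L :: "'n heis \<Rightarrow> 'b::real_normed_vector"
  assumes "h_hom L"
  shows "\<exists>K>0. \<forall>x. norm (L x) \<le> K * N x"
proof -
  have lin: "linear L" using assms by (rule h_hom_linear)
  then have "bounded_linear L" by (simp add: linear_conv_bounded_linear)
  then obtain B where B: "B > 0" "\<And>x. norm (L x) \<le> norm x * B" by (metis bounded_linear.pos_bounded)
  obtain C where C: "C > 0" "\<And>x. hgauge x \<le> C * N x" using ex_hgauge_le_N by blast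
  have "norm (L x) \<le> (B * C) * N x" for x
  proof -
    obtain a b s where [simp]: "x = (a, b, s)" by (cases x)
    have "x = (a, b, 0) + s *\<^sub>R e_last" by (simp add: e_last_def)
    then have "L x = L (a, b, 0) + L (s *\<^sub>R e_last)" by (simp only: linear_add[OF lin])
    then have "L x = L (a, b, 0)" by (simp only: h_hom_e_last[OF assms] add_0_right)
    then have "norm (L x) \<le> norm (a, b, 0 :: real) * B" by (simp only: B(2))
    also have "norm (a, b, 0 :: real) \<le> norm a + norm b"
      using norm_Pair_le[of a "(b, 0 :: real)"] norm_Pair_le[of b "0 :: real"] by simp
    also have "norm a + norm b \<le> hgauge x" by (simp add: hgauge_def)
    also have "\<dots> \<le> C * N x" by (rule C(2))
    finally show ?thesis using B(1) by (simp add: mult_ac)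
  qed
  then show ?thesis using B C by (intro exI[of _ "B * C"]) auto
qed

text \<open>The difference of two derivatives, divided by N, is constant along the dilates
  \<open>hdil t w\<close> and yet tends to 0 with t.\<close>

lemma has_h_derivative_unique:
  assumes "has_h_derivative d f L x" "has_h_derivative d f L' x"
  shows "L = L'"
proof
  fix w
  have hom: "h_hom L" "h_hom L'" using assms by (auto simp: has_h_derivative_def)
  then have lin: "linear L" "linear L'" by (auto intro: h_hom_linear)
  show "L w = L' w"
  proof (cases "w = 0")
    case False
    have lim: "((\<lambda>w. norm (f (hmul x w) - f x - L w) / N w + norm (f (hmul x w) - f x - L' w) / N w) \<longlongrightarrow> 0 + 0) (at 0)"
      using assms unfolding has_h_derivative_def by (intro tendsto_add) auto
    have "((\<lambda>w. norm (L w - L' w) / N w) \<longlongrightarrow> 0) (at 0)"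
    proof (rule Lim_null_comparison[OF always_eventually])
      show "\<forall>w. norm (norm (L w - L' w) / N w)
          \<le> norm (f (hmul x w) - f x - L w) / N w + norm (f (hmul x w) - f x - L' w) / N w"
      proof
        fix w
        have "norm (L w - L' w) \<le> norm (f (hmul x w) - f x - L w) + norm (f (hmul x w) - f x - L' w)"
          using norm_triangle_ineq4[of "f (hmul x w) - f x - L' w" "f (hmul x w) - f x - L w"] by simp
        then show "norm (norm (L w - L' w) / N w)
          \<le> norm (f (hmul x w) - f x - L w) / N w + norm (f (hmul x w) - f x - L' w) / N w"
          by (simp add: divide_right_mono flip: add_divide_distrib)
      qed
    qed (use lim in simp)
    moreover have "filterlim (\<lambda>t. hdil t w) (at 0) (at_right 0)"
    proof -
      have "((\<lambda>t. hdil t w) \<longlongrightarrow> hdil 0 w) (at_right 0)" by (intro tendsto_intros)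
      moreover have "eventually (\<lambda>t. hdil t w \<noteq> 0) (at_right 0)"
        unfolding eventually_at_right_field
        using False by (intro exI[of _ 1]) (metis N_dil N_eq_0 less_eq_real_def less_numeral_extra(1) mult_eq_0_iff not_less_iff_gr_or_eq)
      ultimately show ?thesis by (simp add: filterlim_at)
    qed
    ultimately have "((\<lambda>t. norm (L (hdil t w) - L' (hdil t w)) / N (hdil t w)) \<longlongrightarrow> 0) (at_right 0)"
      by (rule filterlim_compose)
    moreover have "eventually (\<lambda>t. norm (L (hdil t w) - L' (hdil t w)) / N (hdil t w) = norm (L w - L' w) / N w) (at_right 0)"
      unfolding eventually_at_right_field
      using hom by (intro exI[of _ 1]) (auto simp: h_hom_def N_dil simp flip: scaleR_diff_right)
    ultimately have "((\<lambda>t::real. norm (L w - L' w) / N w) \<longlongrightarrow> 0) (at_right 0)"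
      using tendsto_cong by force
    then have "norm (L w - L' w) / N w = 0" by (simp add: tendsto_const_iff)
    then show ?thesis using False by simp
  qed (use lin linear_0 in metis)
qed

lemma h_deriv_eq: "has_h_derivative d f L x \<Longrightarrow> h_deriv d f x = L"
  unfolding h_deriv_def by (rule the_equality) (auto intro: has_h_derivative_unique)

lemma C1h_has_h_derivative: "C1h d \<Omega> f \<Longrightarrow> x \<in> \<Omega> \<Longrightarrow> has_h_derivative d f (h_deriv d f x) x"
  unfolding C1h_def by (elim conjE ballE exE) (auto simp: h_deriv_eq)

text \<open>The definition controls the differentials on the unit ball of N; their homogeneity
  extends the bound to all w at the price of the factor \<open>N w\<close>.\<close>

lemma C1h_continuous:
  assumes "C1h d \<Omega> f" "open \<Omega>" "x \<in> \<Omega>" "0 < \<epsilon>"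
  shows "\<exists>\<delta>>0. \<forall>y. d x y < \<delta> \<longrightarrow> y \<in> \<Omega> \<and> (\<forall>w. norm (h_deriv d f y w - h_deriv d f x w) \<le> \<epsilon> * N w)"
proof -
  have "uniform_limit {w. N w \<le> 1} (h_deriv d f) (h_deriv d f x) (at x within \<Omega>)"
    using assms by (auto simp: C1h_def)
  then have "\<forall>\<^sub>F y in at x within \<Omega>. \<forall>w\<in>{w. N w \<le> 1}. dist (h_deriv d f y w) (h_deriv d f x w) < \<epsilon>"
    using assms(4) by (rule uniform_limitD)
  then have "\<forall>\<^sub>F y in at x. \<forall>w\<in>{w. N w \<le> 1}. dist (h_deriv d f y w) (h_deriv d f x w) < \<epsilon>"
    using at_within_open[OF assms(3,2)] by simp
  then obtain A where A: "open A" "x \<in> A"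
      "\<And>y. y \<in> A \<Longrightarrow> y \<noteq> x \<Longrightarrow> \<forall>w\<in>{w. N w \<le> 1}. dist (h_deriv d f y w) (h_deriv d f x w) < \<epsilon>"
    by (auto simp: eventually_at_topological)
  have "open (A \<inter> \<Omega>)" "x \<in> A \<inter> \<Omega>" using A assms by auto
  from d_small[OF this] obtain \<delta> where \<delta>: "\<delta> > 0" "\<And>y. d x y < \<delta> \<Longrightarrow> y \<in> A \<inter> \<Omega>" by blast
  have "norm (h_deriv d f y w - h_deriv d f x w) \<le> \<epsilon> * N w" if "d x y < \<delta>" for y w
  proof (cases "y = x \<or> w = 0")
    case True
    have "h_deriv d f z 0 = 0" if "z \<in> \<Omega>" for z
      using C1h_has_h_derivative[OF assms(1) that] linear_0[OF h_hom_linear] by (auto simp: has_h_derivative_def)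
    then show ?thesis using True \<delta>(2)[OF that] assms by (cases "y = x") auto
  next
    case False
    then have Nw: "N w > 0" by simp
    define w' where "w' = hdil (1 / N w) w"
    have w: "w = hdil (N w) w'" using Nw by (simp add: w'_def hdil_hdil)
    have "N w' = 1" using Nw by (simp add: w'_def N_dil)
    have "norm (h_deriv d f y w' - h_deriv d f x w') < \<epsilon>"
      using A(3)[of y] False \<delta>(2)[OF that] \<open>N w' = 1\<close> by (auto simp: dist_norm)
    moreover have "h_deriv d f z w = N w *\<^sub>R h_deriv d f z w'" if "z \<in> \<Omega>" for z
    proof -
      have "h_deriv d f z (hdil (N w) w') = N w *\<^sub>R h_deriv d f z w'"
        using C1h_has_h_derivative[OF assms(1) that] Nw by (simp add: has_h_derivative_def h_hom_def)
      then show ?thesis by (simp flip: w)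
    qed
    ultimately show ?thesis
      using \<delta>(2)[OF that] assms(3) Nw by (simp flip: scaleR_diff_right add: mult.commute)
  qed
  then show ?thesis using \<delta> by (intro exI[of _ \<delta>]) auto
qed

text \<open>On a horizontal line group increments add like scalars and N is a multiple of the
  absolute value, so the h-derivative restricts to an ordinary derivative.\<close>

lemma h_derivative_segment:
  assumes der: "has_h_derivative d f L (hmul q (t *\<^sub>R X))" and X: "X \<in> H1"
  shows "((\<lambda>t. f (hmul q (t *\<^sub>R X))) has_vector_derivative L X) (at t)"
proof (cases "X = 0")
  case True
  moreover have "L 0 = 0" using der linear_0[OF h_hom_linear] unfolding has_h_derivative_def by metis
  ultimately show ?thesis by simp
next
  case False
  have lin: "linear L" using der by (auto simp: has_h_derivative_def intro: h_hom_linear)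
  have "filterlim (\<lambda>h::real. h *\<^sub>R X) (at 0) (at 0)"
    using False by (auto simp: filterlim_at intro!: tendsto_eq_intros eventually_at_filter[THEN iffD2])
  then have lim: "((\<lambda>h. norm (f (hmul (hmul q (t *\<^sub>R X)) (h *\<^sub>R X)) - f (hmul q (t *\<^sub>R X)) - L (h *\<^sub>R X)) / N (h *\<^sub>R X)) \<longlongrightarrow> 0) (at 0)"
    using der unfolding has_h_derivative_def by (auto intro: filterlim_compose)
  have "((\<lambda>h. N X * (norm (f (hmul (hmul q (t *\<^sub>R X)) (h *\<^sub>R X)) - f (hmul q (t *\<^sub>R X)) - L (h *\<^sub>R X)) / N (h *\<^sub>R X))) \<longlongrightarrow> N X * 0) (at 0)"
    by (intro tendsto_mult tendsto_const lim)
  moreover have "N X * (norm (f (hmul (hmul q (t *\<^sub>R X)) (h *\<^sub>R X)) - f (hmul q (t *\<^sub>R X)) - L (h *\<^sub>R X)) / N (h *\<^sub>R X))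
      = norm (f (hmul q ((t + h) *\<^sub>R X)) - f (hmul q (t *\<^sub>R X)) - h *\<^sub>R L X) / norm h" for h
    using False X by (simp add: hmul_assoc hmul_scaleR N_scaleR linear_scale[OF lin])
  ultimately have "((\<lambda>h. norm (f (hmul q ((t + h) *\<^sub>R X)) - f (hmul q (t *\<^sub>R X)) - h *\<^sub>R L X) / norm h) \<longlongrightarrow> 0) (at 0)"
    by simp
  then show ?thesis
    unfolding has_vector_derivative_def has_derivative_at by (auto intro: bounded_linear_scaleR_left)
qed

text \<open>Mean value inequality for f along the segment minus its linear part; the derivative of
  this difference is the deviation of the differential from L.\<close>

lemma h_segment_bound:
  assumes f: "\<And>y. d x y < \<delta> \<Longrightarrow> has_h_derivative d f (D y) y \<and> (\<forall>w. norm (D y w - L w) \<le> \<epsilon> * N w)"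
    and X: "X \<in> H1" and q: "d x q + N X < \<delta>"
  shows "norm (f (hmul q X) - f q - L X) \<le> \<epsilon> * N X"
proof -
  have near: "d x (hmul q (t *\<^sub>R X)) < \<delta>" if "t \<in> {0..1}" for t
  proof -
    have "d x (hmul q (t *\<^sub>R X)) \<le> d x q + N (t *\<^sub>R X)"
      using d_tri[of x "hmul q (t *\<^sub>R X)" q] by (simp add: d_hmul_right)
    also have "N (t *\<^sub>R X) \<le> N X" using that X by (simp add: N_scaleR mult_left_le_one_le)
    finally show ?thesis using q by simp
  qed
  define F where "F t = f (hmul q (t *\<^sub>R X)) - t *\<^sub>R L X" for t
  have "norm (F 1 - F 0) \<le> (\<epsilon> * N X) * norm (1 - 0 :: real)"
  proof (rule differentiable_bound[where S = "{0..1}" and f' = "\<lambda>t h. h *\<^sub>R (D (hmul q (t *\<^sub>R X)) X - L X)"])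
    fix t :: real assume t: "t \<in> {0..1}"
    have "(F has_vector_derivative (D (hmul q (t *\<^sub>R X)) X - L X)) (at t)"
      unfolding F_def
      by (rule has_vector_derivative_diff[OF h_derivative_segment]) (use f[OF near[OF t]] X in \<open>auto intro!: derivative_eq_intros\<close>)
    then show "(F has_derivative (\<lambda>h. h *\<^sub>R (D (hmul q (t *\<^sub>R X)) X - L X))) (at t within {0..1})"
      unfolding has_vector_derivative_def by (rule has_derivative_at_withinI)
    have "norm (D (hmul q (t *\<^sub>R X)) X - L X) \<le> \<epsilon> * N X" using f[OF near[OF t]] by simp
    then show "onorm (\<lambda>h. h *\<^sub>R (D (hmul q (t *\<^sub>R X)) X - L X)) \<le> \<epsilon> * N X"
      by (intro onorm_le) (simp add: mult.commute mult_left_mono)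
  qed auto
  then show ?thesis by (simp add: F_def algebra_simps)
qed

text \<open>The segment estimates telescope; the bound on the total length keeps every intermediate
  point within \<delta> of x.\<close>

lemma h_chain_bound:
  assumes f: "\<And>y. d x y < \<delta> \<Longrightarrow> has_h_derivative d f (D y) y \<and> (\<forall>w. norm (D y w - L w) \<le> \<epsilon> * N w)"
    and L: "h_hom L"
  shows "set Xs \<subseteq> H1 \<Longrightarrow> d x q + (\<Sum>X\<leftarrow>Xs. N X) < \<delta> \<Longrightarrow>
    norm (f (hmul q (foldr hmul Xs 0)) - f q - L (foldr hmul Xs 0)) \<le> \<epsilon> * (\<Sum>X\<leftarrow>Xs. N X)"
proof (induction Xs arbitrary: q)
  case Nil
  then show ?case using linear_0[OF h_hom_linear[OF L]] by simp
next
  case (Cons X Xs)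
  let ?P = "foldr hmul Xs 0"
  have pos: "0 \<le> (\<Sum>X\<leftarrow>Xs. N X)" by (intro sum_list_nonneg) auto
  have "d x (hmul q X) \<le> d x q + N X" using d_tri[of x "hmul q X" q] by (simp add: d_hmul_right)
  then have 1: "norm (f (hmul (hmul q X) ?P) - f (hmul q X) - L ?P) \<le> \<epsilon> * (\<Sum>X\<leftarrow>Xs. N X)"
    using Cons.prems by (intro Cons.IH) auto
  have 2: "norm (f (hmul q X) - f q - L X) \<le> \<epsilon> * N X"
    by (rule h_segment_bound[OF f]) (use Cons.prems pos in auto)
  have "L (hmul X ?P) = L X + L ?P" using L by (auto simp: h_hom_def)
  then have "f (hmul q (foldr hmul (X # Xs) 0)) - f q - L (foldr hmul (X # Xs) 0)
     = (f (hmul (hmul q X) ?P) - f (hmul q X) - L ?P) + (f (hmul q X) - f q - L X)"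
    by (simp add: hmul_assoc)
  also have "norm \<dots> \<le> \<epsilon> * (\<Sum>X\<leftarrow>Xs. N X) + \<epsilon> * N X"
    by (rule norm_triangle_le) (use 1 2 in simp)
  finally show ?case by (simp add: algebra_simps)
qed

text \<open>A vertical displacement is a commutator of horizontal elements whose size is the square
  root of it. Together with \<open>(a, b, 0)\<close> this makes five factors, whence the
  constant.\<close>

lemma ex_horizontal_chain:
  "\<exists>C>0. \<forall>w. \<exists>Xs. set Xs \<subseteq> H1 \<and> foldr hmul Xs 0 = w \<and> (\<Sum>X\<leftarrow>Xs. N X) \<le> C * N w"
proof -
  obtain C where C: "C > 0" "\<And>x. N x \<le> C * hgauge x" using ex_N_le_hgauge by blast
  obtain C' where C': "C' > 0" "\<And>x. hgauge x \<le> C' * N x" using ex_hgauge_le_N by blast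
  define i :: 'n where "i = undefined"
  have "\<exists>Xs. set Xs \<subseteq> H1 \<and> foldr hmul Xs 0 = w \<and> (\<Sum>X\<leftarrow>Xs. N X) \<le> (5 * C * C') * N w" for w
  proof -
    obtain a b s where w: "w = (a, b, s)" by (cases w)
    define X :: "'n heis" where "X = (axis i (sqrt \<bar>s\<bar>), 0, 0)"
    \<comment> \<open>The sign of s is put into Y, so that the commutator of X and Y is exactly
      \<open>s *\<^sub>R e_last\<close>.\<close>
    define Y :: "'n heis" where "Y = (0, axis i (sgn s * sqrt \<bar>s\<bar>), 0)"
    define Xs where "Xs = [(a, b, 0), X, Y, - X, - Y]"
    have s: "sgn s * sqrt \<bar>s\<bar> * sqrt \<bar>s\<bar> = s"
      by (auto simp: sgn_if abs_if)
    have fold: "foldr hmul Xs 0 = w"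
      using s by (simp add: Xs_def X_def Y_def hmul_Pair inner_axis_axis w mult_ac)
    have set: "set Xs \<subseteq> H1" by (auto simp: Xs_def X_def Y_def H1_def)
    have "hgauge (a, b, 0 :: real) \<le> hgauge w" "hgauge X \<le> hgauge w" "hgauge Y \<le> hgauge w"
      by (auto simp: hgauge_def X_def Y_def w abs_mult sgn_if norm_eq_sqrt_inner[of "axis _ _"] inner_axis_axis)
    moreover have le: "N v \<le> C * hgauge w" if "hgauge v \<le> hgauge w" for v
      by (rule order_trans[OF C(2) mult_left_mono[OF that less_imp_le[OF C(1)]]])
    ultimately have "N (a, b, 0) \<le> C * hgauge w" "N X \<le> C * hgauge w" "N Y \<le> C * hgauge w"
      by (blast intro: le)+
    then have "(\<Sum>X\<leftarrow>Xs. N X) \<le> 5 * (C * hgauge w)" by (simp add: Xs_def)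
    moreover have "C * hgauge w \<le> C * (C' * N w)" using C C'(2)[of w] by (intro mult_left_mono) auto
    ultimately show ?thesis using fold set by (intro exI[of _ Xs]) (simp add: mult_ac)
  qed
  moreover have "5 * C * C' > 0" using C C' by simp
  ultimately show ?thesis by blast
qed

text \<open>Both end points of the increment may vary while the differential stays frozen at x. This
  is the form used for the contraction, for the intrinsic differential and for the tangent
  cone.\<close>

lemma C1h_strict:
  assumes f: "C1h d \<Omega> f" "open \<Omega>" "x \<in> \<Omega>" and "0 < \<epsilon>"
  shows "\<exists>\<delta>>0. (\<forall>y. d x y < \<delta> \<longrightarrow> y \<in> \<Omega>) \<and> (\<forall>y z. d x y < \<delta> \<longrightarrow> d x z < \<delta> \<longrightarrow>
    norm (f z - f y - h_deriv d f x (hmul (- y) z)) \<le> \<epsilon> * d y z)"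
proof -
  obtain C where C: "C > 0"
      "\<And>w. \<exists>Xs. set Xs \<subseteq> H1 \<and> foldr hmul Xs 0 = w \<and> (\<Sum>X\<leftarrow>Xs. N X) \<le> C * N w"
    using ex_horizontal_chain by blast
  obtain \<delta>' where \<delta>': "\<delta>' > 0" "\<And>y. d x y < \<delta>' \<Longrightarrow> y \<in> \<Omega> \<and> (\<forall>w. norm (h_deriv d f y w - h_deriv d f x w) \<le> (\<epsilon> / C) * N w)"
    using C1h_continuous[OF f, of "\<epsilon> / C"] \<open>0 < \<epsilon>\<close> C(1) by auto
  \<comment> \<open>The chain from y to z has length at most \<open>C * (2 * \<delta>)\<close>;
    starting within \<delta> of x it stays in the ball of radius \<open>\<delta>'\<close>.\<close>
  define \<delta> where "\<delta> = \<delta>' / (1 + 2 * C)"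
  have "\<delta> > 0" using \<delta>' C(1) by (simp add: \<delta>_def)
  have "(1 + 2 * C) * \<delta> = \<delta>'" using C(1) by (simp add: \<delta>_def)
  then have 3: "\<delta> + C * (2 * \<delta>) = \<delta>'" by (simp add: algebra_simps)
  moreover have "0 \<le> C * (2 * \<delta>)" using C(1) \<open>\<delta> > 0\<close> by simp
  ultimately have \<delta>: "\<delta> > 0" "\<delta> \<le> \<delta>'" "\<delta> + C * (2 * \<delta>) = \<delta>'" using \<open>\<delta> > 0\<close> by linarith+
  have hom: "h_hom (h_deriv d f x)" using C1h_has_h_derivative[OF f(1,3)] by (auto simp: has_h_derivative_def)
  have "norm (f z - f y - h_deriv d f x (hmul (- y) z)) \<le> \<epsilon> * d y z" if yz: "d x y < \<delta>" "d x z < \<delta>" for y z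
  proof -
    obtain Xs where Xs: "set Xs \<subseteq> H1" "foldr hmul Xs 0 = hmul (- y) z" "(\<Sum>X\<leftarrow>Xs. N X) \<le> C * d y z"
      using C(2)[of "hmul (- y) z"] by (auto simp: d_N)
    have "C * d y z \<le> C * (2 * \<delta>)"
      using yz d_tri[of y z x] C(1) by (intro mult_left_mono) (auto simp: d_sym)
    then have "d x y + (\<Sum>X\<leftarrow>Xs. N X) < \<delta>'" using Xs(3) yz(1) \<delta>(3) by linarith
    then have "norm (f (hmul y (foldr hmul Xs 0)) - f y - h_deriv d f x (foldr hmul Xs 0)) \<le> (\<epsilon> / C) * (\<Sum>X\<leftarrow>Xs. N X)"
      using C1h_has_h_derivative[OF f(1)] \<delta>'(2)
      by (intro h_chain_bound[where D = "h_deriv d f", OF _ hom Xs(1)]) blast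
    also have "\<dots> \<le> (\<epsilon> / C) * (C * d y z)" using Xs(3) \<open>0 < \<epsilon>\<close> C(1) by (intro mult_left_mono) auto
    finally show ?thesis using C(1) by (simp add: Xs(2))
  qed
  moreover have "\<forall>y. d x y < \<delta> \<longrightarrow> y \<in> \<Omega>" using \<delta> \<delta>'(2) by auto
  ultimately show ?thesis using \<delta>(1) by blast
qed

end

section \<open>Semidirect factorizations\<close>

locale factorization = homdist d for d :: "('n::finite) heis \<Rightarrow> 'n heis \<Rightarrow> real" +
  fixes W V :: "'n heis set"
  assumes sd: "semidirect W V"
begin

lemma V_H1: "x \<in> V \<Longrightarrow> x \<in> H1" using sd by (auto simp: semidirect_def)

text \<open>For horizontal x and y the vertical coordinate of the product is half of
  \<open>symp x y\<close>, and V is closed under products inside \<open>H1\<close>.\<close>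

lemma V_symp:
  assumes "x \<in> V" "y \<in> V"
  shows "symp x y = 0"
proof -
  have "hmul x y \<in> H1" using sd assms V_H1 by (simp add: semidirect_def homogeneous_subgroup_def)
  then show ?thesis using V_H1[OF assms(1)] V_H1[OF assms(2)] by (simp add: H1_def hmul_alt)
qed

lemma V_hmul: "x \<in> V \<Longrightarrow> y \<in> V \<Longrightarrow> hmul x y = x + y"
  by (simp add: hmul_def V_symp)

lemma subspace_V: "subspace V"
proof (rule subspaceI)
  show 0: "0 \<in> V" using sd by (simp add: semidirect_def homogeneous_subgroup_def)
  show "x + y \<in> V" if "x \<in> V" "y \<in> V" for x y
    using sd that V_hmul[OF that] by (metis semidirect_def homogeneous_subgroup_def)
  have pos: "t *\<^sub>R x \<in> V" if "0 < t" "x \<in> V" for t x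
    using sd that hdil_H1[OF V_H1[OF that(2)], of t] by (metis semidirect_def homogeneous_subgroup_def)
  show "t *\<^sub>R x \<in> V" if "x \<in> V" for t x
  proof (cases t "0::real" rule: linorder_cases)
    case less
    have "- x \<in> V" using sd that by (simp add: semidirect_def homogeneous_subgroup_def hinv_eq)
    then show ?thesis using pos[of "- t" "- x"] less by simp
  qed (use pos that 0 in auto)
qed

lemma W_e_last: "s *\<^sub>R e_last \<in> W"
  using sd by (auto simp: semidirect_def H2_def e_last_def)

lemma W_hmul: "x \<in> W \<Longrightarrow> y \<in> W \<Longrightarrow> hmul x y \<in> W"
  using sd by (simp add: semidirect_def homogeneous_subgroup_def)

lemma W_vert: "x \<in> W \<Longrightarrow> x + s *\<^sub>R e_last \<in> W"
  using W_hmul[OF _ W_e_last, of x s] by (simp add: hmul_e_last)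

text \<open>W contains the vertical line, so products and dilates in W may be corrected by vertical
  vectors to sums and scalar multiples.\<close>

lemma subspace_W: "subspace W"
proof (rule subspaceI)
  show 0: "0 \<in> W" using sd by (simp add: semidirect_def homogeneous_subgroup_def)
  show "x + y \<in> W" if "x \<in> W" "y \<in> W" for x y
    using W_vert[OF W_hmul[OF that], of "- symp x y / 2"] by (simp add: hmul_def)
  have pos: "t *\<^sub>R x \<in> W" if "0 < t" "x \<in> W" for t x
  proof -
    have "hdil t x \<in> W" using sd that by (simp add: semidirect_def homogeneous_subgroup_def)
    moreover have "t *\<^sub>R x = hdil t x + ((t - t\<^sup>2) * snd (snd x)) *\<^sub>R e_last"
      by (simp add: hdil_def e_last_def prod_eq_iff algebra_simps)
    ultimately show ?thesis using W_vert by metis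
  qed
  show "t *\<^sub>R x \<in> W" if "x \<in> W" for t x
  proof (cases t "0::real" rule: linorder_cases)
    case less
    have "- x \<in> W" using sd that by (simp add: semidirect_def homogeneous_subgroup_def hinv_eq)
    then show ?thesis using pos[of "- t" "- x"] less by simp
  qed (use pos that 0 in auto)
qed

lemma W_hdil: "x \<in> W \<Longrightarrow> hdil t x \<in> W"
proof -
  assume "x \<in> W"
  moreover have "hdil t x = t *\<^sub>R x + ((t\<^sup>2 - t) * snd (snd x)) *\<^sub>R e_last"
    by (simp add: hdil_def e_last_def prod_eq_iff algebra_simps)
  ultimately show ?thesis using W_vert subspace_scale[OF subspace_W] by metis
qed

lemma WV_0: "x \<in> W \<Longrightarrow> x \<in> V \<Longrightarrow> x = 0"
  using sd by (auto simp: semidirect_def)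

text \<open>The linear projection onto V along W. As W contains the vertical direction it coincides
  with the group projection (\<open>proj_V_eq\<close>); the additive and the group decomposition
  differ only in their W-components.\<close>

definition pV :: "'n heis \<Rightarrow> 'n heis" where
  "pV x = (THE v. v \<in> V \<and> x - v \<in> W)"

lemma pV_eqI: "v \<in> V \<Longrightarrow> x - v \<in> W \<Longrightarrow> pV x = v"
proof -
  assume v: "v \<in> V" "x - v \<in> W"
  have "v' = v" if "v' \<in> V \<and> x - v' \<in> W" for v'
  proof -
    have "v' - v \<in> V" using that v subspace_diff[OF subspace_V] by blast
    moreover have "v' - v \<in> W" using subspace_diff[OF subspace_W v(2), of "x - v'"] that by simp
    ultimately show ?thesis using WV_0[of "v' - v"] by simp
  qed
  then show ?thesis unfolding pV_def using v by (intro the_equality) blast+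
qed

lemma pV: "pV x \<in> V" "x - pV x \<in> W"
proof -
  obtain w v where wv: "w \<in> W" "v \<in> V" "x = hmul w v" using sd unfolding semidirect_def by blast
  then have "x - v = w + (symp w v / 2) *\<^sub>R e_last" by (simp add: hmul_def)
  then have "x - v \<in> W" using W_vert[OF wv(1)] by simp
  then show "pV x \<in> V" "x - pV x \<in> W" using pV_eqI[OF wv(2)] wv(2) by auto
qed

lemma linear_pV: "linear pV"
proof (rule linearI)
  show "pV (x + y) = pV x + pV y" for x y
    using subspace_add[OF subspace_V pV(1) pV(1)] subspace_add[OF subspace_W pV(2)[of x] pV(2)[of y]]
    by (intro pV_eqI) (simp_all add: algebra_simps)
  show "pV (t *\<^sub>R x) = t *\<^sub>R pV x" for t x
    using subspace_scale[OF subspace_V pV(1)] subspace_scale[OF subspace_W pV(2)[of x], of t]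
    by (intro pV_eqI) (simp_all add: algebra_simps)
qed

lemma pV_V [simp]: "v \<in> V \<Longrightarrow> pV v = v"
  using subspace_0[OF subspace_W] by (intro pV_eqI) auto

lemma pV_W [simp]: "w \<in> W \<Longrightarrow> pV w = 0"
  using subspace_0[OF subspace_V] by (intro pV_eqI) auto

lemma pV_hmul: "pV (hmul x y) = pV x + pV y"
  by (simp add: hmul_def linear_add[OF linear_pV] linear_scale[OF linear_pV] pV_W[OF W_e_last, of 1, simplified])

lemma pV_hdil: "pV (hdil t x) = t *\<^sub>R pV x"
proof -
  have "hdil t x = t *\<^sub>R x + ((t\<^sup>2 - t) * snd (snd x)) *\<^sub>R e_last"
    by (simp add: hdil_def e_last_def prod_eq_iff algebra_simps)
  then show ?thesis using W_e_last by (simp add: linear_add[OF linear_pV] linear_scale[OF linear_pV] pV_W[OF W_e_last, of 1, simplified])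
qed

lemma pV_uminus: "pV (- x) = - pV x" by (rule linear_neg[OF linear_pV])

lemma continuous_on_pV [continuous_intros]: "continuous_on A f \<Longrightarrow> continuous_on A (\<lambda>x. pV (f x))"
  by (rule bounded_linear.continuous_on[OF linear_pV[unfolded linear_conv_bounded_linear]])

lemma W_iff: "x \<in> W \<longleftrightarrow> pV x = 0" using pV(2)[of x] by auto

text \<open>The W-factor of the group decomposition, which is not linear; its additive counterpart
  is \<open>qV\<close>.\<close>

definition pW :: "'n heis \<Rightarrow> 'n heis" where
  "pW x = hmul x (- pV x)"

lemma pW_W: "pW x \<in> W"
  by (simp add: W_iff pW_def pV_hmul pV_uminus pV)

lemma pW_pV: "hmul (pW x) (pV x) = x"
  by (simp add: pW_def hmul_assoc)

lemma pW_hmul [simp]: "w \<in> W \<Longrightarrow> v \<in> V \<Longrightarrow> pW (hmul w v) = w"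
  by (simp add: pW_def pV_hmul hmul_assoc)

lemma factorization_unique:
  assumes "w \<in> W" "v \<in> V" "w' \<in> W" "v' \<in> V" "hmul w v = hmul w' v'"
  shows "w = w'" "v = v'"
proof -
  have "pV (hmul w v) = v" "pV (hmul w' v') = v'" using assms(1-4) by (auto simp: pV_hmul)
  then show "v = v'" using assms(5) by simp
  show "w = w'" using pW_hmul[OF assms(1,2)] pW_hmul[OF assms(3,4)] assms(5) by simp
qed

lemma continuous_on_pW [continuous_intros]: "continuous_on A f \<Longrightarrow> continuous_on A (\<lambda>x. pW (f x))"
  unfolding pW_def by (intro continuous_intros)

lemma proj_V_eq: "proj_V W V x = pV x"
  unfolding proj_V_def
proof (rule the_equality)
  show "pV x \<in> V \<and> (\<exists>w\<in>W. x = hmul w (pV x))" using pV pW_W pW_pV by metis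
  show "v = pV x" if "v \<in> V \<and> (\<exists>w\<in>W. x = hmul w v)" for v
    using that by (auto simp: pV_hmul)
qed

lemma proj_W_eq: "proj_W W V x = pW x"
  unfolding proj_W_def
proof (rule the_equality)
  show "pW x \<in> W \<and> (\<exists>v\<in>V. x = hmul (pW x) v)" using pV pW_W pW_pV by metis
  show "w = pW x" if "w \<in> W \<and> (\<exists>v\<in>V. x = hmul w v)" for w
    using that by auto
qed

lemma dim_W_V: "dim W + dim V = 2 * CARD('n) + 1"
proof -
  have "x = (x - pV x) + pV x" for x by simp
  then have "{x + y |x y. x \<in> W \<and> y \<in> V} = UNIV" using pV by blast
  moreover have "W \<inter> V = {0}" using sd by (simp add: semidirect_def)
  ultimately show ?thesis
    using dim_sums_Int[OF subspace_W subspace_V] by (simp add: dim_UNIV)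
qed

text \<open>\<open>V\<close> is isotropic, so the image of \<open>V\<close> under the complex structure is orthogonal to \<open>V\<close>.\<close>

lemma dim_V_le: "dim V \<le> CARD('n)"
proof -
  define J :: "'n heis \<Rightarrow> 'n heis" where "J p = (- fst (snd p), fst p, snd (snd p))" for p
  have lin: "linear J" by (rule linearI) (simp_all add: J_def)
  have inj: "inj J" by (rule injI) (simp add: J_def prod_eq_iff)
  have "dim (J ` V) = dim V" using dim_image_eq[OF lin] inj by (metis inj_on_subset subset_UNIV)
  have "x \<bullet> J y = 0" if "x \<in> V" "y \<in> V" for x y
    using V_symp[OF that] V_H1[OF that(1)] by (simp add: J_def symp_def inner_prod_def H1_def)
  then have "dim (V \<union> J ` V) = dim V + dim (J ` V)"
    by (intro dim_orthogonal_sum) auto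
  moreover have "dim ((V \<union> J ` V) \<union> {e_last}) = dim (V \<union> J ` V) + dim {e_last :: 'n heis}"
    using V_H1 by (intro dim_orthogonal_sum) (auto simp: J_def e_last_def H1_def inner_prod_def)
  moreover have "dim {e_last :: 'n heis} = 1" by (simp add: e_last_def zero_prod_def)
  moreover have "dim ((V \<union> J ` V) \<union> {e_last}) \<le> 2 * CARD('n) + 1"
    using dim_subset_UNIV[of "(V \<union> J ` V) \<union> {e_last}"] by simp
  ultimately show ?thesis using \<open>dim (J ` V) = dim V\<close> by linarith
qed

end

section \<open>The level set as a graph\<close>

lemma linear_iso_on_subspace:
  fixes L :: "'a::euclidean_space \<Rightarrow> real^('k::finite)"
  assumes L: "linear L" and V: "subspace V" "dim V = CARD('k)" and inj: "\<And>v. v \<in> V \<Longrightarrow> L v = 0 \<Longrightarrow> v = 0"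
  shows "\<exists>\<Lambda>. linear \<Lambda> \<and> (\<forall>y. \<Lambda> y \<in> V \<and> L (\<Lambda> y) = y) \<and> (\<forall>v\<in>V. \<Lambda> (L v) = v)"
proof -
  have injL: "inj_on L V"
  proof (rule inj_onI)
    fix x y assume "x \<in> V" "y \<in> V" "L x = L y"
    then show "x = y" using inj[of "x - y"] by (simp add: linear_diff[OF L] subspace_diff[OF V(1)])
  qed
  obtain \<Lambda> where \<Lambda>: "range \<Lambda> \<subseteq> V" "linear \<Lambda>" "\<And>v. v \<in> V \<Longrightarrow> \<Lambda> (L v) = v"
    using real_vector.linear_exists_left_inverse_on[OF L V(1) injL] by (auto simp: linear_def)
  have "span V = V" using V(1) by (rule span_eq_iff[THEN iffD2])
  then have "dim (L ` V) = dim V" using dim_image_eq[OF L, of V] injL by metis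
  then have "L ` V = UNIV"
    using V linear_subspace_image[OF L V(1)] by (metis dim_UNIV DIM_cart DIM_real mult.right_neutral dim_eq_full span_eq_iff)
  then have "L (\<Lambda> y) = y" for y using \<Lambda>(3) by (metis UNIV_I imageE)
  then show ?thesis using \<Lambda> by blast
qed

locale level_set = factorization d W V for d :: "('n::finite) heis \<Rightarrow> 'n heis \<Rightarrow> real" and W V +
  fixes \<Omega> S :: "'n heis set" and f :: "'n heis \<Rightarrow> real^('k::finite)" and x0 :: "'n heis" and v :: "nat \<Rightarrow> 'n heis"
  assumes dimV: "dim V = CARD('k)" and op: "open \<Omega>" and C1: "C1h d \<Omega> f"
    and S: "S = {x\<in>\<Omega>. f x = f x0}" and JV: "\<forall>x\<in>S. J_V d V f x > 0"
    and v: "orthonormal_basis_of {1..CARD('k)} v V"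
begin

section \<open>Horizontal gradients and the two Jacobians\<close>

abbreviation D :: "'n heis \<Rightarrow> 'n heis \<Rightarrow> real^'k" where "D \<equiv> h_deriv d f"

lemma S_sub: "x \<in> S \<Longrightarrow> x \<in> \<Omega>" using S by simp

lemma has_D: "x \<in> \<Omega> \<Longrightarrow> has_h_derivative d f (D x) x"
  by (rule C1h_has_h_derivative[OF C1])

lemma hom_D: "x \<in> \<Omega> \<Longrightarrow> h_hom (D x)" using has_D by (simp add: has_h_derivative_def)

lemma lin_D: "x \<in> \<Omega> \<Longrightarrow> linear (D x)" using hom_D h_hom_linear by blast

lemma D_hmul: "x \<in> \<Omega> \<Longrightarrow> D x (hmul y z) = D x y + D x z" using hom_D by (simp add: h_hom_def)

definition grad :: "'n heis \<Rightarrow> 'k \<Rightarrow> 'n heis" where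
  "grad x i = (\<Sum>b\<in>Basis. (D x b $ i) *\<^sub>R b)"

lemma grad_inner: "x \<in> \<Omega> \<Longrightarrow> grad x i \<bullet> z = D x z $ i"
proof -
  assume x: "x \<in> \<Omega>"
  have "D x z = D x (\<Sum>b\<in>Basis. (z \<bullet> b) *\<^sub>R b)" by (simp add: euclidean_representation)
  also have "\<dots> = (\<Sum>b\<in>Basis. (z \<bullet> b) *\<^sub>R D x b)"
    by (simp add: linear_sum[OF lin_D[OF x]] linear_scale[OF lin_D[OF x]])
  finally have "D x z $ i = (\<Sum>b\<in>Basis. (z \<bullet> b) * D x b $ i)" by simp
  also have "\<dots> = grad x i \<bullet> z"
    unfolding grad_def inner_sum_left by (intro sum.cong refl) (simp add: inner_commute)
  finally show ?thesis ..
qed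

lemma has_h_derivative_component: "x \<in> \<Omega> \<Longrightarrow> has_h_derivative d (\<lambda>y. f y $ i) (\<lambda>z. D x z $ i) x"
proof -
  assume x: "x \<in> \<Omega>"
  have "((\<lambda>w. norm (f (hmul x w) $ i - f x $ i - D x w $ i) / N w) \<longlongrightarrow> 0) (at 0)"
  proof (rule Lim_null_comparison[OF always_eventually])
    show "\<forall>w. norm (norm (f (hmul x w) $ i - f x $ i - D x w $ i) / N w) \<le> norm (f (hmul x w) - f x - D x w) / N w"
    proof
      fix w
      have "norm (f (hmul x w) $ i - f x $ i - D x w $ i) \<le> norm (f (hmul x w) - f x - D x w)"
        using component_le_norm_cart[of "f (hmul x w) - f x - D x w" i] by simp
      then show "norm (norm (f (hmul x w) $ i - f x $ i - D x w $ i) / N w) \<le> norm (f (hmul x w) - f x - D x w) / N w"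
        by (simp add: divide_right_mono)
    qed
  qed (use has_D[OF x] in \<open>simp add: has_h_derivative_def\<close>)
  then show "has_h_derivative d (\<lambda>y. f y $ i) (\<lambda>z. D x z $ i) x"
    using hom_D[OF x] by (simp add: has_h_derivative_def h_hom_def)
qed

lemma h_deriv_component: "x \<in> \<Omega> \<Longrightarrow> h_deriv d (\<lambda>y. f y $ i) x = (\<lambda>z. D x z $ i)"
  by (rule h_deriv_eq[OF has_h_derivative_component])

lemma grad_H_eq: "x \<in> \<Omega> \<Longrightarrow> grad_H d (\<lambda>y. f y $ i) x = grad x i"
  unfolding grad_H_def h_deriv_component
proof (rule the_equality)
  assume x: "x \<in> \<Omega>"
  have "snd (snd (grad x i)) = grad x i \<bullet> (1 *\<^sub>R e_last)"
    by (simp add: e_last_def inner_prod_def)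
  also have "\<dots> = 0" using h_hom_e_last[OF hom_D[OF x], of 1] by (simp only: grad_inner[OF x]) simp
  finally show "grad x i \<in> H1 \<and> (\<forall>z. D x z $ i = grad x i \<bullet> z)"
    by (simp add: H1_def grad_inner[OF x])
  fix g assume "g \<in> H1 \<and> (\<forall>z. D x z $ i = g \<bullet> z)"
  then have "g \<bullet> z = grad x i \<bullet> z" for z by (simp add: grad_inner[OF x])
  then show "g = grad x i" using vector_eq_rdot[of g "grad x i"] by simp
qed

text \<open>The gradient along V is the orthogonal projection of the full gradient onto V, written
  out in the basis v.\<close>

lemma grad_V_eq:
  assumes x: "x \<in> \<Omega>"
  shows "grad_V d V (\<lambda>y. f y $ i) x \<in> V" "z \<in> V \<Longrightarrow> grad_V d V (\<lambda>y. f y $ i) x \<bullet> z = grad x i \<bullet> z"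
proof -
  define g where "g = (\<Sum>l\<in>{1..CARD('k)}. (grad x i \<bullet> v l) *\<^sub>R v l)"
  have vV: "v l \<in> V" if "l \<in> {1..CARD('k)}" for l
    using v that by (auto simp: orthonormal_basis_of_def intro: span_base)
  have gV: "g \<in> V" unfolding g_def by (intro subspace_sum subspace_scale subspace_V vV)
  have gz: "g \<bullet> z = grad x i \<bullet> z" if "z \<in> V" for z
  proof -
    have "g \<bullet> z = (\<Sum>l\<in>{1..CARD('k)}. (z \<bullet> v l) * (v l \<bullet> grad x i))"
      unfolding g_def inner_sum_left by (intro sum.cong refl) (simp add: inner_commute mult.commute)
    also have "\<dots> = z \<bullet> grad x i" by (rule orthonormal_basis_inner[OF v _ that, symmetric]) simp
    finally show ?thesis by (simp add: inner_commute)
  qed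
  have "grad_V d V (\<lambda>y. f y $ i) x = g"
    unfolding grad_V_def h_deriv_component[OF x]
  proof (rule the_equality)
    show "g \<in> V \<and> (\<forall>z\<in>V. D x z $ i = g \<bullet> z)" using gV gz by (simp add: grad_inner[OF x])
    fix g' assume g': "g' \<in> V \<and> (\<forall>z\<in>V. D x z $ i = g' \<bullet> z)"
    then have "g' - g \<in> V" using gV subspace_diff[OF subspace_V] by blast
    then have "(g' - g) \<bullet> (g' - g) = 0"
      using g' gz[of "g' - g"] grad_inner[OF x, of i "g' - g"] by (simp add: inner_diff_left)
    then show "g' = g" by simp
  qed
  then show "grad_V d V (\<lambda>y. f y $ i) x \<in> V" "z \<in> V \<Longrightarrow> grad_V d V (\<lambda>y. f y $ i) x \<bullet> z = grad x i \<bullet> z"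
    using gV gz by auto
qed

text \<open>Matches the index type of the components of f with the indices of v, so that Jacobians
  can be compared with frame volumes.\<close>

definition ek :: "'k \<Rightarrow> nat" where "ek = (SOME h. bij_betw h UNIV {1..CARD('k)})"

lemma ek: "bij_betw ek UNIV {1..CARD('k)}"
proof -
  have "\<exists>h :: 'k \<Rightarrow> nat. bij_betw h UNIV {1..CARD('k)}" by (rule finite_same_card_bij) auto
  then show ?thesis unfolding ek_def by (rule someI_ex)
qed

lemma orthonormal_basis_ek:
  assumes "orthonormal_basis_of {1..CARD('k)} b A"
  shows "orthonormal_basis_of UNIV (b \<circ> ek) A"
proof -
  have rng: "range ek = {1..CARD('k)}" and inj: "inj ek" using ek by (auto simp: bij_betw_def)
  then have "ek i \<in> {1..CARD('k)}" for i by blast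
  moreover have "range (b \<circ> ek) = b ` {1..CARD('k)}" using rng by (metis image_comp)
  ultimately show ?thesis using assms inj by (simp add: orthonormal_basis_of_def inj_eq)
qed

lemma J_V_eq:
  assumes x: "x \<in> \<Omega>"
  shows "J_V d V f x = \<bar>det (\<chi> i j. grad x i \<bullet> v (ek j))\<bar>"
proof -
  have vV: "v (ek j) \<in> V" for j
    using orthonormal_basis_ek[OF v] by (auto simp: orthonormal_basis_of_def intro: span_base)
  have "J_V d V f x = \<bar>leib UNIV (\<lambda>i j. grad_V d V (\<lambda>y. f y $ i) x \<bullet> (v \<circ> ek) j)\<bar>"
    unfolding J_V_def
    by (rule mv_norm_wedge_basis[OF bij_id[unfolded id_def, simplified] orthonormal_basis_ek[OF v]]) (rule grad_V_eq[OF x])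
  also have "\<dots> = \<bar>leib UNIV (\<lambda>i j. grad x i \<bullet> v (ek j))\<bar>"
    by (simp add: grad_V_eq(2)[OF x vV])
  finally show ?thesis by (simp add: leib_det[of "\<lambda>i. i"] bij_betw_def)
qed

text \<open>In the basis v the restriction of the differential to V has a matrix whose determinant
  is \<open>J_V\<close> up to sign, and this is nonzero on S.\<close>

lemma D_inj:
  assumes x: "x \<in> S" and u: "u \<in> V" "D x u = 0"
  shows "u = 0"
proof -
  let ?M = "\<chi> i j. grad x i \<bullet> v (ek j)"
  have x': "x \<in> \<Omega>" using x S_sub by simp
  have "det ?M \<noteq> 0" using JV x J_V_eq[OF x'] by auto
  then have inj: "inj ((*v) ?M)" by (intro inj_matrix_vector_mult) (simp add: invertible_det_nz)
  define c where "c = (\<chi> j. u \<bullet> v (ek j))"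
  have uc: "u = (\<Sum>j\<in>UNIV. (u \<bullet> v (ek j)) *\<^sub>R v (ek j))"
    using orthonormal_basis_expand[OF orthonormal_basis_ek[OF v] _ u(1)] by simp
  have "(?M *v c) $ i = 0" for i
  proof -
    have "(?M *v c) $ i = grad x i \<bullet> (\<Sum>j\<in>UNIV. (u \<bullet> v (ek j)) *\<^sub>R v (ek j))"
      by (simp add: matrix_vector_mult_def c_def inner_sum_right mult.commute)
    also have "\<dots> = 0" using u(2) grad_inner[OF x', of i u] by (simp flip: uc)
    finally show ?thesis .
  qed
  then have "?M *v c = ?M *v 0" by (simp add: vec_eq_iff)
  then have "c = 0" by (rule injD[OF inj])
  then have "u \<bullet> v (ek j) = 0" for j by (simp add: c_def vec_eq_iff)
  then show ?thesis using uc by simp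
qed

lemma D_inverse:
  assumes x: "x \<in> S"
  obtains \<Lambda> B where "linear \<Lambda>" "\<And>y. \<Lambda> y \<in> V" "\<And>y. D x (\<Lambda> y) = y" "\<And>u. u \<in> V \<Longrightarrow> \<Lambda> (D x u) = u"
    "0 < B" "\<And>y. N (\<Lambda> y) \<le> B * norm y" "\<And>y. norm (\<Lambda> y) \<le> B * norm y"
proof -
  obtain \<Lambda> where \<Lambda>: "linear \<Lambda>" "\<And>y. \<Lambda> y \<in> V" "\<And>y. D x (\<Lambda> y) = y" "\<And>u. u \<in> V \<Longrightarrow> \<Lambda> (D x u) = u"
    using linear_iso_on_subspace[OF lin_D[OF S_sub[OF x]] subspace_V dimV] D_inj[OF x] by blast
  have "bounded_linear \<Lambda>" using \<Lambda>(1) by (simp add: linear_conv_bounded_linear)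
  then obtain B where B: "0 < B" "\<And>y. norm (\<Lambda> y) \<le> norm y * B" by (metis bounded_linear.pos_bounded)
  obtain C where C: "0 < C" "\<And>x. x \<in> H1 \<Longrightarrow> N x \<le> C * norm x" using ex_N_le_norm_H1 by blast
  show ?thesis
  \<comment> \<open>One constant for two norms: \<open>B\<close> bounds the Euclidean norm of
    \<open>\<Lambda> y\<close>, and \<open>B * C\<close> its homogeneous norm.\<close>
  proof (rule that[OF \<Lambda>, of "B * C + B"])
    show "0 < B * C + B" using B C by (simp add: add_pos_pos)
    fix y
    have "N (\<Lambda> y) \<le> C * norm (\<Lambda> y)" by (rule C(2)[OF V_H1[OF \<Lambda>(2)]])
    also have "\<dots> \<le> C * (norm y * B)" using B C by (intro mult_left_mono) auto
    also have "\<dots> \<le> (B * C + B) * norm y" using B by (simp add: algebra_simps)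
    finally show "N (\<Lambda> y) \<le> (B * C + B) * norm y" .
    have "norm (\<Lambda> y) \<le> norm y * B" by (rule B(2))
    also have "\<dots> \<le> (B * C + B) * norm y" using B C by (simp add: algebra_simps)
    finally show "norm (\<Lambda> y) \<le> (B * C + B) * norm y" .
  qed auto
qed

section \<open>Implicit function theorem on the fibres of V\<close>

lemma strict:
  assumes "x \<in> \<Omega>" "0 < \<epsilon>"
  obtains \<delta> where "0 < \<delta>" "\<And>y. d x y < \<delta> \<Longrightarrow> y \<in> \<Omega>"
    "\<And>y z. d x y < \<delta> \<Longrightarrow> d x z < \<delta> \<Longrightarrow> norm (f z - f y - D x (hmul (- y) z)) \<le> \<epsilon> * d y z"
  using C1h_strict[OF C1 op assms] by blast

lemma continuous_WV:
  fixes A :: "'n heis set"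
  assumes "open A" "hmul a b \<in> A"
  obtains r where "0 < r" "\<And>u u'. norm (u - a) < r \<Longrightarrow> norm (u' - b) < r \<Longrightarrow> hmul u u' \<in> A"
proof -
  have "continuous_on UNIV (\<lambda>x. hmul (fst x) (snd x) :: 'n heis)" by (intro continuous_intros)
  then have "open ((\<lambda>x. hmul (fst x) (snd x)) -` A)" using assms(1) by (intro open_vimage) auto
  moreover have "(a, b) \<in> (\<lambda>x. hmul (fst x) (snd x)) -` A" using assms(2) by simp
  ultimately obtain A1 A2 where A: "open A1" "open A2" "a \<in> A1" "b \<in> A2" "A1 \<times> A2 \<subseteq> (\<lambda>x. hmul (fst x) (snd x)) -` A"
    by (rule open_prod_elim) (auto simp: mem_Times_iff)
  obtain r1 where r1: "r1 > 0" "ball a r1 \<subseteq> A1" using A(1,3) open_contains_ball by blast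
  obtain r2 where r2: "r2 > 0" "ball b r2 \<subseteq> A2" using A(2,4) open_contains_ball by blast
  show ?thesis
  proof (rule that[of "min r1 r2"])
    show "0 < min r1 r2" using r1 r2 by simp
    fix u u' :: "'n heis" assume "norm (u - a) < min r1 r2" "norm (u' - b) < min r1 r2"
    then have "u \<in> A1" "u' \<in> A2" using r1(2) r2(2) by (auto simp: ball_def dist_norm norm_minus_commute subset_eq)
    then have "(u, u') \<in> A1 \<times> A2" by simp
    from subsetD[OF A(5) this] show "hmul u u' \<in> A" by simp
  qed
qed

text \<open>Newton's map with the derivative frozen at p is a contraction of a ball of V for every u
  near the W-factor of p: on a fibre the group increment is just z - z', so strict differentiability
  controls f minus its linear part. The neighbourhood A is carried along to obtain continuity of the
  graph map later.\<close>

lemma implicit_function: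
  assumes p: "p \<in> S" and A: "open A" "p \<in> A"
  obtains \<eta> \<rho> where "0 < \<eta>" "0 < \<rho>"
    "\<And>u u'. u \<in> W \<Longrightarrow> norm (u - pW p) < \<eta> \<Longrightarrow> u' \<in> V \<Longrightarrow> norm (u' - pV p) \<le> \<rho> \<Longrightarrow> hmul u u' \<in> A \<inter> \<Omega>"
    "\<And>u. u \<in> W \<Longrightarrow> norm (u - pW p) < \<eta> \<Longrightarrow> \<exists>!u'. u' \<in> V \<and> norm (u' - pV p) \<le> \<rho> \<and> f (hmul u u') = f p"
proof -
  have p\<Omega>: "p \<in> \<Omega>" using S_sub[OF p] .
  obtain \<Lambda> B where \<Lambda>: "linear \<Lambda>" "\<And>y. \<Lambda> y \<in> V" "\<And>y. D p (\<Lambda> y) = y" "\<And>u. u \<in> V \<Longrightarrow> \<Lambda> (D p u) = u"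
    and B: "0 < B" "\<And>y. N (\<Lambda> y) \<le> B * norm y" "\<And>y. norm (\<Lambda> y) \<le> B * norm y"
    using D_inverse[OF p] by blast
  obtain C where C: "0 < C" "\<And>x. x \<in> H1 \<Longrightarrow> N x \<le> C * norm x" using ex_N_le_norm_H1 by blast
  \<comment> \<open>Makes the Lipschitz constant \<open>B * (\<epsilon> * C)\<close> of the map G
    equal to 1/2.\<close>
  define \<epsilon> where "\<epsilon> = 1 / (2 * B * C)"
  have \<epsilon>: "0 < \<epsilon>" "B * (\<epsilon> * C) = 1 / 2" using B(1) C(1) by (auto simp: \<epsilon>_def)
  obtain \<delta> where \<delta>: "0 < \<delta>" "\<And>y. d p y < \<delta> \<Longrightarrow> y \<in> \<Omega>"
    "\<And>y z. d p y < \<delta> \<Longrightarrow> d p z < \<delta> \<Longrightarrow> norm (f z - f y - D p (hmul (- y) z)) \<le> \<epsilon> * d y z"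
    using strict[OF p\<Omega> \<epsilon>(1)] by blast
  obtain K where K: "0 < K" "\<And>x. norm (D p x) \<le> K * N x" using h_hom_bounded[OF hom_D[OF p\<Omega>]] by blast
  have f_near: "norm (f z - f p) \<le> (K + \<epsilon>) * d p z" if "d p z < \<delta>" for z
  proof -
    have "norm (f z - f p) \<le> norm (f z - f p - D p (hmul (- p) z)) + norm (D p (hmul (- p) z))"
      using norm_triangle_ineq[of "f z - f p - D p (hmul (- p) z)" "D p (hmul (- p) z)"] by simp
    also have "\<dots> \<le> \<epsilon> * d p z + K * d p z"
    proof (rule add_mono)
      have "d p p < \<delta>" using \<delta>(1) by simp
      then show "norm (f z - f p - D p (hmul (- p) z)) \<le> \<epsilon> * d p z" using that by (rule \<delta>(3))
      show "norm (D p (hmul (- p) z)) \<le> K * d p z" unfolding d_N[of p z] by (rule K(2))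
    qed
    finally show ?thesis by (simp add: algebra_simps)
  qed
  have "open (A \<inter> {y. d p y < \<delta>})" "hmul (pW p) (pV p) \<in> A \<inter> {y. d p y < \<delta>}"
    using A \<delta>(1) by (auto simp: pW_pV intro: open_d_ball)
  then obtain r where r: "0 < r" "\<And>u u'. norm (u - pW p) < r \<Longrightarrow> norm (u' - pV p) < r \<Longrightarrow> hmul u u' \<in> A \<inter> {y. d p y < \<delta>}"
    by (rule continuous_WV) blast
  define \<rho> where "\<rho> = r / 2"
  \<comment> \<open>With this choice G moves the centre \<open>pV p\<close> by at most \<rho>/2; the
    contraction adds at most another \<rho>/2, so G maps the ball into itself.\<close>
  define \<delta>2 where "\<delta>2 = \<rho> / (2 * B * (K + \<epsilon>))"
  have \<rho>: "0 < \<rho>" "\<rho> < r" using r(1) by (auto simp: \<rho>_def)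
  have "0 < \<delta>2" using \<rho> B K \<epsilon> by (simp add: \<delta>2_def)
  then have "open {y. d p y < \<delta>2}" "hmul (pW p) (pV p) \<in> {y. d p y < \<delta>2}"
    by (auto simp: pW_pV intro: open_d_ball)
  then obtain r' where r': "0 < r'" "\<And>u u'. norm (u - pW p) < r' \<Longrightarrow> norm (u' - pV p) < r' \<Longrightarrow> hmul u u' \<in> {y. d p y < \<delta>2}"
    by (rule continuous_WV) blast
  define \<eta> where "\<eta> = min r r'"
  have in_A: "hmul u u' \<in> A" "d p (hmul u u') < \<delta>" if "norm (u - pW p) < \<eta>" "norm (u' - pV p) \<le> \<rho>" for u u'
    using r(2)[of u u'] that \<rho> by (auto simp: \<eta>_def)
  show ?thesis
  proof (rule that[of \<eta> \<rho>])
    show "0 < \<eta>" "0 < \<rho>" using r r' \<rho> by (auto simp: \<eta>_def)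
    show "hmul u u' \<in> A \<inter> \<Omega>" if "u \<in> W" "norm (u - pW p) < \<eta>" "u' \<in> V" "norm (u' - pV p) \<le> \<rho>" for u u'
      using in_A[of u u'] that \<delta>(2) by auto
    fix u assume u: "u \<in> W" "norm (u - pW p) < \<eta>"
    define G where "G z = z - \<Lambda> (f (hmul u z) - f p)" for z
    let ?s = "V \<inter> cball (pV p) \<rho>"
    have contr: "norm (G z - G z') \<le> 1 / 2 * norm (z - z')" if z: "z \<in> ?s" "z' \<in> ?s" for z z'
    proof -
      have zV: "z \<in> V" "z' \<in> V" using z by auto
      then have zz: "z - z' \<in> V" using subspace_diff[OF subspace_V] by blast
      have "- z' \<in> V" using subspace_neg[OF subspace_V] zV by blast
      have eq: "hmul (- hmul u z') (hmul u z) = z - z'"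
        using V_hmul[OF \<open>- z' \<in> V\<close> zV(1)] by (simp add: uminus_hmul hmul_assoc)
      have "G z - G z' = \<Lambda> (D p (z - z')) - \<Lambda> (f (hmul u z) - f (hmul u z'))"
        by (simp add: G_def \<Lambda>(4)[OF zz] linear_diff[OF \<Lambda>(1)])
      also have "\<dots> = - \<Lambda> (f (hmul u z) - f (hmul u z') - D p (z - z'))"
        by (simp add: linear_diff[OF \<Lambda>(1)])
      finally have "norm (G z - G z') \<le> B * norm (f (hmul u z) - f (hmul u z') - D p (z - z'))"
        using B(3) by (simp only: norm_minus_cancel)
      also have "\<dots> \<le> B * (\<epsilon> * d (hmul u z') (hmul u z))"
      proof (rule mult_left_mono)
        have "norm (z - pV p) \<le> \<rho>" "norm (z' - pV p) \<le> \<rho>" using z by (auto simp: dist_norm norm_minus_commute)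
        then show "norm (f (hmul u z) - f (hmul u z') - D p (z - z')) \<le> \<epsilon> * d (hmul u z') (hmul u z)"
          using \<delta>(3)[OF in_A(2)[OF u(2), of z'] in_A(2)[OF u(2), of z]] unfolding eq by blast
      qed (use B in simp)
      also have "d (hmul u z') (hmul u z) = N (z - z')" unfolding d_N[of "hmul u z'"] eq ..
      also have "B * (\<epsilon> * N (z - z')) \<le> B * (\<epsilon> * (C * norm (z - z')))"
        using C(2)[OF V_H1[OF zz]] B \<epsilon>(1) by (intro mult_left_mono) auto
      also have "\<dots> = 1 / 2 * norm (z - z')" using \<epsilon>(2) by (metis mult.assoc)
      finally show ?thesis .
    qed
    have pVs: "pV p \<in> ?s" using \<rho> pV by simp
    have start: "norm (G (pV p) - pV p) \<le> \<rho> / 2"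
    proof -
      have d2: "d p (hmul u (pV p)) < \<delta>2" using r'(2)[of u "pV p"] u(2) r'(1) by (auto simp: \<eta>_def)
      have "norm (G (pV p) - pV p) \<le> B * norm (f (hmul u (pV p)) - f p)"
        using B(3) by (simp add: G_def)
      also have "\<dots> \<le> B * ((K + \<epsilon>) * \<delta>2)"
        using f_near[OF in_A(2)[OF u(2), of "pV p"]] d2 \<rho> B K \<epsilon>
        by (intro mult_left_mono order_trans[OF f_near] in_A u) auto
      also have "\<dots> = \<rho> / 2" using B(1) K(1) \<epsilon>(1) by (simp add: \<delta>2_def)
      finally show ?thesis .
    qed
    have "\<exists>!z. z \<in> ?s \<and> G z = z"
    proof (rule Banach_fix[of ?s "1/2"])
      show "complete ?s" by (intro complete_eq_closed[THEN iffD2] closed_Int closed_subspace subspace_V closed_cball)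
      show "?s \<noteq> {}" using pVs by blast
      show "G ` ?s \<subseteq> ?s"
      proof
        fix y assume "y \<in> G ` ?s"
        then obtain z where z: "z \<in> ?s" "y = G z" by blast
        have "norm (G z - G (pV p)) \<le> 1 / 2 * norm (z - pV p)" by (rule contr[OF z(1) pVs])
        also have "\<dots> \<le> \<rho> / 2" using z(1) by (auto simp: dist_norm norm_minus_commute)
        finally have "norm (G z - pV p) \<le> \<rho>"
          using start norm_triangle_ineq[of "G z - G (pV p)" "G (pV p) - pV p"] by simp
        moreover have "G z \<in> V" using z(1) \<Lambda>(2) subspace_diff[OF subspace_V] by (auto simp: G_def)
        ultimately show "y \<in> ?s" using z(2) by (auto simp: dist_norm norm_minus_commute)
      qed
      show "dist (G z) (G z') \<le> 1 / 2 * dist z z'" if "z \<in> ?s" "z' \<in> ?s" for z z'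
        using contr that by (simp add: dist_norm)
    qed auto
    moreover have "G z = z \<longleftrightarrow> f (hmul u z) = f p" for z
    proof
      assume "G z = z"
      then have "\<Lambda> (f (hmul u z) - f p) = 0" by (simp add: G_def)
      then have "f (hmul u z) - f p = 0" using \<Lambda>(3) linear_0[OF lin_D[OF p\<Omega>]] by metis
      then show "f (hmul u z) = f p" by simp
    qed (simp add: G_def linear_0[OF \<Lambda>(1)])
    moreover have "z \<in> ?s \<longleftrightarrow> z \<in> V \<and> norm (z - pV p) \<le> \<rho>" for z
      by (auto simp: dist_norm norm_minus_commute)
    ultimately show "\<exists>!u'. u' \<in> V \<and> norm (u' - pV p) \<le> \<rho> \<and> f (hmul u u') = f p"
      by (simp only: conj_assoc)
  qed
qed

text \<open>Two points of S near p with the same W-factor u have V-factors that solve the same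
  equation, to which the uniqueness in \<open>implicit_function\<close> applies.\<close>

lemma local_injective:
  assumes p: "p \<in> S"
  shows "\<exists>O'. open O' \<and> p \<in> O' \<and> inj_on (proj_W W V) (S \<inter> O')"
proof -
  obtain \<eta> \<rho> where \<eta>: "0 < \<eta>" "0 < \<rho>"
    "\<And>u u'. u \<in> W \<Longrightarrow> norm (u - pW p) < \<eta> \<Longrightarrow> u' \<in> V \<Longrightarrow> norm (u' - pV p) \<le> \<rho> \<Longrightarrow> hmul u u' \<in> UNIV \<inter> \<Omega>"
    "\<And>u. u \<in> W \<Longrightarrow> norm (u - pW p) < \<eta> \<Longrightarrow> \<exists>!u'. u' \<in> V \<and> norm (u' - pV p) \<le> \<rho> \<and> f (hmul u u') = f p"
    by (rule implicit_function[OF p open_UNIV UNIV_I]) (rule that)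
  define O' where "O' = {x. norm (pW x - pW p) < \<eta> \<and> norm (pV x - pV p) < \<rho>}"
  have "open O'"
    unfolding O'_def by (intro open_Collect_conj open_Collect_less continuous_intros continuous_on_pV continuous_on_pW)
  moreover have "p \<in> O'" using \<eta> by (simp add: O'_def)
  moreover have "inj_on (proj_W W V) (S \<inter> O')"
  proof (rule inj_onI)
    fix x y assume xy: "x \<in> S \<inter> O'" "y \<in> S \<inter> O'" "proj_W W V x = proj_W W V y"
    have eq: "pW x = pW y" using xy(3) by (simp add: proj_W_eq)
    have fxy: "f x = f p" "f y = f p" using xy p by (auto simp: S)
    have "f (hmul (pW x) (pV x)) = f p" using fxy by (simp add: pW_pV)
    moreover have "f (hmul (pW x) (pV y)) = f p" unfolding eq using fxy by (simp add: pW_pV)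
    moreover have "norm (pW x - pW p) < \<eta>" "norm (pV x - pV p) \<le> \<rho>" "norm (pV y - pV p) \<le> \<rho>"
      using xy by (auto simp: O'_def)
    ultimately have "pV x = pV y" using \<eta>(4)[OF pW_W[of x]] pV(1)[of x] pV(1)[of y] by blast
    then have "hmul (pW x) (pV x) = hmul (pW y) (pV y)" by (simp only: eq)
    then show "x = y" by (simp only: pW_pV)
  qed
  ultimately show ?thesis by blast
qed

text \<open>If \<open>D y\<close> is closer to \<open>D p\<close> than 1/(2B), a vector u of V in
  its kernel satisfies N u \<le> N u / 2. This covers points y off S, where positivity of
  \<open>J_V\<close> is not given.\<close>

lemma D_inj_near:
  assumes p: "p \<in> S"
  shows "\<exists>\<delta>>0. \<forall>y. d p y < \<delta> \<longrightarrow> y \<in> \<Omega> \<and> (\<forall>u\<in>V. D y u = 0 \<longrightarrow> u = 0)"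
proof -
  obtain \<Lambda> B where \<Lambda>: "linear \<Lambda>" "\<And>y. \<Lambda> y \<in> V" "\<And>y. D p (\<Lambda> y) = y" "\<And>u. u \<in> V \<Longrightarrow> \<Lambda> (D p u) = u"
    and B: "0 < B" "\<And>y. N (\<Lambda> y) \<le> B * norm y" "\<And>y. norm (\<Lambda> y) \<le> B * norm y"
    by (rule D_inverse[OF p]) (rule that)
  have "0 < 1 / (2 * B)" using B by simp
  from C1h_continuous[OF C1 op S_sub[OF p] this] obtain \<delta> where \<delta>: "0 < \<delta>"
    "\<And>y. d p y < \<delta> \<Longrightarrow> y \<in> \<Omega> \<and> (\<forall>w. norm (D y w - D p w) \<le> 1 / (2 * B) * N w)" by blast
  have "u = 0" if "d p y < \<delta>" "u \<in> V" "D y u = 0" for y u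
  proof -
    have "norm (D p u) \<le> 1 / (2 * B) * N u" using \<delta>(2)[OF that(1)] that(3) by (metis norm_minus_cancel diff_0)
    then have "B * norm (D p u) \<le> B * (1 / (2 * B) * N u)" using B by (intro mult_left_mono) auto
    then have "N u \<le> N u / 2" using B(1) B(2)[of "D p u"] \<Lambda>(4)[OF that(2)] by simp
    then have "N u = 0" using N_nonneg[of u] by linarith
    then show ?thesis by simp
  qed
  then show ?thesis using \<delta> by (intro exI[of _ \<delta>]) blast
qed

text \<open>The gradients have to be independent on a whole neighbourhood and not only on S, which
  \<open>D_inj_near\<close> provides. Evaluated at preimages in V of the standard basis, their wedge
  is the determinant of the identity matrix.\<close>

lemma H_regular_level_set:
  assumes oO: "open O'"
  shows "H_regular_surface TYPE('k) d (S \<inter> O')"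
  unfolding H_regular_surface_def
proof (intro conjI ballI)
  show "CARD('k) \<le> CARD('n)" using dim_V_le dimV by simp
  fix x assume x: "x \<in> S \<inter> O'"
  obtain \<delta> where \<delta>: "0 < \<delta>" "\<And>y. d x y < \<delta> \<Longrightarrow> y \<in> \<Omega> \<and> (\<forall>u\<in>V. D y u = 0 \<longrightarrow> u = 0)"
    using D_inj_near x by blast
  define A where "A = O' \<inter> {y. d x y < \<delta>}"
  define h where "h y = f y - f x0" for y
  have A: "open A" "x \<in> A" using x oO \<delta>(1) open_d_ball[of x \<delta>] by (auto simp: A_def)
  have A\<Omega>: "y \<in> \<Omega>" if "y \<in> A" for y using that \<delta>(2)[of y] by (simp add: A_def)
  have der: "has_h_derivative d h (D y) y" if "y \<in> A" for y
    using has_D[OF A\<Omega>[OF that]] by (simp add: has_h_derivative_def h_def)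
  have hD: "h_deriv d h y = D y" if "y \<in> A" for y using h_deriv_eq[OF der[OF that]] .
  have "C1h d A h"
    unfolding C1h_def
  proof (intro conjI ballI)
    show "\<exists>L. has_h_derivative d h L y" if "y \<in> A" for y using der[OF that] by blast
    fix y assume y: "y \<in> A"
    have "uniform_limit {w. N w \<le> 1} D (D y) (at y within \<Omega>)"
      using C1 A\<Omega>[OF y] by (simp add: C1h_def)
    then have "uniform_limit {w. N w \<le> 1} D (D y) (at y within A)"
      by (rule filterlim_mono[OF _ order_refl at_le]) (use A\<Omega> in blast)
    moreover have "eventually (\<lambda>z. \<forall>w\<in>{w. N w \<le> 1}. h_deriv d h z w = D z w) (at y within A)"
      unfolding eventually_at_filter using hD by (intro always_eventually) auto
    ultimately show "uniform_limit {w. N w \<le> 1} (h_deriv d h) (h_deriv d h y) (at y within A)"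
      unfolding hD[OF y] by (subst uniform_limit_cong) auto
  qed
  moreover have "S \<inter> O' \<inter> A = {y \<in> A. h y = 0}"
    using A\<Omega> by (auto simp: S h_def A_def)
  moreover have "wedge (UNIV::'k set) (\<lambda>i. grad_H d (\<lambda>z. h z $ i) y) \<noteq> (\<lambda>_. 0)" if y: "y \<in> A" for y
  proof -
    have y\<Omega>: "y \<in> \<Omega>" by (rule A\<Omega>[OF y])
    have der_i: "has_h_derivative d (\<lambda>z. h z $ i) (\<lambda>w. D y w $ i) y" for i
    proof -
      have "has_h_derivative d (\<lambda>z. f z $ i) (\<lambda>w. D y w $ i) y"
        using has_h_derivative_component[OF y\<Omega>] .
      then show ?thesis by (simp add: has_h_derivative_def h_def)
    qed
    have "h_deriv d (\<lambda>z. h z $ i) y = h_deriv d (\<lambda>z. f z $ i) y" for i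
      unfolding h_deriv_component[OF y\<Omega>] by (rule h_deriv_eq[OF der_i])
    then have g: "grad_H d (\<lambda>z. h z $ i) y = grad y i" for i
      using grad_H_eq[OF y\<Omega>, of i] by (simp add: grad_H_def)
    obtain \<Lambda> where \<Lambda>: "\<And>z. \<Lambda> z \<in> V \<and> D y (\<Lambda> z) = z"
      using linear_iso_on_subspace[OF lin_D[OF y\<Omega>] subspace_V dimV] \<delta>(2)[of y] y unfolding A_def by blast
    have "wedge (UNIV::'k set) (\<lambda>i. grad_H d (\<lambda>z. h z $ i) y) (\<lambda>j. \<Lambda> (axis j 1))
        = det (\<chi> i j. grad y i \<bullet> \<Lambda> (axis j 1))"
      by (simp add: wedge_def det_def g)
    also have "(\<chi> i j. grad y i \<bullet> \<Lambda> (axis j 1)) = mat 1"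
      using \<Lambda> by (simp add: grad_inner[OF y\<Omega>] mat_def axis_def vec_eq_iff)
    finally have "wedge (UNIV::'k set) (\<lambda>i. grad_H d (\<lambda>z. h z $ i) y) (\<lambda>j. \<Lambda> (axis j 1)) = 1"
      by simp
    then show ?thesis by (metis zero_neq_one)
  qed
  ultimately show "\<exists>\<Omega> h. open \<Omega> \<and> x \<in> \<Omega> \<and> C1h d \<Omega> (h :: 'n heis \<Rightarrow> real^'k) \<and>
        S \<inter> O' \<inter> \<Omega> = {y\<in>\<Omega>. h y = 0} \<and>
        (\<forall>y\<in>\<Omega>. wedge (UNIV::'k set) (\<lambda>i. grad_H d (\<lambda>z. h z $ i) y) \<noteq> (\<lambda>_. 0))"
    using A by (intro exI[of _ A] exI[of _ h]) blast
qed

end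

text \<open>Serves both to construct a parametrization and to analyse a given one: openness of U and
  differentiability of \<phi> are derived from the graph property.\<close>

locale surface_graph = level_set d W V \<Omega> S f x0 v
  for d :: "('n::finite) heis \<Rightarrow> 'n heis \<Rightarrow> real" and W V \<Omega> S and f :: "'n heis \<Rightarrow> real^('k::finite)" and x0 v +
  fixes O' U :: "'n heis set" and \<phi> :: "'n heis \<Rightarrow> 'n heis"
  assumes oO: "open O'" and UW: "U \<subseteq> W" and \<phi>V: "\<phi> ` U \<subseteq> V"
    and graph: "S \<inter> O' = {hmul u (\<phi> u) |u. u \<in> U}"
begin

abbreviation \<Phi> :: "'n heis \<Rightarrow> 'n heis" where "\<Phi> u \<equiv> hmul u (\<phi> u)"

lemma \<Phi>_S: "u \<in> U \<Longrightarrow> \<Phi> u \<in> S" "u \<in> U \<Longrightarrow> \<Phi> u \<in> O'" using graph by blast+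

lemma U_W: "u \<in> U \<Longrightarrow> u \<in> W" using UW by blast

lemma \<phi>_V: "u \<in> U \<Longrightarrow> \<phi> u \<in> V" using \<phi>V by blast

lemma pV_\<Phi> [simp]: "u \<in> U \<Longrightarrow> pV (\<Phi> u) = \<phi> u" by (simp add: pV_hmul U_W \<phi>_V)

lemma pW_\<Phi> [simp]: "u \<in> U \<Longrightarrow> pW (\<Phi> u) = u" by (simp add: U_W \<phi>_V)

text \<open>The implicit function provides a point of the level set over each u near w0, inside O'.
  It belongs to the graph, and uniqueness of the factorization identifies it with
  \<open>\<Phi> u\<close>. Openness of U and continuity of the graph map are both contained in
  this.\<close>

lemma graph_local:
  assumes w0: "w0 \<in> U" and A: "open A" "\<Phi> w0 \<in> A"
  shows "\<exists>\<eta>>0. \<forall>u\<in>W. norm (u - w0) < \<eta> \<longrightarrow> u \<in> U \<and> \<Phi> u \<in> A"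
proof -
  have A': "open (A \<inter> O')" "\<Phi> w0 \<in> A \<inter> O'" using A oO \<Phi>_S[OF w0] by auto
  obtain \<eta> \<rho> where \<eta>: "0 < \<eta>" "0 < \<rho>"
    "\<And>u u'. u \<in> W \<Longrightarrow> norm (u - pW (\<Phi> w0)) < \<eta> \<Longrightarrow> u' \<in> V \<Longrightarrow> norm (u' - pV (\<Phi> w0)) \<le> \<rho> \<Longrightarrow> hmul u u' \<in> (A \<inter> O') \<inter> \<Omega>"
    "\<And>u. u \<in> W \<Longrightarrow> norm (u - pW (\<Phi> w0)) < \<eta> \<Longrightarrow> \<exists>!u'. u' \<in> V \<and> norm (u' - pV (\<Phi> w0)) \<le> \<rho> \<and> f (hmul u u') = f (\<Phi> w0)"
    by (rule implicit_function[OF \<Phi>_S(1)[OF w0] A']) (rule that)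
  have "u \<in> U \<and> \<Phi> u \<in> A" if u: "u \<in> W" "norm (u - w0) < \<eta>" for u
  proof -
    have u': "norm (u - pW (\<Phi> w0)) < \<eta>" using u(2) w0 by simp
    obtain u1 where u1: "u1 \<in> V" "norm (u1 - pV (\<Phi> w0)) \<le> \<rho>" "f (hmul u u1) = f (\<Phi> w0)"
      using \<eta>(4)[OF u(1) u'] by blast
    have mem: "hmul u u1 \<in> A" "hmul u u1 \<in> O'" "hmul u u1 \<in> \<Omega>" using \<eta>(3)[OF u(1) u' u1(1,2)] by auto
    have "f (\<Phi> w0) = f x0" using \<Phi>_S(1)[OF w0] by (simp add: S)
    then have "hmul u u1 \<in> S \<inter> O'" using mem u1(3) by (simp add: S)
    then obtain u2 where u2: "u2 \<in> U" "hmul u u1 = \<Phi> u2" using graph by blast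
    then have "u = u2" using factorization_unique[OF u(1) u1(1) U_W \<phi>_V] by blast
    then show ?thesis using u2 mem by simp
  qed
  then show ?thesis using \<eta>(1) by blast
qed

lemma openin_U: "openin (top_of_set W) U"
  unfolding openin_euclidean_subtopology_iff
proof (intro conjI UW ballI)
  fix w0 assume "w0 \<in> U"
  from graph_local[OF this open_UNIV UNIV_I] show "\<exists>e>0. \<forall>u\<in>W. dist u w0 < e \<longrightarrow> u \<in> U"
    unfolding dist_norm by blast
qed

text \<open>The intrinsic differential is \<open>- (Df|V)\<^sup>-\<^sup>1 \<circ> Df|W\<close>.\<close>

lemma intrinsic_differential:
  assumes w0: "w0 \<in> U"
  obtains L where "linear L" "\<And>z. L z \<in> V" "\<And>z. D (\<Phi> w0) (L z) = - D (\<Phi> w0) z"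
    "\<And>t z. 0 < t \<Longrightarrow> L (hdil t z) = t *\<^sub>R L z" "\<And>y z. L (hmul y z) = L y + L z"
    "\<And>e. 0 < e \<Longrightarrow> \<exists>\<delta>>0. \<forall>w'\<in>U. d w0 w' < \<delta> \<longrightarrow> (\<forall>u\<in>U. \<forall>w. w = hmul (hmul (- \<Phi> w') u) (\<phi> w') \<longrightarrow> N w < \<delta> \<longrightarrow>
       d (L w) (\<phi> u - \<phi> w') \<le> e * N w)"
proof -
  define p where "p = \<Phi> w0"
  have pS: "p \<in> S" using \<Phi>_S(1)[OF w0] by (simp add: p_def)
  have p\<Omega>: "p \<in> \<Omega>" using S_sub[OF pS] .
  obtain \<Lambda> B where \<Lambda>: "linear \<Lambda>" "\<And>y. \<Lambda> y \<in> V" "\<And>y. D p (\<Lambda> y) = y" "\<And>u. u \<in> V \<Longrightarrow> \<Lambda> (D p u) = u"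
    and B: "0 < B" "\<And>y. N (\<Lambda> y) \<le> B * norm y" "\<And>y. norm (\<Lambda> y) \<le> B * norm y"
    by (rule D_inverse[OF pS]) (rule that)
  define L where "L z = - \<Lambda> (D p z)" for z
  have LV: "L z \<in> V" for z using \<Lambda>(2) subspace_neg[OF subspace_V] by (simp add: L_def)
  have lin: "linear L"
    unfolding L_def[abs_def] using linear_compose[OF linear_compose[OF lin_D[OF p\<Omega>] \<Lambda>(1)] module_hom_uminus]
    by (simp add: o_def)
  have DL: "D p (L z) = - D p z" for z
    using \<Lambda>(3) by (simp add: L_def linear_neg[OF lin_D[OF p\<Omega>]])
  obtain K where K: "0 < K" "\<And>x. norm (D p x) \<le> K * N x" using h_hom_bounded[OF hom_D[OF p\<Omega>]] by blast
  have NL: "N (L z) \<le> B * K * N z" for z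
  proof -
    have "N (L z) \<le> B * norm (D p z)" using B(2) by (simp add: L_def)
    also have "\<dots> \<le> B * (K * N z)" using B(1) K(2) by (intro mult_left_mono) auto
    finally show ?thesis by (simp add: mult.assoc)
  qed
  have est: "\<exists>\<delta>>0. \<forall>w'\<in>U. d w0 w' < \<delta> \<longrightarrow> (\<forall>u\<in>U. \<forall>w. w = hmul (hmul (- \<Phi> w') u) (\<phi> w') \<longrightarrow> N w < \<delta> \<longrightarrow>
       d (L w) (\<phi> u - \<phi> w') \<le> e * N w)" if "0 < e" for e
  proof -
    \<comment> \<open>The bound 1/2 lets a term in \<open>N z\<close> be absorbed; the second bound
      turns the resulting factor \<open>2 * B * K + 2\<close> into e.\<close>
    define \<kappa> where "\<kappa> = min (1 / 2) (e / (2 * B * K + 2))"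
    have BK: "0 < 2 * B * K + 2" using B(1) K(1) by (simp add: add_pos_pos)
    have \<kappa>: "0 < \<kappa>" "\<kappa> \<le> 1 / 2" "\<kappa> * (2 * B * K + 2) \<le> e"
    proof -
      show "0 < \<kappa>" using \<open>0 < e\<close> BK by (simp add: \<kappa>_def)
      show "\<kappa> \<le> 1 / 2" unfolding \<kappa>_def by (rule min.cobounded1)
      have "\<kappa> \<le> e / (2 * B * K + 2)" by (simp add: \<kappa>_def)
      then show "\<kappa> * (2 * B * K + 2) \<le> e" using BK by (simp add: pos_le_divide_eq)
    qed
    have "0 < \<kappa> / B" using \<kappa> B by simp
    then obtain \<delta>1 where \<delta>1: "0 < \<delta>1" "\<And>y. d p y < \<delta>1 \<Longrightarrow> y \<in> \<Omega>"
      "\<And>y z. d p y < \<delta>1 \<Longrightarrow> d p z < \<delta>1 \<Longrightarrow> norm (f z - f y - D p (hmul (- y) z)) \<le> \<kappa> / B * d y z"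
      by (rule strict[OF p\<Omega>]) (rule that)
    have "open {y. d p y < \<delta>1}" "\<Phi> w0 \<in> {y. d p y < \<delta>1}"
      using \<delta>1(1) by (auto simp: p_def open_d_ball)
    from graph_local[OF w0 this] obtain \<eta> where \<eta>: "0 < \<eta>"
      "\<And>u. u \<in> W \<Longrightarrow> norm (u - w0) < \<eta> \<Longrightarrow> u \<in> U \<and> d p (\<Phi> u) < \<delta>1" by blast
    have base: "hmul p (- \<phi> w0) = w0" by (simp add: p_def hmul_assoc)
    \<comment> \<open>The map \<open>sigma_tr W V q\<close>, which recovers u from w. Its continuity
      at (p, 0) keeps u close to w0 uniformly in the base point q.\<close>
    define F where "F q w = hmul (hmul q w) (- pV q)" for q w
    have "continuous_on UNIV (\<lambda>x. F (fst x) (snd x))"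
      unfolding F_def by (intro continuous_intros continuous_on_pV)
    moreover have "F p 0 = w0" using w0 base by (simp add: F_def p_def)
    moreover have "open (ball w0 \<eta>)" by simp
    ultimately have "open ((\<lambda>x. F (fst x) (snd x)) -` ball w0 \<eta>)" "(p, 0) \<in> (\<lambda>x. F (fst x) (snd x)) -` ball w0 \<eta>"
      using \<eta>(1) open_vimage by auto
    then obtain A1 A2 where A12: "open A1" "open A2" "p \<in> A1" "0 \<in> A2"
      "A1 \<times> A2 \<subseteq> (\<lambda>x. F (fst x) (snd x)) -` ball w0 \<eta>"
      by (rule open_prod_elim) auto
    have A1: "open (A1 \<inter> {y. d p y < \<delta>1})" "\<Phi> w0 \<in> A1 \<inter> {y. d p y < \<delta>1}"
      using A12 \<delta>1(1) by (auto simp: p_def open_d_ball)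
    from graph_local[OF w0 A1] obtain \<eta>' where \<eta>': "0 < \<eta>'"
      "\<And>u. u \<in> W \<Longrightarrow> norm (u - w0) < \<eta>' \<Longrightarrow> \<Phi> u \<in> A1 \<and> d p (\<Phi> u) < \<delta>1" by blast
    have "w0 \<in> ball w0 \<eta>'" using \<eta>' by simp
    from d_small[OF open_ball this] obtain \<delta>2 where \<delta>2: "0 < \<delta>2" "\<And>y. d w0 y < \<delta>2 \<Longrightarrow> y \<in> ball w0 \<eta>'" by blast
    from d_small[OF A12(2,4)] obtain \<delta>3 where \<delta>3: "0 < \<delta>3" "\<And>y. d 0 y < \<delta>3 \<Longrightarrow> y \<in> A2" by blast
    show ?thesis
    proof (intro exI[of _ "min \<delta>2 \<delta>3"] conjI ballI allI impI)
      show "0 < min \<delta>2 \<delta>3" using \<delta>2 \<delta>3 by simp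
      fix w' u w assume w': "w' \<in> U" "d w0 w' < min \<delta>2 \<delta>3" and u: "u \<in> U"
        and w: "w = hmul (hmul (- \<Phi> w') u) (\<phi> w')" and Nw: "N w < min \<delta>2 \<delta>3"
      define q where "q = \<Phi> w'"
      define z where "z = \<phi> u - \<phi> w'"
      have "norm (w' - w0) < \<eta>'" using \<delta>2(2)[of w'] w'(2) by (simp add: dist_norm norm_minus_commute)
      then have q: "q \<in> A1" "d p q < \<delta>1" using \<eta>'(2)[OF U_W[OF w'(1)]] by (auto simp: q_def)
      have "d 0 w < \<delta>3" using Nw by (simp add: hnorm_def d_sym)
      then have "w \<in> A2" by (rule \<delta>3(2))
      with q(1) have "(q, w) \<in> A1 \<times> A2" by simp
      from subsetD[OF A12(5) this] have "F q w \<in> ball w0 \<eta>" by simp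
      moreover have "F q w = u" using w'(1) by (simp add: F_def q_def w hmul_assoc)
      ultimately have "norm (u - w0) < \<eta>" by (simp add: dist_norm norm_minus_commute)
      then have du: "d p (\<Phi> u) < \<delta>1" using \<eta>(2)[OF U_W[OF u]] by blast
      have zV: "z \<in> V" using subspace_diff[OF subspace_V \<phi>_V[OF u] \<phi>_V[OF w'(1)]] by (simp add: z_def)
      have "- \<phi> w' \<in> V" using subspace_neg[OF subspace_V \<phi>_V[OF w'(1)]] .
      then have "z = hmul (- \<phi> w') (\<phi> u)" using V_hmul[OF _ \<phi>_V[OF u]] by (simp add: z_def)
      then have qu: "hmul (- q) (\<Phi> u) = hmul w z" by (simp add: w q_def hmul_assoc)
      \<comment> \<open>Both points lie on the level set, so the increment of f vanishes and strict
        differentiability bounds \<open>D p (hmul w z)\<close> itself.\<close>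
      have "f (\<Phi> u) = f q" using \<Phi>_S(1)[OF u] \<Phi>_S(1)[OF w'(1)] by (simp add: S q_def)
      then have "norm (D p (hmul w z)) \<le> \<kappa> / B * N (hmul w z)"
        using \<delta>1(3)[OF q(2) du] unfolding d_N[of q] qu by simp
      also have "\<dots> \<le> \<kappa> / B * (N w + N z)" using \<kappa> B N_hmul by (intro mult_left_mono) auto
      finally have Dwz: "norm (D p (hmul w z)) \<le> \<kappa> / B * (N w + N z)" .
      have "z - L w = \<Lambda> (D p (hmul w z))"
        using \<Lambda>(4)[OF zV] by (simp add: L_def D_hmul[OF p\<Omega>] linear_add[OF \<Lambda>(1)])
      then have "N (z - L w) \<le> B * norm (D p (hmul w z))" using B(2) by simp
      also have "\<dots> \<le> B * (\<kappa> / B * (N w + N z))" using Dwz B(1) by (intro mult_left_mono) auto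
      finally have 1: "N (z - L w) \<le> \<kappa> * (N w + N z)" using B(1) by simp
      have "- L w \<in> V" using subspace_neg[OF subspace_V LV] .
      then have d: "d (L w) z = N (z - L w)" using V_hmul[OF _ zV] by (simp add: d_N[of "L w"])
      have "z = hmul (L w) (z - L w)"
        using V_hmul[OF LV subspace_diff[OF subspace_V zV LV]] by simp
      then have "N z \<le> N (L w) + N (z - L w)" using N_hmul by metis
      also have "\<dots> \<le> B * K * N w + \<kappa> * (N w + N z)"
        using NL[of w] 1 by (rule add_mono)
      \<comment> \<open>Half of \<open>N z\<close> is absorbed on the left, leaving an a priori
        bound of \<open>N z\<close> by a multiple of \<open>N w\<close>.\<close>
      also have "\<kappa> * (N w + N z) \<le> 1 / 2 * (N w + N z)"
        using \<kappa>(2) by (rule mult_right_mono) simp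
      finally have "N z \<le> (2 * B * K + 1) * N w" by (simp add: algebra_simps)
      then have "N w + N z \<le> (2 * B * K + 2) * N w" by (simp add: algebra_simps)
      then have "\<kappa> * (N w + N z) \<le> \<kappa> * ((2 * B * K + 2) * N w)" using \<kappa>(1) by (intro mult_left_mono) auto
      also have "\<dots> \<le> e * N w" using mult_right_mono[OF \<kappa>(3), of "N w"] by (simp add: mult.assoc)
      finally show "d (L w) (\<phi> u - \<phi> w') \<le> e * N w" using 1 d by (simp add: z_def)
    qed
  qed
  have "L (hdil t z) = t *\<^sub>R L z" if "0 < t" for t z
    using hom_D[OF p\<Omega>] that by (simp add: L_def h_hom_def linear_scale[OF \<Lambda>(1)])
  moreover have "L (hmul y z) = L y + L z" for y z
    by (simp add: L_def D_hmul[OF p\<Omega>] linear_add[OF \<Lambda>(1)])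
  ultimately show ?thesis
    using that[of L] lin LV DL est unfolding p_def by blast
qed

lemma sigma_tr_\<Phi>:
  assumes "w' \<in> U"
  shows "sigma_tr W V (hinv (\<Phi> w')) u = hmul (hmul (- \<Phi> w') u) (\<phi> w')"
  using assms by (simp add: sigma_tr_def proj_V_eq hinv_eq pV_uminus)

text \<open>V is commutative, so translation by the inverse of \<open>\<Phi> w'\<close> acts on
  values by subtraction. This gives the quotient in \<open>unif_intrinsic_diff\<close> the form
  estimated above.\<close>

lemma phi_tr_\<Phi>:
  assumes "w' \<in> U" "u \<in> U"
  shows "phi_tr W V \<phi> (hinv (\<Phi> w')) (hmul (hmul (- \<Phi> w') u) (\<phi> w')) = \<phi> u - \<phi> w'"
proof -
  have "sigma_tr W V (\<Phi> w') (hmul (hmul (- \<Phi> w') u) (\<phi> w')) = u"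
    using assms by (simp add: sigma_tr_def proj_V_eq hinv_eq hmul_assoc)
  moreover have "- \<phi> w' \<in> V" using subspace_neg[OF subspace_V \<phi>_V[OF assms(1)]] .
  ultimately show ?thesis
    using assms V_hmul[OF _ \<phi>_V[OF assms(2)]] by (simp add: phi_tr_def proj_V_eq hinv_eq pV_uminus)
qed

lemma unif_intrinsic_diff_\<phi>: "unif_intrinsic_diff d W V U \<phi>"
  unfolding unif_intrinsic_diff_def
proof
  fix w0 assume w0: "w0 \<in> U"
  obtain L where L: "linear L" "\<And>z. L z \<in> V" "\<And>z. D (\<Phi> w0) (L z) = - D (\<Phi> w0) z"
    "\<And>t z. 0 < t \<Longrightarrow> L (hdil t z) = t *\<^sub>R L z" "\<And>y z. L (hmul y z) = L y + L z"
    "\<And>e. 0 < e \<Longrightarrow> \<exists>\<delta>>0. \<forall>w'\<in>U. d w0 w' < \<delta> \<longrightarrow> (\<forall>u\<in>U. \<forall>w. w = hmul (hmul (- \<Phi> w') u) (\<phi> w') \<longrightarrow> N w < \<delta> \<longrightarrow>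
       d (L w) (\<phi> u - \<phi> w') \<le> e * N w)"
    by (rule intrinsic_differential[OF w0]) (rule that)
  have "h_hom_on W V L"
    using L(2,4,5) V_H1 by (auto simp: h_hom_on_def V_hmul hdil_H1)
  moreover have "((\<lambda>\<delta>. SUP w'\<in>{w'\<in>U. N (hmul (hinv w0) w') < \<delta>}.
             SUP w\<in>{w \<in> sigma_tr W V (hinv (\<Phi> w')) ` U. 0 < N w \<and> N w < \<delta>}.
               ennreal (d (L w) (phi_tr W V \<phi> (hinv (\<Phi> w')) w) / N w)) \<longlongrightarrow> 0) (at_right 0)"
    (is "(?G \<longlongrightarrow> 0) _")
  proof (rule order_tendstoI)
    fix a :: ennreal assume "0 < a"
    then have "\<exists>e>0. ennreal e < a"
    proof (cases a)
      case (real r)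
      then show ?thesis using \<open>0 < a\<close> by (intro exI[of _ "r / 2"]) (auto simp: ennreal_less_iff)
    qed (auto intro: exI[of _ 1])
    then obtain e where e: "0 < e" "ennreal e < a" by blast
    obtain \<delta> where \<delta>: "0 < \<delta>" "\<And>w' u w. w' \<in> U \<Longrightarrow> d w0 w' < \<delta> \<Longrightarrow> u \<in> U \<Longrightarrow>
        w = hmul (hmul (- \<Phi> w') u) (\<phi> w') \<Longrightarrow> N w < \<delta> \<Longrightarrow> d (L w) (\<phi> u - \<phi> w') \<le> e * N w"
      using L(6)[OF e(1)] by blast
    have "?G \<delta>' \<le> ennreal e" if "\<delta>' < \<delta>" for \<delta>'
    proof (intro SUP_least)
      fix w' w assume w': "w' \<in> {w'\<in>U. N (hmul (hinv w0) w') < \<delta>'}"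
        and w: "w \<in> {w \<in> sigma_tr W V (hinv (\<Phi> w')) ` U. 0 < N w \<and> N w < \<delta>'}"
      have w'U: "w' \<in> U" "d w0 w' < \<delta>" using w' that by (auto simp: hinv_eq d_N[of w0])
      obtain u where u: "u \<in> U" "w = hmul (hmul (- \<Phi> w') u) (\<phi> w')"
        using w sigma_tr_\<Phi>[OF w'U(1)] by auto
      have "d (L w) (\<phi> u - \<phi> w') \<le> e * N w" by (rule \<delta>(2)[OF w'U u]) (use w that in simp)
      then have "d (L w) (phi_tr W V \<phi> (hinv (\<Phi> w')) w) \<le> e * N w"
        using phi_tr_\<Phi>[OF w'U(1) u(1)] by (simp add: u(2))
      then have "d (L w) (phi_tr W V \<phi> (hinv (\<Phi> w')) w) / N w \<le> e"
        using w by (simp add: pos_divide_le_eq)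
      then show "ennreal (d (L w) (phi_tr W V \<phi> (hinv (\<Phi> w')) w) / N w) \<le> ennreal e" by (rule ennreal_leI)
    qed
    then show "\<forall>\<^sub>F \<delta> in at_right 0. ?G \<delta> < a"
      unfolding eventually_at_right_field using \<delta>(1) e(2) by (intro exI[of _ \<delta>]) (auto intro: le_less_trans)
  qed auto
  ultimately show "\<exists>L. h_hom_on W V L \<and> ((\<lambda>\<delta>. SUP w'\<in>{w'\<in>U. N (hmul (hinv w0) w') < \<delta>}.
             SUP w\<in>{w \<in> sigma_tr W V (hinv (\<Phi> w')) ` U. 0 < N w \<and> N w < \<delta>}.
               ennreal (d (L w) (phi_tr W V \<phi> (hinv (\<Phi> w')) w) / N w)) \<longlongrightarrow> 0) (at_right 0)"
    by blast
qed

lemma H_parametrized_graph: "H_parametrized TYPE('k) d W V (S \<inter> O') U \<phi>"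
  unfolding H_parametrized_def
  using H_regular_level_set[OF oO] sd openin_U \<phi>V unif_intrinsic_diff_\<phi> graph by blast

end

context level_set begin

text \<open>Where the projection to W is injective, \<phi> may be taken to send the W-factor of a
  surface point to its V-factor.\<close>

lemma ex_H_parametrized:
  assumes "open O'" "inj_on (proj_W W V) (S \<inter> O')"
  shows "\<exists>U \<phi>. H_parametrized TYPE('k) d W V (S \<inter> O') U \<phi>"
proof -
  define g where "g = inv_into (S \<inter> O') pW"
  have inj: "inj_on pW (S \<inter> O')" using assms(2) by (simp add: inj_on_def proj_W_eq)
  have g: "g (pW x) = x" if "x \<in> S \<inter> O'" for x unfolding g_def by (rule inv_into_f_f[OF inj that])
  interpret surface_graph d W V \<Omega> S f x0 v O' "pW ` (S \<inter> O')" "\<lambda>u. pV (g u)"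
  proof
    show "open O'" by (rule assms)
    show "pW ` (S \<inter> O') \<subseteq> W" using pW_W by blast
    show "(\<lambda>u. pV (g u)) ` pW ` (S \<inter> O') \<subseteq> V" using pV by blast
    have "hmul (pW x) (pV (g (pW x))) = x" if "x \<in> S \<inter> O'" for x using g[OF that] pW_pV by simp
    then show "S \<inter> O' = {hmul u (pV (g u)) |u. u \<in> pW ` (S \<inter> O')}" by force
  qed
  show ?thesis using H_parametrized_graph by blast
qed

end

section \<open>Hausdorff measure and slabs\<close>

lemma ex_orthonormal_basis:
  fixes X :: "'a::euclidean_space set"
  assumes "subspace X" "finite J" "card J = dim X"
  shows "\<exists>b :: 'i \<Rightarrow> 'a. orthonormal_basis_of J b X"
proof -
  obtain B where B: "B \<subseteq> X" "pairwise orthogonal B" "\<And>x. x \<in> B \<Longrightarrow> norm x = 1"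
      "independent B" "card B = dim X" "span B = X"
    by (rule orthonormal_basis_subspace[OF assms(1)]) auto
  have "finite B" using B(4) by (rule independent_imp_finite)
  then obtain b where b: "bij_betw b J B" using finite_same_card_bij[OF assms(2)] assms(3) B(5) by metis
  have "b i \<bullet> b j = (if i = j then 1 else 0)" if "i \<in> J" "j \<in> J" for i j
  proof -
    have "b i \<in> B" "b j \<in> B" "b i = b j \<longleftrightarrow> i = j"
      using b that by (auto simp: bij_betw_def inj_on_def)
    then show ?thesis using B(2,3) by (auto simp: pairwise_def orthogonal_def norm_eq_1)
  qed
  moreover have "span (b ` J) = X" using b B(6) by (simp add: bij_betw_def)
  ultimately show ?thesis by (intro exI[of _ b]) (simp add: orthonormal_basis_of_def)
qed

lemma orthonormal_sum_inner:
  assumes b: "orthonormal_basis_of J b X" and J: "finite J" "j \<in> J"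
  shows "(\<Sum>i\<in>J. c i *\<^sub>R b i) \<bullet> b j = c j"
proof -
  have "(\<Sum>i\<in>J. c i *\<^sub>R b i) \<bullet> b j = (\<Sum>i\<in>J. if i = j then c j else 0)"
    unfolding inner_sum_left using b J(2) by (intro sum.cong) (auto simp: orthonormal_basis_of_def)
  then show ?thesis using J by simp
qed

lemma norm_orthonormal_sum:
  assumes b: "orthonormal_basis_of J b X" and J: "finite J"
  shows "(norm (\<Sum>i\<in>J. c i *\<^sub>R b i))\<^sup>2 = (\<Sum>i\<in>J. (c i)\<^sup>2)"
proof -
  have "(norm (\<Sum>i\<in>J. c i *\<^sub>R b i))\<^sup>2 = (\<Sum>j\<in>J. c j * ((\<Sum>i\<in>J. c i *\<^sub>R b i) \<bullet> b j))"
    using inner_sum_right[of "\<Sum>i\<in>J. c i *\<^sub>R b i" "\<lambda>i. c i *\<^sub>R b i" J]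
    by (simp only: power2_norm_eq_inner inner_scaleR_right)
  also have "\<dots> = (\<Sum>j\<in>J. (c j)\<^sup>2)"
    by (intro sum.cong refl) (simp add: orthonormal_sum_inner[OF b J] power2_eq_square)
  finally show ?thesis .
qed

lemma orthonormal_basis_mem: "orthonormal_basis_of J b X \<Longrightarrow> i \<in> J \<Longrightarrow> b i \<in> X"
  by (auto simp: orthonormal_basis_of_def intro: span_base)

locale framed_graph = surface_graph d W V \<Omega> S f x0 v O' U \<phi>
  for d :: "('n::finite) heis \<Rightarrow> 'n heis \<Rightarrow> real" and W V \<Omega> S and f :: "'n heis \<Rightarrow> real^('k::finite)" and x0 v O' U \<phi> +
  fixes w :: "nat \<Rightarrow> 'n heis"
  assumes w: "orthonormal_basis_of {CARD('k)+1..2*CARD('n)+1} w W"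
    and w_last: "w (2*CARD('n)+1) = e_last"
begin

definition I0 :: "nat set" where "I0 = {1..2*CARD('n)+1}"
definition I1 :: "nat set" where "I1 = {1..CARD('k)}"
definition I2 :: "nat set" where "I2 = {CARD('k)+1..2*CARD('n)+1}"

lemma k_le: "CARD('k) \<le> CARD('n)" using dim_V_le dimV by simp

lemma I_facts: "finite I0" "finite I1" "finite I2" "I1 \<inter> I2 = {}" "I0 = I1 \<union> I2"
  using k_le by (auto simp: I0_def I1_def I2_def)

lemma v1: "orthonormal_basis_of I1 v V" using v by (simp add: I1_def)
lemma w2: "orthonormal_basis_of I2 w W" using w by (simp add: I2_def)

lemma card_I1: "card I1 = CARD('k)" by (simp add: I1_def)

lemma dim_W: "dim W = card I2" using dim_W_V dimV by (simp add: I2_def)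

text \<open>The frame that lists a basis of V first: \<open>join v w\<close> stands for V \<and> N,
  and \<open>join v p\<close> exchanges the basis of W for one of another complement of V.\<close>

definition join :: "(nat \<Rightarrow> 'n heis) \<Rightarrow> (nat \<Rightarrow> 'n heis) \<Rightarrow> nat \<Rightarrow> 'n heis" where
  "join a b i = (if i \<le> CARD('k) then a i else b i)"

lemma join_1: "i \<in> I1 \<Longrightarrow> join a b i = a i" and join_2: "i \<in> I2 \<Longrightarrow> join a b i = b i"
  by (auto simp: join_def I1_def I2_def)

lemma sum_I0: "(\<Sum>i\<in>I0. g i) = (\<Sum>i\<in>I1. g i) + (\<Sum>i\<in>I2. g (i::nat))" for g :: "nat \<Rightarrow> 'a::comm_monoid_add"
  unfolding I_facts(5) by (rule sum.union_disjoint) (use I_facts in auto)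

definition vol :: "(nat \<Rightarrow> 'n heis) \<Rightarrow> real" where
  "vol u = mv_norm I0 (wedge I0 u)"

lemma vol_nonneg: "0 \<le> vol u" by (auto simp: vol_def mv_norm_def intro!: divide_nonneg_nonneg sum_nonneg)

text \<open>\<open>\<pi>\<close> is the projection onto \<open>P\<close> along \<open>V\<close>.\<close>

definition complement :: "'n heis set \<Rightarrow> (nat \<Rightarrow> 'n heis) \<Rightarrow> ('n heis \<Rightarrow> 'n heis) \<Rightarrow> bool" where
  "complement P p \<pi> \<longleftrightarrow> subspace P \<and> dim P = dim W \<and> orthonormal_basis_of I2 p P \<and> linear \<pi> \<and>
     (\<forall>y. \<pi> y \<in> P) \<and> (\<forall>x\<in>P. \<pi> x = x) \<and> (\<forall>y. y - \<pi> y \<in> V) \<and> (\<forall>x\<in>V. \<pi> x = 0)"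

definition slab :: "('n heis \<Rightarrow> 'n heis) \<Rightarrow> 'n heis set \<Rightarrow> 'n heis set" where
  "slab \<pi> A = {y. \<pi> y \<in> A \<and> norm (y - \<pi> y) \<le> 1}"

text \<open>A linear map sends a fixed orthonormal basis to the frame \<open>join v p\<close> and
  the fixed body \<open>K\<close>, a product of two unit balls, onto the slab over the unit ball of
  P. Hence \<kappa> is the volume of \<open>K\<close>, the same for all P.\<close>

lemma ex_unit_slab_volume:
  "\<exists>\<kappa>>0. \<forall>P p \<pi>. complement P p \<pi> \<longrightarrow>
     emeasure lborel (slab \<pi> (cball 0 1)) = ennreal (vol (join v p) * \<kappa>)"
proof -
  obtain s :: "nat \<Rightarrow> 'n heis" where s': "orthonormal_basis_of {1..2 * CARD('n) + 1} s UNIV"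
    and vol': "\<And>(u :: nat \<Rightarrow> 'n heis) A. compact A \<Longrightarrow>
       emeasure lborel ((\<lambda>y. \<Sum>i\<in>{1..2 * CARD('n) + 1}. (y \<bullet> s i) *\<^sub>R u i) ` A)
       = ennreal (mv_norm {1..2 * CARD('n) + 1} (wedge {1..2 * CARD('n) + 1} u)) * emeasure lborel A"
    by (rule volume_of_frame) (rule that)
  have s: "orthonormal_basis_of I0 s UNIV" using s' by (simp only: I0_def)
  have vol: "emeasure lborel ((\<lambda>y. \<Sum>i\<in>I0. (y \<bullet> s i) *\<^sub>R u i) ` A) = ennreal (vol u) * emeasure lborel A"
    if "compact A" for u A using vol'[OF that] by (simp only: vol_def I0_def)
  define K where "K = {y. (\<Sum>i\<in>I1. (y \<bullet> s i)\<^sup>2) \<le> 1 \<and> (\<Sum>i\<in>I2. (y \<bullet> s i)\<^sup>2) \<le> 1}"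
  have ny: "(norm y)\<^sup>2 = (\<Sum>i\<in>I1. (y \<bullet> s i)\<^sup>2) + (\<Sum>i\<in>I2. (y \<bullet> s i)\<^sup>2)" for y
  proof -
    have "y = (\<Sum>i\<in>I0. (y \<bullet> s i) *\<^sub>R s i)" by (rule orthonormal_basis_expand[OF s I_facts(1)]) simp
    then have "(norm y)\<^sup>2 = (\<Sum>i\<in>I0. (y \<bullet> s i)\<^sup>2)"
      using norm_orthonormal_sum[OF s I_facts(1), of "\<lambda>i. y \<bullet> s i"] by simp
    then show ?thesis by (simp only: sum_I0)
  qed
  have "closed K"
    unfolding K_def by (intro closed_Collect_conj closed_Collect_le continuous_intros)
  moreover have "norm y \<le> 2" if "y \<in> K" for y
  proof -
    have "(norm y)\<^sup>2 \<le> 2\<^sup>2" using that by (simp add: ny K_def)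
    then show ?thesis by (rule power2_le_imp_le) simp
  qed
  then have "bounded K" unfolding bounded_iff by blast
  ultimately have cK: "compact K" by (simp add: compact_eq_bounded_closed)
  have "ball 0 1 \<subseteq> K"
  proof
    fix y :: "'n heis" assume "y \<in> ball 0 1"
    then have "(norm y)\<^sup>2 \<le> 1" by (simp add: power_le_one)
    moreover have "0 \<le> (\<Sum>i\<in>I1. (y \<bullet> s i)\<^sup>2)" "0 \<le> (\<Sum>i\<in>I2. (y \<bullet> s i)\<^sup>2)" by (auto intro: sum_nonneg)
    ultimately show "y \<in> K" by (simp add: ny K_def)
  qed
  then have "emeasure lborel (ball (0::'n heis) 1) \<le> emeasure lborel K"
    using borel_compact[OF cK] by (intro emeasure_mono) auto
  moreover have "0 < emeasure lborel (ball (0::'n heis) 1)"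
    using unit_ball_vol_pos[of "real DIM('n heis)"] by (simp add: emeasure_ball)
  moreover have "emeasure lborel K < \<infinity>" by (rule emeasure_compact_finite[OF cK])
  ultimately have "0 < emeasure lborel K" "emeasure lborel K \<noteq> top" by (auto intro: less_le_trans)
  then obtain \<kappa> where \<kappa>: "0 < \<kappa>" "emeasure lborel K = ennreal \<kappa>"
    by (cases "emeasure lborel K") auto
  have "emeasure lborel (slab \<pi> (cball 0 1)) = ennreal (vol (join v p) * \<kappa>)" if c: "complement P p \<pi>" for P p \<pi>
  proof -
    have p: "orthonormal_basis_of I2 p P" and \<pi>: "linear \<pi>" "\<And>y. \<pi> y \<in> P" "\<And>x. x \<in> P \<Longrightarrow> \<pi> x = x"
      "\<And>y. y - \<pi> y \<in> V" "\<And>x. x \<in> V \<Longrightarrow> \<pi> x = 0" and P: "subspace P"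
      using c by (auto simp: complement_def)
    define T where "T y = (\<Sum>i\<in>I0. (y \<bullet> s i) *\<^sub>R join v p i)" for y
    have T: "T y = (\<Sum>i\<in>I1. (y \<bullet> s i) *\<^sub>R v i) + (\<Sum>i\<in>I2. (y \<bullet> s i) *\<^sub>R p i)" for y
      unfolding T_def sum_I0 by (simp add: join_1 join_2 cong: sum.cong)
    have T1: "(\<Sum>i\<in>I1. c i *\<^sub>R v i) \<in> V" for c
      by (intro subspace_sum[OF subspace_V] subspace_scale[OF subspace_V] orthonormal_basis_mem[OF v1])
    have T2: "(\<Sum>i\<in>I2. c i *\<^sub>R p i) \<in> P" for c
      by (intro subspace_sum[OF P] subspace_scale[OF P] orthonormal_basis_mem[OF p])
    have \<pi>T: "\<pi> (T y) = (\<Sum>i\<in>I2. (y \<bullet> s i) *\<^sub>R p i)" for y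
      by (simp add: T linear_add[OF \<pi>(1)] \<pi>(5)[OF T1] \<pi>(3)[OF T2])
    have le1: "norm x \<le> 1 \<longleftrightarrow> (norm x)\<^sup>2 \<le> 1" for x :: "'n heis"
      by (simp add: power2_le_iff_abs_le[of 1, simplified] abs_square_le_1)
    have inK: "T y \<in> slab \<pi> (cball 0 1) \<longleftrightarrow> y \<in> K" for y
    proof -
      have "norm (\<pi> (T y)) \<le> 1 \<longleftrightarrow> (\<Sum>i\<in>I2. (y \<bullet> s i)\<^sup>2) \<le> 1"
        unfolding \<pi>T le1 norm_orthonormal_sum[OF p I_facts(3)] ..
      moreover have "norm (T y - \<pi> (T y)) \<le> 1 \<longleftrightarrow> (\<Sum>i\<in>I1. (y \<bullet> s i)\<^sup>2) \<le> 1"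
      proof -
        have "T y - \<pi> (T y) = (\<Sum>i\<in>I1. (y \<bullet> s i) *\<^sub>R v i)" unfolding \<pi>T by (simp add: T)
        then show ?thesis by (simp only: le1 norm_orthonormal_sum[OF v1 I_facts(2)])
      qed
      ultimately show ?thesis by (auto simp: slab_def K_def)
    qed
    have surj: "\<exists>y. T y = y'" for y'
    proof -
      define c where "c i = (if i \<le> CARD('k) then (y' - \<pi> y') \<bullet> v i else \<pi> y' \<bullet> p i)" for i
      define y where "y = (\<Sum>i\<in>I0. c i *\<^sub>R s i)"
      have "y \<bullet> s i = c i" if "i \<in> I0" for i
        unfolding y_def by (rule orthonormal_sum_inner[OF s I_facts(1) that])
      then have "T y = (\<Sum>i\<in>I1. c i *\<^sub>R v i) + (\<Sum>i\<in>I2. c i *\<^sub>R p i)"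
        unfolding T using I_facts(5) by simp
      also have "(\<Sum>i\<in>I1. c i *\<^sub>R v i) = (\<Sum>i\<in>I1. ((y' - \<pi> y') \<bullet> v i) *\<^sub>R v i)"
        by (intro sum.cong) (auto simp: c_def I1_def)
      also have "\<dots> = y' - \<pi> y'" by (rule orthonormal_basis_expand[OF v1 I_facts(2) \<pi>(4), symmetric])
      also have "(\<Sum>i\<in>I2. c i *\<^sub>R p i) = (\<Sum>i\<in>I2. (\<pi> y' \<bullet> p i) *\<^sub>R p i)"
        by (intro sum.cong) (auto simp: c_def I2_def)
      also have "\<dots> = \<pi> y'" by (rule orthonormal_basis_expand[OF p I_facts(3) \<pi>(2), symmetric])
      finally show ?thesis by auto
    qed
    have "slab \<pi> (cball 0 1) = T ` K"
    proof (intro set_eqI iffI)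
      fix y' assume "y' \<in> slab \<pi> (cball 0 1)"
      moreover obtain y where "T y = y'" using surj by blast
      ultimately show "y' \<in> T ` K" using inK by blast
    qed (use inK in blast)
    then have "emeasure lborel (slab \<pi> (cball 0 1)) = ennreal (vol (join v p)) * ennreal \<kappa>"
      using vol[OF cK, of "join v p"] \<kappa>(2) by (simp add: T_def[abs_def])
    then show ?thesis using \<kappa>(1) vol_nonneg by (simp add: ennreal_mult)
  qed
  then show ?thesis using \<kappa>(1) by blast
qed

abbreviation H :: "'n heis set \<Rightarrow> ennreal" where
  "H A \<equiv> emeasure (hausdorff_measure (dim W)) A"

text \<open>The constant is the Hausdorff measure of the unit ball of W divided by \<kappa>. Since
  it is common to all complements, it drops out when two of them are compared.\<close>

lemma ex_hausdorff_slab: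
  "\<exists>c. \<forall>P p \<pi> A. complement P p \<pi> \<longrightarrow> A \<in> sets borel \<longrightarrow>
     H (P \<inter> A) * ennreal (vol (join v p)) = c * emeasure lborel (slab \<pi> A)"
proof -
  obtain \<kappa> where \<kappa>: "0 < \<kappa>" "\<And>P p \<pi>. complement P p \<pi> \<Longrightarrow>
     emeasure lborel (slab \<pi> (cball 0 1)) = ennreal (vol (join v p) * \<kappa>)"
    using ex_unit_slab_volume by blast
  define h where "h = hausdorff_outer (dim W) (W \<inter> cball 0 1)"
  have "H (P \<inter> A) * ennreal (vol (join v p)) = (h * ennreal (1 / \<kappa>)) * emeasure lborel (slab \<pi> A)"
    if c: "complement P p \<pi>" and A: "A \<in> sets borel" for P p \<pi> A
  proof -
    have P: "subspace P" "dim P = dim W" and \<pi>: "linear \<pi>" "\<And>y. \<pi> y \<in> P" "\<And>x. x \<in> P \<Longrightarrow> \<pi> x = x"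
      using c by (auto simp: complement_def)
    have "P \<inter> cball 0 1 \<in> sets borel" using closed_subspace[OF P(1)] by (intro borel_closed closed_Int) auto
    then have h: "H (P \<inter> cball 0 1) = h"
      unfolding h_def using hausdorff_unit_ball_subspace[OF P(1) subspace_W P(2)] by (simp add: emeasure_hausdorff_measure)
    have "H (P \<inter> A) * ennreal (vol (join v p) * \<kappa>) = h * emeasure lborel (slab \<pi> A)"
      using hausdorff_subspace_unique[OF P(1) \<pi> A, of "cball 0 1"] h \<kappa>(2)[OF c]
      by (simp add: P(2) slab_def)
    then have eq: "H (P \<inter> A) * (ennreal (vol (join v p)) * ennreal \<kappa>) = h * emeasure lborel (slab \<pi> A)"
      using \<kappa>(1) vol_nonneg by (simp add: ennreal_mult)
    have "ennreal (1 / \<kappa>) * ennreal \<kappa> = 1" using \<kappa>(1) by (simp flip: ennreal_mult)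
    then have "H (P \<inter> A) * ennreal (vol (join v p))
        = (ennreal (1 / \<kappa>) * ennreal \<kappa>) * (H (P \<inter> A) * ennreal (vol (join v p)))" by simp
    also have "\<dots> = ennreal (1 / \<kappa>) * (H (P \<inter> A) * (ennreal (vol (join v p)) * ennreal \<kappa>))"
      by (simp only: mult_ac)
    also have "\<dots> = (h * ennreal (1 / \<kappa>)) * emeasure lborel (slab \<pi> A)"
      unfolding eq by (simp only: mult_ac)
    finally show ?thesis .
  qed
  then show ?thesis by blast
qed

lemma cont_linear: "linear F \<Longrightarrow> continuous_on A F" for F :: "'n heis \<Rightarrow> 'n heis"
  by (simp add: linear_continuous_on linear_conv_bounded_linear)

definition qV :: "'n heis \<Rightarrow> 'n heis" where "qV y = y - pV y"

lemma qV_W: "qV y \<in> W" by (simp add: qV_def pV)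

lemma linear_qV: "linear qV"
  unfolding qV_def[abs_def] by (intro linear_compose_sub linear_pV linear_ident)

lemma qV_simps [simp]: "x \<in> W \<Longrightarrow> qV x = x" "x \<in> V \<Longrightarrow> qV x = 0"
  by (simp_all add: qV_def)

lemma qV_vert: "qV (y + t *\<^sub>R e_last) = qV y + t *\<^sub>R e_last"
  using W_e_last[of t] by (simp add: linear_add[OF linear_qV])

lemma complement_W: "complement W w qV"
  using subspace_W w2 linear_qV qV_W pV by (auto simp: complement_def qV_def)

lemma compact_slab_W:
  assumes "compact A"
  shows "compact (slab qV A)"
proof -
  have "closed (slab qV A)"
  proof -
    have "slab qV A = qV -` A \<inter> {y. norm (y - qV y) \<le> 1}" by (auto simp: slab_def)
    moreover have "closed (qV -` A)" using compact_imp_closed[OF assms] cont_linear[OF linear_qV] by (rule closed_vimage)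
    ultimately show ?thesis
      by (auto intro!: closed_Int closed_Collect_le continuous_intros cont_linear[OF linear_qV])
  qed
  moreover have "bounded (slab qV A)"
  proof -
    obtain B where B: "\<And>x. x \<in> A \<Longrightarrow> norm x \<le> B" using compact_imp_bounded[OF assms] unfolding bounded_iff by blast
    have "norm y \<le> B + 1" if "y \<in> slab qV A" for y
      using that B[of "qV y"] norm_triangle_ineq[of "qV y" "y - qV y"] by (simp add: slab_def)
    then show ?thesis unfolding bounded_iff by blast
  qed
  ultimately show ?thesis by (simp add: compact_eq_bounded_closed)
qed

text \<open>The slab over the unit ball of W contains a Euclidean ball, so its volume, a multiple of
  the frame volume, is positive.\<close>

lemma vol_pos: "0 < vol (join v w)"
proof -
  obtain \<kappa> where \<kappa>: "0 < \<kappa>" "\<And>P p \<pi>. complement P p \<pi> \<Longrightarrow>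
     emeasure lborel (slab \<pi> (cball 0 1)) = ennreal (vol (join v p) * \<kappa>)"
    using ex_unit_slab_volume by blast
  have "open {y. norm (qV y) < 1 \<and> norm (y - qV y) < 1}"
    by (intro open_Collect_conj open_Collect_less continuous_intros cont_linear[OF linear_qV])
  moreover have "0 \<in> {y. norm (qV y) < 1 \<and> norm (y - qV y) < 1}" by (simp add: linear_0[OF linear_qV])
  ultimately obtain e where e: "0 < e" "ball 0 e \<subseteq> {y. norm (qV y) < 1 \<and> norm (y - qV y) < 1}"
    using open_contains_ball by blast
  then have "ball 0 e \<subseteq> slab qV (cball 0 1)" by (auto simp: slab_def subset_eq)
  then have "emeasure lborel (ball (0::'n heis) e) \<le> emeasure lborel (slab qV (cball 0 1))"
    using borel_compact[OF compact_slab_W[OF compact_cball]] by (intro emeasure_mono) auto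
  moreover have "0 < emeasure lborel (ball (0::'n heis) e)"
    using unit_ball_vol_pos[of "real DIM('n heis)"] e(1) by (simp add: emeasure_ball)
  ultimately have "0 < vol (join v w) * \<kappa>" unfolding \<kappa>(2)[OF complement_W]
    by (metis ennreal_less_zero_iff less_le_trans)
  then show ?thesis using \<kappa>(1) by (simp add: zero_less_mult_iff)
qed

lemma hausdorff_W_cancel:
  assumes "A \<in> sets borel" "A \<subseteq> W" "B \<in> sets borel" "B \<subseteq> W"
    and "emeasure lborel (slab qV B) = ennreal t * emeasure lborel (slab qV A)"
  shows "H B = ennreal t * H A"
proof -
  obtain c where c: "\<And>P p \<pi> A. complement P p \<pi> \<Longrightarrow> A \<in> sets borel \<Longrightarrow>
     H (P \<inter> A) * ennreal (vol (join v p)) = c * emeasure lborel (slab \<pi> A)"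
    using ex_hausdorff_slab by blast
  have "ennreal (vol (join v w)) * H B = ennreal (vol (join v w)) * (ennreal t * H A)"
    using c[OF complement_W assms(1)] c[OF complement_W assms(3)] assms
    by (simp add: Int_absorb1 mult.left_commute mult.commute)
  moreover have "ennreal (vol (join v w)) \<noteq> 0" using vol_pos by simp
  ultimately show ?thesis by (simp add: ennreal_mult_cancel_left)
qed

text \<open>The homogeneous dimension of \<open>W\<close>, which is \<open>dim W + 1\<close>.\<close>

definition Q :: nat where "Q = 2 * CARD('n) + 2 - CARD('k)"

text \<open>On slabs the map is a dilation of the W-component followed by a vertical shear and a
  translation. Only the dilation changes volume: its eigenvalues are 1 on V, r on the horizontal
  part of W and the square of r on \<open>e_last\<close>, with product \<open>r ^ Q\<close>.\<close>

lemma hausdorff_translate_dilate: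
  assumes r: "0 < r" and A: "compact A" "A \<subseteq> W"
  shows "H ((\<lambda>z. sigma_tr W V x (hdil r z)) ` A) = ennreal (r ^ Q) * H A"
proof -
  define \<tau> where "\<tau> z = sigma_tr W V x (hdil r z)" for z
  define c where "c = pW x"
  \<comment> \<open>The vertical terms of the group law: conjugation by the V-factor of x gives
    \<open>symp (pV x) z\<close>, left translation by its W-factor gives half of
    \<open>symp c z\<close>.\<close>
  define sh where "sh z = symp (pV x) z + symp c z / 2" for z
  have \<tau>: "\<tau> z = c + hdil r z + sh (hdil r z) *\<^sub>R e_last" if "z \<in> W" for z
  proof -
    have conj: "hmul (hmul a z) (- a) = z + symp a z *\<^sub>R e_last" for a z :: "'n heis"
      by (cases a; cases z) (simp add: hmul_Pair e_last_def symp_def inner_commute inner_add_left inner_add_right field_simps)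
    have "\<tau> z = hmul (hmul (hmul c (pV x)) (hdil r z)) (- pV x)"
      by (simp add: \<tau>_def sigma_tr_def proj_V_eq hinv_eq c_def pW_pV)
    also have "\<dots> = hmul c (hmul (hmul (pV x) (hdil r z)) (- pV x))" by (simp only: hmul_assoc)
    also have "\<dots> = hmul c (hdil r z + symp (pV x) (hdil r z) *\<^sub>R e_last)" by (simp only: conj)
    also have "\<dots> = c + hdil r z + sh (hdil r z) *\<^sub>R e_last"
    proof -
      have "symp c (y + t *\<^sub>R e_last) = symp c y" for y t by (simp add: symp_def e_last_def)
      then show ?thesis by (simp add: hmul_def sh_def scaleR_add_left)
    qed
    finally show ?thesis .
  qed
  have \<tau>W: "\<tau> z \<in> W" if "z \<in> W" for z
    using \<tau>[OF that] W_vert subspace_add[OF subspace_W] pW_W W_hdil[OF that] by (simp add: c_def)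
  have c\<tau>: "continuous_on UNIV \<tau>"
    unfolding \<tau>_def sigma_tr_def hinv_eq by (intro continuous_intros)
  have compact\<tau>: "compact (\<tau> ` A)" using A(1) c\<tau> continuous_on_subset by (blast intro: compact_continuous_image)
  \<comment> \<open>The dilation acts on the W-component only, so the thickness of the slab along V
    is unchanged.\<close>
  define K where "K y = hdil r (qV y) + pV y" for y
  have linK: "linear K"
    unfolding K_def[abs_def]
    by (intro linear_compose_add linear_pV linear_compose[OF linear_qV linear_hdil, unfolded o_def])
  have qK: "qV (K y) = hdil r (qV y)" for y
    using W_hdil[OF qV_W] pV by (simp add: K_def linear_add[OF linear_qV])
  have pK: "pV (K y) = pV y" for y
    using W_hdil[OF qV_W] pV by (simp add: K_def linear_add[OF linear_pV])
  define E where "E y = y + sh (qV y) *\<^sub>R e_last" for y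
  have sh_vert: "sh (y + t *\<^sub>R e_last) = sh y" for y t by (simp add: sh_def symp_def e_last_def)
  have qE: "qV (E y) = qV y + sh (qV y) *\<^sub>R e_last" and pE: "pV (E y) = pV y" for y
  proof -
    show "qV (E y) = qV y + sh (qV y) *\<^sub>R e_last" by (simp add: E_def qV_vert)
    show "pV (E y) = pV y" using W_e_last by (simp add: E_def linear_add[OF linear_pV])
  qed
  have slab_eq: "slab qV (\<tau> ` A) = (+) c ` E ` K ` slab qV A"
  proof (intro set_eqI iffI)
    fix y assume "y \<in> (+) c ` E ` K ` slab qV A"
    then obtain y' where y': "y' \<in> slab qV A" "y = c + E (K y')" by blast
    have "qV y = \<tau> (qV y')"
      using pW_W[of x] \<tau>[OF qV_W, of y'] by (simp add: y'(2) linear_add[OF linear_qV] qE qK c_def)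
    moreover have "pV y = pV y'" using pW_W[of x] by (simp add: y'(2) linear_add[OF linear_pV] pE pK c_def)
    ultimately show "y \<in> slab qV (\<tau> ` A)" using y'(1) by (auto simp: slab_def qV_def)
  next
    fix y assume y: "y \<in> slab qV (\<tau> ` A)"
    then obtain z where z: "z \<in> A" "qV y = \<tau> z" by (auto simp: slab_def)
    have zW: "z \<in> W" using z A by blast
    define y' where "y' = z + pV y"
    have q': "qV y' = z" "pV y' = pV y" using zW pV by (auto simp: y'_def linear_add[OF linear_qV] linear_add[OF linear_pV])
    have "c + E (K y') = \<tau> z + pV y"
      using \<tau>[OF zW] by (simp add: E_def qK q') (simp add: K_def q' algebra_simps)
    also have "\<dots> = y" using z(2) by (simp add: qV_def flip: z(2))
    finally have y_eq: "y = c + E (K y')" ..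
    have "norm (pV y) \<le> 1" using y by (simp add: slab_def qV_def)
    then have "y' \<in> slab qV A" using z q' by (simp add: slab_def y'_def)
    then show "y \<in> (+) c ` E ` K ` slab qV A" using y_eq by blast
  qed
  have cS: "compact (slab qV A)" by (rule compact_slab_W[OF A(1)])
  have cKS: "compact (K ` B)" if "compact B" for B using that by (intro compact_continuous_image cont_linear linK)
  have "continuous_on UNIV (\<lambda>y. sh (qV y))"
    unfolding sh_def by (intro continuous_intros cont_linear[OF linear_qV]) auto
  moreover have "sh (qV (a, b, s)) = sh (qV (a, b, 0))" for a b s
  proof -
    have "(a, b, s) = (a, b, 0) + s *\<^sub>R e_last" by (simp add: e_last_def)
    then show ?thesis by (simp only: qV_vert sh_vert)
  qed
  ultimately have vE: "emeasure lborel (E ` B) = emeasure lborel B" if "compact B" for B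
    unfolding E_def[abs_def] using that by (intro emeasure_vertical_shear) auto
  have cEB: "compact (E ` B)" if "compact B" for B
    using that unfolding E_def[abs_def] sh_def
    by (intro compact_continuous_image continuous_intros cont_linear[OF linear_qV]) auto
  have vT: "emeasure lborel ((+) c ` B) = emeasure lborel B" if "compact B" for B :: "'n heis set"
  proof -
    have "(+) c ` B = (+) (- c) -` B" by (auto intro: image_eqI[of _ _ "_ - c"])
    then have "emeasure lborel ((+) c ` B) = emeasure (distr lborel borel ((+) (- c))) B"
      using borel_compact[OF that] by (subst emeasure_distr) auto
    then show ?thesis by (simp add: lborel_distr_plus)
  qed
  define m where "m = \<bar>det (matrix (heis_to_vec \<circ> K \<circ> vec_to_heis))\<bar>"
  have vK: "emeasure lborel (K ` B) = ennreal m * emeasure lborel B" if "compact B" for B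
    unfolding m_def by (rule emeasure_linear_heis[OF linK that])
  have "m = r ^ Q"
  proof -
    obtain s :: "nat \<Rightarrow> 'n heis" where s': "orthonormal_basis_of {1..2 * CARD('n) + 1} s UNIV"
      and vol': "\<And>(u :: nat \<Rightarrow> 'n heis) A. compact A \<Longrightarrow>
         emeasure lborel ((\<lambda>y. \<Sum>i\<in>{1..2 * CARD('n) + 1}. (y \<bullet> s i) *\<^sub>R u i) ` A)
         = ennreal (mv_norm {1..2 * CARD('n) + 1} (wedge {1..2 * CARD('n) + 1} u)) * emeasure lborel A"
      by (rule volume_of_frame) (rule that)
    have s: "orthonormal_basis_of I0 s UNIV" using s' by (simp only: I0_def)
    define T where "T u y = (\<Sum>i\<in>I0. (y \<bullet> s i) *\<^sub>R u i)" for u :: "nat \<Rightarrow> 'n heis" and y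
    have vol: "emeasure lborel (T u ` A) = ennreal (vol u) * emeasure lborel A" if "compact A" for u A
      unfolding T_def[abs_def] using vol'[OF that] by (simp only: vol_def I0_def)
    define t where "t i = (if i \<le> CARD('k) then 1 else if i = 2*CARD('n)+1 then r\<^sup>2 else r)" for i
    have K_basis: "K (join v w i) = t i *\<^sub>R join v w i" if "i \<in> I0" for i
    proof (cases "i \<in> I1")
      case True
      then have "v i \<in> V" by (rule orthonormal_basis_mem[OF v1])
      moreover have "i \<le> CARD('k)" using True by (simp add: I1_def)
      ultimately show ?thesis by (simp add: K_def t_def join_def)
    next
      case False
      then have i: "i \<in> I2" using that I_facts(5) by blast
      then have wi: "w i \<in> W" and ik: "\<not> i \<le> CARD('k)" using orthonormal_basis_mem[OF w2] by (auto simp: I2_def)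
      have last: "2*CARD('n)+1 \<in> I2" using k_le by (simp add: I2_def)
      show ?thesis
      proof (cases "i = 2*CARD('n)+1")
        case True
        then show ?thesis using wi ik w_last
          by (simp add: K_def t_def join_def hdil_def e_last_def)
      next
        case False
        \<comment> \<open>Orthogonality to \<open>e_last\<close> makes the other basis vectors of W
          horizontal, so the dilation multiplies them by r.\<close>
        then have "w i \<bullet> w (2*CARD('n)+1) = 0" using w2 i last by (simp add: orthonormal_basis_of_def)
        then have "w i \<in> H1" unfolding w_last by (simp add: e_last_def inner_prod_def H1_def)
        then show ?thesis using wi ik False by (simp add: K_def t_def join_def hdil_H1)
      qed
    qed
    have KT: "K (T (join v w) y) = T (\<lambda>i. t i *\<^sub>R join v w i) y" for y
      unfolding T_def linear_sum[OF linK] linear_scale[OF linK] by (intro sum.cong refl) (simp add: K_basis)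
    have "vol (\<lambda>i. t i *\<^sub>R join v w i) = (\<Prod>i\<in>I0. t i) * vol (join v w)"
    proof -
      have "leib I0 (\<lambda>i j. (t i *\<^sub>R join v w i) \<bullet> (t j *\<^sub>R join v w j))
          = (\<Prod>i\<in>I0. t i)\<^sup>2 * leib I0 (\<lambda>i j. join v w i \<bullet> join v w j)"
        by (subst leib_scale[OF I_facts(1), symmetric]) (simp add: mult_ac)
      moreover have "0 \<le> (\<Prod>i\<in>I0. t i)" using r by (intro prod_nonneg) (auto simp: t_def)
      ultimately show ?thesis by (simp add: vol_def mv_norm_wedge[OF I_facts(1)] real_sqrt_mult)
    qed
    moreover have "(\<Prod>i\<in>I0. t i) = r ^ Q"
    proof -
      have I0: "I0 = I1 \<union> ({CARD('k)+1..2*CARD('n)} \<union> {2*CARD('n)+1})"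
        using k_le by (auto simp: I0_def I1_def)
      have "(\<Prod>i\<in>I0. t i) = (\<Prod>i\<in>I1. t i) * ((\<Prod>i\<in>{CARD('k)+1..2*CARD('n)}. t i) * t (2*CARD('n)+1))"
        unfolding I0 using k_le by (subst prod.union_disjoint, simp_all add: I1_def disjoint_iff)+
      also have "(\<Prod>i\<in>I1. t i) = 1" by (intro prod.neutral) (auto simp: t_def I1_def)
      also have "(\<Prod>i\<in>{CARD('k)+1..2*CARD('n)}. t i) = (\<Prod>i\<in>{CARD('k)+1..2*CARD('n)}. r)"
        by (intro prod.cong) (auto simp: t_def)
      also have "\<dots> = r ^ (2*CARD('n) - CARD('k))" by simp
      also have "t (2*CARD('n)+1) = r ^ 2" using k_le by (simp add: t_def)
      also have "1 * (r ^ (2*CARD('n) - CARD('k)) * r ^ 2) = r ^ Q"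
      proof -
        have "Q = (2*CARD('n) - CARD('k)) + 2" using k_le by (simp add: Q_def)
        then show ?thesis by (simp only: power_add mult_1)
      qed
      finally show ?thesis .
    qed
    ultimately have v: "vol (\<lambda>i. t i *\<^sub>R join v w i) = r ^ Q * vol (join v w)" by simp
    define C where "C = cball (0::'n heis) 1"
    have cC: "compact C" by (simp add: C_def)
    have cTC: "compact (T (join v w) ` C)"
      using cC unfolding T_def[abs_def] by (intro compact_continuous_image continuous_intros)
    obtain b where b: "emeasure lborel C = ennreal b" "b > 0"
      unfolding C_def by (simp add: emeasure_cball)
    have "K ` T (join v w) ` C = T (\<lambda>i. t i *\<^sub>R join v w i) ` C" by (simp add: image_image KT)
    then have "ennreal m * (ennreal (vol (join v w)) * ennreal b) = ennreal (r ^ Q * vol (join v w)) * ennreal b"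
      using vK[OF cTC] vol[OF cC, of "join v w"] vol[OF cC, of "\<lambda>i. t i *\<^sub>R join v w i"] v b by simp
    moreover have "0 \<le> m" by (simp add: m_def)
    ultimately have "ennreal (m * (vol (join v w) * b)) = ennreal ((r ^ Q * vol (join v w)) * b)"
      using vol_pos b r by (simp add: ennreal_mult)
    then have "m * (vol (join v w) * b) = (r ^ Q * vol (join v w)) * b"
      using vol_pos b r \<open>0 \<le> m\<close> by (subst (asm) ennreal_inj) auto
    then show ?thesis using vol_pos b by simp
  qed
  have "emeasure lborel (slab qV (\<tau> ` A)) = ennreal (r ^ Q) * emeasure lborel (slab qV A)"
    unfolding slab_eq using vT[OF cEB[OF cKS[OF cS]]] vE[OF cKS[OF cS]] vK[OF cS] \<open>m = r ^ Q\<close> by simp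
  moreover have "\<tau> ` A \<subseteq> W" using \<tau>W A(2) by blast
  ultimately have "H (\<tau> ` A) = ennreal (r ^ Q) * H A"
    by (intro hausdorff_W_cancel borel_compact A compact\<tau>)
  then show ?thesis by (simp only: \<tau>_def[abs_def])
qed

end

section \<open>Continuity of the quotient of the Jacobians\<close>

context level_set begin

lemma J_H_eq: "x \<in> \<Omega> \<Longrightarrow> J_H d f x = sqrt (det (\<chi> i j. grad x i \<bullet> grad x j))"
  using mv_norm_wedge[of UNIV "grad x"]
  by (simp add: J_H_def grad_H_eq leib_det[of "\<lambda>i. i"] bij_betw_def)

lemma tendsto_grad:
  assumes x: "x \<in> \<Omega>"
  shows "((\<lambda>y. grad y i) \<longlongrightarrow> grad x i) (at x)"
proof -
  have "((\<lambda>y. D y b) \<longlongrightarrow> D x b) (at x)" for b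
  proof (rule tendstoI)
    fix e :: real assume "0 < e"
    then have "0 < e / (N b + 1)" by (simp add: add_nonneg_pos)
    from C1h_continuous[OF C1 op x this] obtain \<delta> where \<delta>: "0 < \<delta>"
      "\<And>y. d x y < \<delta> \<Longrightarrow> norm (D y b - D x b) \<le> e / (N b + 1) * N b" by blast
    have "e / (N b + 1) * N b < e / (N b + 1) * (N b + 1)"
      using \<open>0 < e / (N b + 1)\<close> by (intro mult_strict_left_mono) auto
    then have "e / (N b + 1) * N b < e" using N_nonneg[of b] by (simp add: add_nonneg_eq_0_iff)
    then have "dist (D y b) (D x b) < e" if "d x y < \<delta>" for y
      using \<delta>(2)[OF that] by (simp add: dist_norm)
    moreover have "open {y. d x y < \<delta>}" "x \<in> {y. d x y < \<delta>}" using \<delta>(1) open_d_ball[of x \<delta>] by auto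
    ultimately show "\<forall>\<^sub>F y in at x. dist (D y b) (D x b) < e"
      unfolding eventually_at_topological by blast
  qed
  then show ?thesis unfolding grad_def by (intro tendsto_intros)
qed

text \<open>Both Jacobians are expressed by determinants of inner products of gradients, which are
  continuous in the point, and \<open>J_V\<close> does not vanish at x.\<close>

lemma ratio_continuous:
  assumes x: "x \<in> S" and "0 < \<eta>"
  shows "\<exists>\<delta>>0. \<forall>y. d x y < \<delta> \<longrightarrow> \<bar>J_H d f y / J_V d V f y - J_H d f x / J_V d V f x\<bar> < \<eta>"
proof -
  have x\<Omega>: "x \<in> \<Omega>" using S_sub[OF x] .
  let ?R = "\<lambda>y. sqrt (det (\<chi> i j. grad y i \<bullet> grad y j)) / \<bar>det (\<chi> i j. grad y i \<bullet> v (ek j))\<bar>"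
  have R: "J_H d f y / J_V d V f y = ?R y" if "y \<in> \<Omega>" for y
    using that by (simp add: J_H_eq J_V_eq)
  have nz: "\<bar>det (\<chi> i j. grad x i \<bullet> v (ek j))\<bar> \<noteq> 0"
    using JV x J_V_eq[OF x\<Omega>] by auto
  have "(?R \<longlongrightarrow> ?R x) (at x)"
    by (intro tendsto_divide tendsto_real_sqrt tendsto_rabs nz; unfold det_def; intro tendsto_intros)
       (simp_all add: tendsto_inner tendsto_grad[OF x\<Omega>])
  then have "\<forall>\<^sub>F y in at x. \<bar>?R y - ?R x\<bar> < \<eta>"
    using \<open>0 < \<eta>\<close> by (auto dest: tendstoD simp: dist_real_def)
  then obtain A where A: "open A" "x \<in> A" "\<And>y. y \<in> A \<Longrightarrow> y \<noteq> x \<Longrightarrow> \<bar>?R y - ?R x\<bar> < \<eta>"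
    unfolding eventually_at_topological by blast
  have "open (A \<inter> \<Omega>)" "x \<in> A \<inter> \<Omega>" using A op x\<Omega> by auto
  from d_small[OF this] obtain \<delta> where \<delta>: "0 < \<delta>" "\<And>y. d x y < \<delta> \<Longrightarrow> y \<in> A \<inter> \<Omega>" by blast
  have "\<bar>J_H d f y / J_V d V f y - J_H d f x / J_V d V f x\<bar> < \<eta>" if "d x y < \<delta>" for y
  proof (cases "y = x")
    case False
    then show ?thesis using A(3)[of y] \<delta>(2)[OF that] R x\<Omega> by simp
  qed (use \<open>0 < \<eta>\<close> in simp)
  then show ?thesis using \<delta>(1) by blast
qed

end

section \<open>Blow-up of the graph at a point\<close>

locale blow_up = framed_graph d W V \<Omega> S f x0 v O' U \<phi> w
  for d :: "('n::finite) heis \<Rightarrow> 'n heis \<Rightarrow> real" and W V \<Omega> S and f :: "'n heis \<Rightarrow> real^('k::finite)" and x0 v O' U \<phi> w +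
  fixes w0 :: "'n heis" and L :: "'n heis \<Rightarrow> 'n heis"
  assumes w0: "w0 \<in> U" and lin_L: "linear L" and L_V: "\<And>z. L z \<in> V"
    and D_L: "\<And>z. D (\<Phi> w0) (L z) = - D (\<Phi> w0) z"
    and L_hdil: "\<And>t z. 0 < t \<Longrightarrow> L (hdil t z) = t *\<^sub>R L z"
    and L_hmul: "\<And>y z. L (hmul y z) = L y + L z"
    and L_est: "\<And>e. 0 < e \<Longrightarrow> \<exists>\<delta>>0. \<forall>w'\<in>U. d w0 w' < \<delta> \<longrightarrow> (\<forall>u\<in>U. \<forall>w. w = hmul (hmul (- \<Phi> w') u) (\<phi> w') \<longrightarrow> N w < \<delta> \<longrightarrow>
       d (L w) (\<phi> u - \<phi> w') \<le> e * N w)"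
begin

definition x :: "'n heis" where "x = \<Phi> w0"

lemma x_S: "x \<in> S" and x_O': "x \<in> O'" using \<Phi>_S[OF w0] by (auto simp: x_def)

lemma x_\<Omega>: "x \<in> \<Omega>" using S_sub[OF x_S] .

lemma pV_x: "pV x = \<phi> w0" using w0 by (simp add: x_def)

definition P :: "'n heis set" where "P = {z. D x z = 0}"

definition g :: "'n heis \<Rightarrow> 'n heis" where "g z = hmul z (L z)"

text \<open>The linear counterpart of g: on W the two differ by a vertical vector, which the
  vertical shear in \<open>emeasure_slab_g\<close> compensates.\<close>

definition \<pi> :: "'n heis \<Rightarrow> 'n heis" where "\<pi> y = qV y + L (qV y)"

lemma D_Lx: "D x (L z) = - D x z" using D_L by (simp add: x_def)

lemma L_vert: "L (z + t *\<^sub>R e_last) = L z"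
proof -
  have "D x (L (t *\<^sub>R e_last)) = 0" by (simp add: D_Lx h_hom_e_last[OF hom_D[OF x_\<Omega>]])
  then have "L (t *\<^sub>R e_last) = 0" by (rule D_inj[OF x_S L_V])
  then show ?thesis by (simp add: linear_add[OF lin_L])
qed

lemma subspace_P: "subspace P"
  unfolding P_def using linear_subspace_kernel[OF lin_D[OF x_\<Omega>]] .

lemma \<pi>_P: "\<pi> y \<in> P"
  by (simp add: P_def \<pi>_def linear_add[OF lin_D[OF x_\<Omega>]] D_Lx)

text \<open>Up to sign, \<open>D x\<close> takes the same value at y as at
  \<open>L (qV y) - pV y\<close>, a vector of V, where \<open>D x\<close> is injective. So P is the
  graph of L over W in the additive sense.\<close>

lemma P_iff: "y \<in> P \<longleftrightarrow> L (qV y) = pV y"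
proof
  assume y: "y \<in> P"
  have "D x (L (qV y) - pV y) = - D x (qV y) - D x (pV y)"
    by (simp add: linear_diff[OF lin_D[OF x_\<Omega>]] D_Lx)
  also have "\<dots> = - D x (qV y + pV y)" by (simp add: linear_add[OF lin_D[OF x_\<Omega>]])
  also have "\<dots> = 0" using y by (simp add: qV_def P_def)
  finally have "L (qV y) - pV y = 0"
    by (rule D_inj[OF x_S subspace_diff[OF subspace_V L_V pV(1)]])
  then show "L (qV y) = pV y" by simp
next
  assume "L (qV y) = pV y"
  then have "y = \<pi> y" by (simp add: \<pi>_def qV_def)
  then show "y \<in> P" using \<pi>_P by metis
qed

lemma linear_\<pi>: "linear \<pi>"
  unfolding \<pi>_def[abs_def] by (intro linear_compose_add linear_qV linear_compose[OF linear_qV lin_L, unfolded o_def])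

lemma pW_g: "z \<in> W \<Longrightarrow> pW (g z) = z"
  using L_V by (simp add: g_def)

text \<open>\<open>pW y\<close> and \<open>qV y\<close> differ by a vertical vector, which L does
  not see.\<close>

lemma g_pW: "y \<in> P \<Longrightarrow> g (pW y) = y"
proof -
  assume y: "y \<in> P"
  have "pW y = qV y + (- symp y (pV y) / 2) *\<^sub>R e_last"
    by (simp add: pW_def qV_def hmul_def symp_def)
  then have "L (pW y) = L (qV y)" by (simp only: L_vert)
  then show ?thesis using y pW_pV[of y] by (simp add: g_def P_iff)
qed

lemma g_hdil: "0 < t \<Longrightarrow> g (hdil t z) = hdil t (g z)"
  using hdil_H1[OF V_H1[OF L_V]] by (simp add: g_def hdil_hmul L_hdil)

lemma continuous_on_g: "continuous_on A g"
  unfolding g_def[abs_def] by (intro continuous_intros cont_linear lin_L)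

lemma dim_P: "dim P = dim W"
proof -
  have "inj_on \<pi> W"
  proof (rule inj_onI)
    fix y z assume yz: "y \<in> W" "z \<in> W" "\<pi> y = \<pi> z"
    have "qV (\<pi> u) = u" if "u \<in> W" for u using that L_V by (simp add: \<pi>_def linear_add[OF linear_qV])
    then show "y = z" using yz by metis
  qed
  moreover have "span W = W" using subspace_W by (rule span_eq_iff[THEN iffD2])
  ultimately have "dim (\<pi> ` W) = dim W" using dim_image_eq[OF linear_\<pi>, of W] by metis
  moreover have "\<pi> ` W = P"
  proof (intro set_eqI iffI)
    fix y assume "y \<in> P"
    then have "y = \<pi> (qV y)" using qV_W[of y] by (simp add: P_iff \<pi>_def) (simp add: qV_def)
    then show "y \<in> \<pi> ` W" using qV_W by blast
  qed (use \<pi>_P in blast)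
  ultimately show ?thesis by simp
qed

lemma complement_P: "orthonormal_basis_of I2 b P \<Longrightarrow> complement P b \<pi>"
  unfolding complement_def
proof (intro conjI allI ballI)
  show "\<pi> y = y" if "y \<in> P" for y using that by (simp add: P_iff \<pi>_def) (simp add: qV_def)
  show "y - \<pi> y \<in> V" for y
    using subspace_diff[OF subspace_V pV(1) L_V, of y "qV y"] by (simp add: \<pi>_def qV_def algebra_simps)
  show "\<pi> y = 0" if "y \<in> V" for y using that by (simp add: \<pi>_def linear_0[OF lin_L])
qed (use subspace_P dim_P linear_\<pi> \<pi>_P in auto)

text \<open>The gradients lie in the orthogonal complement of P. With an orthonormal basis a of it,
  \<open>J_H\<close> is the determinant of the gradients against a, the frame volume is that of v
  against a, and the matrix of the gradients against v is the product of the first with the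
  transpose of the second.\<close>

lemma ex_vol_P:
  obtains b where "orthonormal_basis_of I2 b P" "J_V d V f x = J_H d f x * vol (join v b)"
proof -
  define P' where "P' = {y. \<forall>z\<in>P. orthogonal z y}"
  have P': "subspace P'" unfolding P'_def by (rule subspace_orthogonal_to_vectors)
  have "dim P' + dim P = DIM('n heis)"
    using dim_subspace_orthogonal_to_vectors[OF subspace_P subspace_UNIV subset_UNIV] by (simp add: P'_def dim_UNIV)
  then have dim': "dim P' = CARD('k)" using dim_P dim_W_V dimV by simp
  obtain b where b: "orthonormal_basis_of I2 b P"
    using ex_orthonormal_basis[OF subspace_P I_facts(3)] dim_P dim_W by metis
  obtain a where a: "orthonormal_basis_of I1 a P'"
    using ex_orthonormal_basis[OF P' I_facts(2)] dim' card_I1 by metis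
  have ab: "a i \<bullet> b j = 0" if "i \<in> I1" "j \<in> I2" for i j
    using orthonormal_basis_mem[OF a that(1)] orthonormal_basis_mem[OF b that(2)]
    by (simp add: P'_def orthogonal_def inner_commute[of "a i"])
  have on: "join a b i \<bullet> join a b j = (if i = j then 1 else 0)" if ij: "i \<in> I0" "j \<in> I0" for i j
  proof -
    consider "i \<in> I1" "j \<in> I1" | "i \<in> I1" "j \<in> I2" | "i \<in> I2" "j \<in> I1" | "i \<in> I2" "j \<in> I2"
      using ij I_facts(5) by blast
    then show ?thesis
    proof cases
      case 1 then show ?thesis using a by (simp add: join_1 orthonormal_basis_of_def)
    next
      case 2 then show ?thesis using ab I_facts(4) by (auto simp: join_1 join_2)
    next
      case 3 then show ?thesis using ab I_facts(4) by (auto simp: join_1 join_2 inner_commute)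
    next
      case 4 then show ?thesis using b by (simp add: join_2 orthonormal_basis_of_def)
    qed
  qed
  have "z \<in> span (join a b ` I0)" for z
  proof -
    obtain z1 z2 where z: "z1 \<in> span P" "\<And>y. y \<in> span P \<Longrightarrow> orthogonal z2 y" "z = z1 + z2"
      by (rule orthogonal_subspace_decomp_exists[of P z]) (rule that)
    have "z1 \<in> P" using z(1) subspace_P by (simp add: span_eq_iff[THEN iffD2])
    then have "z1 \<in> span (b ` I2)" using b by (simp add: orthonormal_basis_of_def)
    moreover have "z2 \<in> P'" using z(2) by (auto simp: P'_def orthogonal_commute intro: span_base)
    then have "z2 \<in> span (a ` I1)" using a by (simp add: orthonormal_basis_of_def)
    moreover have "b ` I2 \<subseteq> join a b ` I0" "a ` I1 \<subseteq> join a b ` I0"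
      using join_1[of _ a b] join_2[of _ a b] I_facts(5) by force+
    ultimately show ?thesis unfolding z(3) by (intro span_add) (meson span_mono subsetD)+
  qed
  then have onb: "orthonormal_basis_of I0 (join a b) UNIV" using on by (auto simp: orthonormal_basis_of_def)
  obtain h :: "('n bit1) \<Rightarrow> nat" where h: "bij_betw h UNIV I0" using bij_heis_index unfolding I0_def by blast
  have "vol (join v b) = \<bar>leib (I1 \<union> I2) (\<lambda>i j. join v b i \<bullet> join a b j)\<bar>"
    unfolding vol_def by (subst mv_norm_wedge_basis[OF h onb]) (simp_all add: I_facts(5))
  \<comment> \<open>The vectors of b belong to both frames, so only the block of v against a
    remains.\<close>
  also have "leib (I1 \<union> I2) (\<lambda>i j. join v b i \<bullet> join a b j) = leib I1 (\<lambda>i j. join v b i \<bullet> join a b j)"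
  proof (rule leib_block[OF I_facts(2,3,4)])
    fix i j assume ij: "j \<in> I2" "i \<in> I1 \<union> I2"
    have "join v b j = join a b j" using ij(1) by (simp add: join_2)
    then show "join v b j \<bullet> join a b i = (if i = j then 1 else 0)"
      using on[of j i] ij I_facts(5) by auto
  qed
  also have "\<dots> = leib I1 (\<lambda>i j. v i \<bullet> a j)" by (intro leib_cong) (simp add: join_1)
  also have "\<dots> = det (\<chi> i j. v (ek i) \<bullet> a (ek j))"
    using ek by (intro leib_det) (simp add: I1_def)
  finally have vol: "vol (join v b) = \<bar>det (\<chi> i j. v (ek i) \<bullet> a (ek j))\<bar>" .
  have a_ek: "orthonormal_basis_of UNIV (a \<circ> ek) P'"
    using a by (intro orthonormal_basis_ek) (simp add: I1_def)
  have grad': "grad x i \<in> P'" for i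
    unfolding P'_def orthogonal_def P_def by (simp add: inner_commute[of _ "grad x i"] grad_inner[OF x_\<Omega>])
  have JH: "J_H d f x = \<bar>det (\<chi> i j. grad x i \<bullet> a (ek j))\<bar>"
  proof -
    have "J_H d f x = \<bar>leib UNIV (\<lambda>i j. grad x i \<bullet> (a \<circ> ek) j)\<bar>"
      unfolding J_H_def grad_H_eq[OF x_\<Omega>]
      by (rule mv_norm_wedge_basis[OF bij_id[unfolded id_def, simplified] a_ek grad'])
    then show ?thesis by (simp add: leib_det[of "\<lambda>i. i"] bij_betw_def)
  qed
  have "(\<chi> i j. grad x i \<bullet> v (ek j)) = (\<chi> i j. grad x i \<bullet> a (ek j)) ** transpose (\<chi> i j. v (ek i) \<bullet> a (ek j))"
  proof -
    have "grad x i \<bullet> v (ek j) = (\<Sum>l\<in>UNIV. (grad x i \<bullet> a (ek l)) * (v (ek j) \<bullet> a (ek l)))" for i j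
      using orthonormal_basis_inner[OF a_ek finite grad', of i "v (ek j)"]
      by (simp only: comp_def inner_commute[of "v (ek j)"])
    then show ?thesis by (simp only: vec_eq_iff matrix_matrix_mult_def transpose_def vec_lambda_beta) simp
  qed
  then have "J_V d V f x = J_H d f x * vol (join v b)"
    unfolding J_V_eq[OF x_\<Omega>] JH vol by (simp add: det_mul det_transpose abs_mult)
  with b show ?thesis by (rule that)
qed

text \<open>The density in the definition of \<mu>, as a function on the group; by
  \<open>ex_vol_P\<close> its value at x is the reciprocal of the frame volume of P.\<close>

definition \<rho> :: "'n heis \<Rightarrow> real" where "\<rho> y = J_H d f y / J_V d V f y"

lemma J_pos: "0 < J_V d V f x" "0 < J_H d f x" "0 < \<rho> x"
proof -
  show V: "0 < J_V d V f x" using JV x_S by blast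
  obtain b where "J_V d V f x = J_H d f x * vol (join v b)" by (rule ex_vol_P)
  then show H: "0 < J_H d f x" using V vol_nonneg[of "join v b"] by (simp add: zero_less_mult_iff)
  show "0 < \<rho> x" using V H by (simp add: \<rho>_def)
qed

section \<open>Hausdorff measure on the tangent subgroup in graph coordinates\<close>

lemma compact_preimage_g:
  assumes "compact B"
  shows "compact {z\<in>W. g z \<in> B}"
proof -
  have "{z\<in>W. g z \<in> B} = pW ` B \<inter> (W \<inter> g -` B)" by (auto simp: pW_g intro!: image_eqI[of _ pW "g _"])
  moreover have "compact (pW ` B)" using assms by (intro compact_continuous_image continuous_intros continuous_on_pW)
  moreover have "closed (W \<inter> g -` B)"
    by (rule closed_Int[OF closed_subspace[OF subspace_W] closed_vimage[OF compact_imp_closed[OF assms] continuous_on_g]])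
  ultimately show ?thesis by auto
qed

text \<open>As g is not linear, it is realised on slabs by two volume-preserving maps: the linear
  shear \<open>T\<close> along V, then the vertical shear by the quadratic term of the product
  \<open>z L(z)\<close>.\<close>

lemma emeasure_slab_g:
  assumes B: "compact B"
  shows "emeasure lborel (slab \<pi> B) = emeasure lborel (slab qV {z\<in>W. g z \<in> B})"
proof -
  define A where "A = {z\<in>W. g z \<in> B}"
  define T where "T y = y + L (qV y)" for y
  \<comment> \<open>The reflection that fixes W and reverses V; it conjugates \<open>T\<close> to
    its inverse.\<close>
  define R where "R y = y - 2 *\<^sub>R pV y" for y
  define h where "h y = symp (qV y) (L (qV y)) / 2" for y
  have linT: "linear T"
    unfolding T_def[abs_def] by (intro linear_compose_add linear_ident linear_compose[OF linear_qV lin_L, unfolded o_def])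
  have linR: "linear R"
    unfolding R_def[abs_def] by (intro linear_compose_sub linear_ident linear_compose_scale_right linear_pV)
  have qT: "qV (T y) = qV y" "pV (T y) = pV y + L (qV y)" for y
    using L_V by (simp_all add: T_def linear_add[OF linear_qV] linear_add[OF linear_pV])
  have pR: "pV (R y) = - pV y" "qV (R y) = qV y" for y
  proof -
    have "pV (R y) = pV y - 2 *\<^sub>R pV y"
      using pV by (simp add: R_def linear_diff[OF linear_pV] linear_scale[OF linear_pV])
    then show p: "pV (R y) = - pV y" by (simp add: scaleR_2)
    show "qV (R y) = qV y" unfolding qV_def p by (simp add: R_def scaleR_2)
  qed
  have RR: "R (R y) = y" for y using pR(1)[of y] by (simp add: R_def)
  have TRT: "T (R (T y)) = R y" for y
  proof -
    have "T (R (T y)) = R (T y) + L (qV y)" by (simp add: T_def[of "R _"] pR qT)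
    also have "\<dots> = R y" by (simp add: R_def qT) (simp add: T_def algebra_simps scaleR_2)
    finally show ?thesis .
  qed
  have h_vert: "h (y + t *\<^sub>R e_last) = h y" for y t
    by (simp add: h_def qV_vert L_vert) (simp add: symp_def e_last_def)
  have qh: "qV (y + h y *\<^sub>R e_last) = qV y + h y *\<^sub>R e_last" "pV (y + h y *\<^sub>R e_last) = pV y" for y
    using W_e_last by (simp_all add: qV_vert linear_add[OF linear_pV])
  have hT: "h (T y) = h y" for y by (simp add: h_def qT)
  have gz: "g z = z + L z + h z *\<^sub>R e_last" if "z \<in> W" for z
    using that by (simp add: g_def hmul_def h_def)
  have hq: "h (qV y) = h y" for y using qV_W by (simp add: h_def)
  have eq: "slab \<pi> B = (\<lambda>y. y + h y *\<^sub>R e_last) ` T ` slab qV A"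
  proof (intro set_eqI iffI)
    fix y' assume "y' \<in> (\<lambda>y. y + h y *\<^sub>R e_last) ` T ` slab qV A"
    then obtain y where y: "y \<in> slab qV A" "y' = T y + h y *\<^sub>R e_last" by (auto simp: hT)
    have q: "qV y' = qV y + h y *\<^sub>R e_last" "pV y' = pV y + L (qV y)"
      using qh[of "T y"] qT by (simp_all add: y(2) hT)
    have "\<pi> y' = g (qV y)" using gz[OF qV_W[of y]] by (simp add: \<pi>_def q L_vert hq)
    moreover have "y' - \<pi> y' = y - qV y"
    proof -
      have "y' - \<pi> y' = pV y' - L (qV y')" by (simp add: \<pi>_def qV_def)
      then show ?thesis by (simp add: q L_vert) (simp add: qV_def)
    qed
    ultimately show "y' \<in> slab \<pi> B" using y(1) by (simp add: slab_def A_def)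
  next
    fix y' assume y': "y' \<in> slab \<pi> B"
    define y where "y = y' + (- h y') *\<^sub>R e_last - L (qV y')"
    have qy: "qV y = qV y' + (- h y') *\<^sub>R e_last" "pV y = pV y' - L (qV y')"
      using L_V W_e_last[of "- h y'"]
      by (simp_all add: y_def linear_diff[OF linear_qV] linear_diff[OF linear_pV] linear_add[OF linear_pV] qV_vert del: scaleR_minus_left)
    have hy: "h y = h y'"
    proof -
      have "h y = h (qV y)" by (simp add: hq)
      also have "\<dots> = h (qV y')" unfolding qy by (rule h_vert)
      finally show ?thesis by (simp add: hq)
    qed
    have "L (qV y) = L (qV y')" unfolding qy by (rule L_vert)
    then have "T y + h y *\<^sub>R e_last = y'" by (simp add: T_def hy) (simp add: y_def)
    moreover have "g (qV y) = \<pi> y'"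
    proof -
      have "g (qV y) = qV y + L (qV y) + h y *\<^sub>R e_last" using gz[OF qV_W[of y]] by (simp add: hq)
      then show ?thesis using \<open>L (qV y) = L (qV y')\<close> by (simp add: \<pi>_def qy hy)
    qed
    moreover have "y - qV y = y' - \<pi> y'"
    proof -
      have "y - qV y = pV y" by (simp add: qV_def)
      then show ?thesis by (simp add: qy \<pi>_def) (simp add: qV_def)
    qed
    ultimately have "y \<in> slab qV A" "y' = T y + h (T y) *\<^sub>R e_last"
      using y' qV_W by (auto simp: slab_def A_def hT)
    then show "y' \<in> (\<lambda>y. y + h y *\<^sub>R e_last) ` T ` slab qV A" by blast
  qed
  have cA: "compact (slab qV A)" unfolding A_def by (intro compact_slab_W compact_preimage_g B)
  have cT: "compact (T ` slab qV A)" by (intro compact_continuous_image cont_linear linT cA)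
  have "continuous_on UNIV h"
    unfolding h_def[abs_def]
    by (intro continuous_intros cont_linear[OF linear_qV] cont_linear[OF linear_compose[OF linear_qV lin_L, unfolded o_def]]) auto
  moreover have "h (a, b, s) = h (a, b, 0)" for a b s
    using h_vert[of "(a, b, 0)" s] by (simp add: e_last_def)
  ultimately have "emeasure lborel ((\<lambda>y. y + h y *\<^sub>R e_last) ` T ` slab qV A) = emeasure lborel (T ` slab qV A)"
    by (rule emeasure_vertical_shear[OF _ _ cT])
  also have "\<dots> = emeasure lborel (slab qV A)"
    by (rule emeasure_linear_involutive_shear[OF linT linR RR TRT cA])
  finally show ?thesis unfolding eq by (simp add: A_def)
qed

text \<open>The slabs over B and over its preimage in W have equal volume, so the Hausdorff measures
  are inversely proportional to the frame volumes, and \<open>\<rho> x\<close> is the reciprocal of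
  the frame volume of P.\<close>

lemma hausdorff_graph:
  assumes B: "compact B"
  shows "ennreal (vol (join v w) * \<rho> x) * H {z\<in>W. g z \<in> B} = H (P \<inter> B)"
proof -
  obtain b where b: "orthonormal_basis_of I2 b P" "J_V d V f x = J_H d f x * vol (join v b)" by (rule ex_vol_P)
  obtain c where c: "\<And>P p \<pi> A. complement P p \<pi> \<Longrightarrow> A \<in> sets borel \<Longrightarrow>
     H (P \<inter> A) * ennreal (vol (join v p)) = c * emeasure lborel (slab \<pi> A)"
    using ex_hausdorff_slab by blast
  let ?A = "{z\<in>W. g z \<in> B}"
  have "H (W \<inter> ?A) * ennreal (vol (join v w)) = H (P \<inter> B) * ennreal (vol (join v b))"
    using c[OF complement_W borel_compact[OF compact_preimage_g[OF B]]] c[OF complement_P[OF b(1)] borel_compact[OF B]]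
      emeasure_slab_g[OF B] by simp
  moreover have "W \<inter> ?A = ?A" by blast
  ultimately have eq: "H ?A * ennreal (vol (join v w)) = H (P \<inter> B) * ennreal (vol (join v b))" by simp
  have "\<rho> x * vol (join v b) = 1" using b(2) J_pos by (simp add: \<rho>_def field_simps)
  then have one: "ennreal (\<rho> x) * ennreal (vol (join v b)) = 1" using J_pos(3) by (simp flip: ennreal_mult')
  have "ennreal (vol (join v w) * \<rho> x) * H ?A = ennreal (\<rho> x) * (H ?A * ennreal (vol (join v w)))"
    using J_pos(3) vol_nonneg by (simp add: ennreal_mult mult_ac)
  also have "\<dots> = ennreal (\<rho> x) * (H (P \<inter> B) * ennreal (vol (join v b)))" by (simp only: eq)
  also have "\<dots> = (ennreal (\<rho> x) * ennreal (vol (join v b))) * H (P \<inter> B)" by (simp only: mult_ac)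
  finally show ?thesis by (simp add: one)
qed

text \<open>The scaling on P is pulled back to W along g, which commutes with dilations; there
  \<open>hausdorff_translate_dilate\<close> with base point 0 applies.\<close>

lemma hausdorff_hcball_dilate:
  assumes r: "0 < r"
  shows "H (P \<inter> hcball d (hdil r z) (r * s)) = ennreal (r ^ Q) * H (P \<inter> hcball d z s)"
proof -
  have eq: "{y\<in>W. g y \<in> hcball d (hdil r z) (r * s)} = (\<lambda>y. sigma_tr W V 0 (hdil r y)) ` {y\<in>W. g y \<in> hcball d z s}"
  proof -
    have s0: "sigma_tr W V 0 y = y" for y by (simp add: sigma_tr_def proj_V_eq hinv_eq linear_0[OF linear_pV])
    have mem: "g (hdil r y) \<in> hcball d (hdil r z) (r * s) \<longleftrightarrow> g y \<in> hcball d z s" for y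
      using r by (simp add: g_hdil hcball_def d_dil)
    have "y \<in> hdil r ` {y\<in>W. g y \<in> hcball d z s}" if "y \<in> W" "g y \<in> hcball d (hdil r z) (r * s)" for y
    proof (rule image_eqI[of _ _ "hdil (1 / r) y"])
      show y: "y = hdil r (hdil (1 / r) y)" using r hdil_inverse(2)[of r y] by simp
      show "hdil (1 / r) y \<in> {y\<in>W. g y \<in> hcball d z s}"
        using that W_hdil mem[of "hdil (1 / r) y"] by (simp flip: y)
    qed
    then show ?thesis unfolding s0 using W_hdil mem by blast
  qed
  have "H {y\<in>W. g y \<in> hcball d (hdil r z) (r * s)} = ennreal (r ^ Q) * H {y\<in>W. g y \<in> hcball d z s}"
    unfolding eq by (rule hausdorff_translate_dilate[OF r compact_preimage_g[OF compact_hcball]]) auto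
  then show ?thesis
    unfolding hausdorff_graph[OF compact_hcball, symmetric] by (simp add: mult.left_commute)
qed

end

context homdist begin

lemma tendsto_dI: "((\<lambda>h. d z (Y h)) \<longlongrightarrow> 0) F \<Longrightarrow> (Y \<longlongrightarrow> z) F"
proof (rule topological_tendstoI)
  fix A assume lim: "((\<lambda>h. d z (Y h)) \<longlongrightarrow> 0) F" and A: "open A" "z \<in> A"
  from d_small[OF A] obtain \<delta> where \<delta>: "0 < \<delta>" "\<And>y. d z y < \<delta> \<Longrightarrow> y \<in> A" by blast
  from order_tendstoD(2)[OF lim \<delta>(1)] show "\<forall>\<^sub>F h in F. Y h \<in> A"
    by (rule eventually_mono) (rule \<delta>(2))
qed

text \<open>N is proportional to the parameter along a horizontal line through 0, so the two ends of
  a horizontal diameter have distance exactly \<open>2 * r\<close>.\<close>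

lemma hdiam_hcball:
  assumes r: "0 < r"
  shows "hdiam d (hcball d y r) = 2 * r"
proof -
  define e :: "'n heis" where "e = (axis undefined 1, 0, 0)"
  have e: "e \<in> H1" "e \<noteq> 0" by (auto simp: e_def H1_def prod_eq_iff axis_eq_0_iff)
  define X where "X = (r / N e) *\<^sub>R e"
  have X: "X \<in> H1" "N X = r" using e r by (auto simp: X_def H1_scaleR N_scaleR)
  define a where "a = hmul y X"
  define b where "b = hmul y (- X)"
  have "d a b = N (hmul ((-1) *\<^sub>R X) ((-1) *\<^sub>R X))" by (simp add: a_def b_def d_N[of X])
  also have "\<dots> = N ((-2) *\<^sub>R X)" by (subst hmul_scaleR[OF X(1)]) simp
  also have "\<dots> = 2 * r" by (subst N_scaleR[OF X(1)]) (simp add: X(2))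
  finally have ab: "d a b = 2 * r" .
  have mem: "a \<in> hcball d y r" "b \<in> hcball d y r" using X by (simp_all add: a_def b_def hcball_def d_hmul_right)
  have "(SUP (x, y)\<in>hcball d y r \<times> hcball d y r. d x y) = 2 * r"
  proof (rule cSup_eq_maximum)
    show "2 * r \<in> (\<lambda>(x, y). d x y) ` (hcball d y r \<times> hcball d y r)"
      using mem ab by (intro image_eqI[of _ _ "(a, b)"]) auto
    fix t assume "t \<in> (\<lambda>(x, y). d x y) ` (hcball d y r \<times> hcball d y r)"
    then obtain p q where pq: "t = d p q" "d y p \<le> r" "d y q \<le> r" by (auto simp: hcball_def)
    then show "t \<le> 2 * r" using d_tri[of p q y] by (simp add: d_sym)
  qed
  then show ?thesis by (simp add: hdiam_def)
qed

end

context blow_up begin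

text \<open>Coordinates on W around w0 at scale r; the origin corresponds to w0.\<close>

definition \<tau> :: "real \<Rightarrow> 'n heis \<Rightarrow> 'n heis" where
  "\<tau> r z = sigma_tr W V x (hdil r z)"

lemma \<tau>_eq: "\<tau> r z = hmul (hmul x (hdil r z)) (- \<phi> w0)"
  by (simp add: \<tau>_def sigma_tr_def proj_V_eq hinv_eq pV_x)

lemma \<tau>_W: "z \<in> W \<Longrightarrow> \<tau> r z \<in> W"
  by (simp add: W_iff \<tau>_eq pV_hmul pV_hdil pV_x pV_uminus pV_V \<phi>_V[OF w0])

text \<open>In the coordinates \<tau> the rescaled graph converges to the graph of L, uniformly on
  bounded sets. By left invariance the distance equals that between L and the increment of \<phi>,
  which the intrinsic differential makes a small multiple of the size of
  \<open>hdil r z\<close>.\<close>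

lemma blow:
  assumes "0 < \<eta>" "0 \<le> R"
  shows "\<exists>r0>0. \<forall>r z. 0 < r \<longrightarrow> r < r0 \<longrightarrow> z \<in> W \<longrightarrow> N z \<le> R \<longrightarrow>
    \<tau> r z \<in> U \<and> d (hmul (- x) (\<Phi> (\<tau> r z))) (hdil r (g z)) \<le> \<eta> * r"
proof -
  have "0 < \<eta> / (R + 1)" using assms by simp
  from L_est[OF this] obtain \<delta> where \<delta>: "0 < \<delta>" "\<And>u z. u \<in> U \<Longrightarrow> z = hmul (hmul (- \<Phi> w0) u) (\<phi> w0) \<Longrightarrow> N z < \<delta> \<Longrightarrow>
      d (L z) (\<phi> u - \<phi> w0) \<le> \<eta> / (R + 1) * N z" using w0 by (metis d_refl)
  from graph_local[OF w0 open_UNIV UNIV_I] obtain \<eta>' where \<eta>': "0 < \<eta>'"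
    "\<And>u. u \<in> W \<Longrightarrow> norm (u - w0) < \<eta>' \<Longrightarrow> u \<in> U" by blast
  define F where "F q = hmul (hmul x q) (- \<phi> w0)" for q
  have "continuous_on UNIV F" unfolding F_def by (intro continuous_intros)
  then have "open (F -` ball w0 \<eta>')" by (intro open_vimage) auto
  moreover have "0 \<in> F -` ball w0 \<eta>'" using \<eta>'(1) by (simp add: F_def x_def hmul_assoc)
  ultimately obtain \<delta>' where \<delta>': "0 < \<delta>'" "\<And>q. d 0 q < \<delta>' \<Longrightarrow> q \<in> F -` ball w0 \<eta>'"
    using d_small by blast
  define r0 where "r0 = min \<delta> \<delta>' / (R + 1)"
  have r0: "0 < r0" using \<delta> \<delta>' assms by (simp add: r0_def)
  have "\<tau> r z \<in> U \<and> d (hmul (- x) (\<Phi> (\<tau> r z))) (hdil r (g z)) \<le> \<eta> * r"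
    if r: "0 < r" "r < r0" and z: "z \<in> W" "N z \<le> R" for r z
  proof -
    define \<zeta> where "\<zeta> = hdil r z"
    define u where "u = \<tau> r z"
    have N\<zeta>: "N \<zeta> = r * N z" using r by (simp add: \<zeta>_def N_dil)
    have "r * N z \<le> r * (R + 1)" using r z by (intro mult_left_mono) auto
    also have "\<dots> < r0 * (R + 1)" using r assms by (intro mult_strict_right_mono) auto
    also have "\<dots> = min \<delta> \<delta>'" using assms by (simp add: r0_def)
    finally have small: "N \<zeta> < \<delta>" "N \<zeta> < \<delta>'" by (auto simp: N\<zeta>)
    have "d 0 \<zeta> < \<delta>'" using small(2) by (simp add: hnorm_def d_sym)
    from \<delta>'(2)[OF this] have "norm (u - w0) < \<eta>'"
      by (simp add: F_def u_def \<tau>_eq \<zeta>_def dist_norm norm_minus_commute)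
    then have uU: "u \<in> U" using \<eta>'(2) \<tau>_W[OF z(1)] by (simp add: u_def)
    have \<zeta>: "\<zeta> = hmul (hmul (- \<Phi> w0) u) (\<phi> w0)"
      by (simp add: u_def \<tau>_eq \<zeta>_def hmul_assoc flip: x_def)
    have est: "d (L \<zeta>) (\<phi> u - \<phi> w0) \<le> \<eta> / (R + 1) * N \<zeta>"
      by (rule \<delta>(2)[OF uU \<zeta> small(1)])
    have "- \<phi> w0 \<in> V" using subspace_neg[OF subspace_V \<phi>_V[OF w0]] .
    then have "\<phi> u - \<phi> w0 = hmul (- \<phi> w0) (\<phi> u)" using V_hmul[OF _ \<phi>_V[OF uU]] by simp
    then have "hmul (- x) (\<Phi> u) = hmul \<zeta> (\<phi> u - \<phi> w0)"
      by (simp add: u_def \<tau>_eq \<zeta>_def hmul_assoc)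
    moreover have "hdil r (g z) = hmul \<zeta> (L \<zeta>)" using g_hdil[OF r(1), of z] by (simp add: g_def \<zeta>_def)
    ultimately have "d (hmul (- x) (\<Phi> u)) (hdil r (g z)) = d (L \<zeta>) (\<phi> u - \<phi> w0)" by (simp add: d_sym)
    also note est
    also have "\<eta> / (R + 1) * N \<zeta> \<le> \<eta> / (R + 1) * (r * (R + 1))"
      unfolding N\<zeta> using r z assms by (intro mult_left_mono) auto
    also have "\<dots> = \<eta> * r" using assms by simp
    finally show ?thesis using uU by (simp add: u_def)
  qed
  then show ?thesis using r0 by blast
qed

text \<open>A limit of rescaled surface points lies in the kernel because f is constant on S, so
  strict differentiability gives \<open>norm (D x z) \<le> \<epsilon> * N z\<close> for every
  \<epsilon>. Conversely, z in P is approached by the surface points over the coordinates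
  \<open>\<tau> s q\<close>, with q the W-factor of z.\<close>

lemma Tan_eq: "Tan S x = P"
proof (intro set_eqI iffI)
  fix z assume "z \<in> Tan S x"
  then obtain r X where r: "\<And>h. 0 < r h" and X: "\<And>h. X h \<in> S" "X \<longlonglongrightarrow> x"
    and lim: "(\<lambda>h::nat. hdil (r h) (hmul (hinv x) (X h))) \<longlonglongrightarrow> z"
    unfolding Tan_def by blast
  define Y where "Y h = hdil (r h) (hmul (- x) (X h))" for h
  have Y: "Y \<longlonglongrightarrow> z" using lim by (simp add: Y_def[abs_def] hinv_eq)
  have DY: "(\<lambda>h. norm (D x (Y h))) \<longlonglongrightarrow> norm (D x z)"
    by (intro tendsto_norm bounded_linear.tendsto[OF lin_D[OF x_\<Omega>, unfolded linear_conv_bounded_linear] Y])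
  have le: "norm (D x z) \<le> \<epsilon> * N z" if \<epsilon>: "0 < \<epsilon>" for \<epsilon>
  proof -
    obtain \<delta> where \<delta>: "0 < \<delta>" "\<And>y. d x y < \<delta> \<Longrightarrow> y \<in> \<Omega>"
      "\<And>y z. d x y < \<delta> \<Longrightarrow> d x z < \<delta> \<Longrightarrow> norm (f z - f y - D x (hmul (- y) z)) \<le> \<epsilon> * d y z"
      by (rule strict[OF x_\<Omega> \<epsilon>]) (rule that)
    have "(\<lambda>h. d x (X h)) \<longlonglongrightarrow> d x x" by (rule tendsto_d[OF tendsto_const X(2)])
    then have "\<forall>\<^sub>F h in sequentially. d x (X h) < \<delta>" using \<delta>(1) by (intro order_tendstoD(2)) auto
    moreover have "norm (D x (Y h)) \<le> \<epsilon> * N (Y h)" if h: "d x (X h) < \<delta>" for h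
    proof -
      have "f (X h) = f x" using X(1)[of h] x_S by (simp add: S)
      then have "norm (D x (hmul (- x) (X h))) \<le> \<epsilon> * N (hmul (- x) (X h))"
        using \<delta>(3)[OF _ h, of x] \<delta>(1) by (simp add: d_N[of x])
      then have "r h * norm (D x (hmul (- x) (X h))) \<le> r h * (\<epsilon> * N (hmul (- x) (X h)))"
        using r[of h] by (intro mult_left_mono) auto
      moreover have "D x (Y h) = r h *\<^sub>R D x (hmul (- x) (X h))"
        using hom_D[OF x_\<Omega>] r[of h] by (simp add: Y_def h_hom_def)
      moreover have "N (Y h) = r h * N (hmul (- x) (X h))" using r[of h] by (simp add: Y_def N_dil)
      ultimately show ?thesis using r[of h] by (simp add: mult.left_commute)
    qed
    ultimately have "\<forall>\<^sub>F h in sequentially. norm (D x (Y h)) \<le> \<epsilon> * N (Y h)"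
      by (rule eventually_mono)
    moreover have "(\<lambda>h. \<epsilon> * N (Y h)) \<longlonglongrightarrow> \<epsilon> * N z" by (intro tendsto_mult tendsto_const tendsto_N Y)
    ultimately show ?thesis using tendsto_le[OF sequentially_bot _ DY] by blast
  qed
  have "norm (D x z) \<le> 0"
  proof (rule field_le_epsilon)
    fix e :: real assume "0 < e"
    then have "norm (D x z) \<le> e / (N z + 1) * N z" by (intro le) (simp add: add_nonneg_pos)
    also have "\<dots> \<le> e / (N z + 1) * (N z + 1)" using \<open>0 < e\<close> by (intro mult_left_mono) (auto simp: add_nonneg_nonneg)
    also have "\<dots> = e" using N_nonneg[of z] by (simp add: add_nonneg_eq_0_iff)
    finally show "norm (D x z) \<le> 0 + e" by simp
  qed
  then show "z \<in> P" by (simp add: P_def)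
next
  fix z assume z: "z \<in> P"
  define q where "q = pW z"
  have q: "q \<in> W" "g q = z" using g_pW[OF z] pW_W by (auto simp: q_def)
  from blow[OF zero_less_one N_nonneg[of q]] obtain r0 where r0: "0 < r0"
    "\<And>r. 0 < r \<Longrightarrow> r < r0 \<Longrightarrow> \<tau> r q \<in> U" using q(1) by (metis order_refl)
  obtain h0 where h0: "1 / r0 < real h0" using reals_Archimedean2 by blast
  define s where "s h = 1 / real (Suc (h + h0))" for h
  have s: "0 < s h" "s h < r0" for h
  proof -
    have "1 / r0 < real (Suc (h + h0))" using h0 by simp
    then show "s h < r0" using r0(1) by (simp add: s_def field_simps)
  qed (simp add: s_def)
  have s_lim: "s \<longlonglongrightarrow> 0"
    unfolding s_def[abs_def] using LIMSEQ_ignore_initial_segment[OF LIMSEQ_Suc[OF lim_1_over_n], of h0] by simp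
  define X where "X h = \<Phi> (\<tau> (s h) q)" for h
  define Y where "Y h = hdil (1 / s h) (hmul (- x) (X h))" for h
  have "(\<lambda>h. d z (Y h)) \<longlonglongrightarrow> 0"
  proof (rule tendstoI)
    fix e :: real assume "0 < e"
    then have "0 < e / 2" by simp
    from blow[OF this N_nonneg[of q]] obtain r1 where r1: "0 < r1"
      "\<And>r. 0 < r \<Longrightarrow> r < r1 \<Longrightarrow> d (hmul (- x) (\<Phi> (\<tau> r q))) (hdil r (g q)) \<le> e / 2 * r" using q(1) by (metis order_refl)
    have "\<forall>\<^sub>F h in sequentially. s h < r1" using order_tendstoD(2)[OF s_lim r1(1)] .
    then show "\<forall>\<^sub>F h in sequentially. dist (d z (Y h)) 0 < e"
    proof (rule eventually_mono)
      fix h assume "s h < r1"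
      from r1(2)[OF s(1) this] have *: "d (hmul (- x) (X h)) (hdil (s h) z) \<le> e / 2 * s h"
        by (simp add: X_def q)
      have "d (Y h) z = d (Y h) (hdil (1 / s h) (hdil (s h) z))" using s(1)[of h] by (simp add: hdil_hdil)
      also have "\<dots> = (1 / s h) * d (hmul (- x) (X h)) (hdil (s h) z)"
        unfolding Y_def using s(1)[of h] by (intro d_dil) simp
      also have "\<dots> \<le> (1 / s h) * (e / 2 * s h)" using * s(1)[of h] by (intro mult_left_mono) auto
      also have "\<dots> = e / 2" using s(1)[of h] by simp
      finally show "dist (d z (Y h)) 0 < e" using \<open>0 < e\<close> by (simp add: d_sym)
    qed
  qed
  then have Y: "Y \<longlonglongrightarrow> z" by (rule tendsto_dI)
  have X: "X h = hmul x (hdil (s h) (Y h))" for h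
    using s(1)[of h] by (simp add: Y_def hdil_hdil)
  have "(\<lambda>h. hmul x (hdil (s h) (Y h))) \<longlonglongrightarrow> hmul x (hdil 0 z)"
    by (intro tendsto_hmul tendsto_hdil tendsto_const s_lim Y)
  then have "X \<longlonglongrightarrow> x" unfolding X[symmetric] by simp
  moreover have "X h \<in> S" for h using \<Phi>_S(1)[OF r0(2)[OF s]] by (simp add: X_def)
  ultimately show "z \<in> Tan S x"
    unfolding Tan_def using s(1) Y
    by (intro CollectI exI[of _ "\<lambda>h. 1 / s h"] exI[of _ X]) (simp add: Y_def[abs_def] hinv_eq)
qed

section \<open>Attainment of the spherical factor\<close>

lemma borel_P_hcball: "P \<inter> hcball d z s \<in> sets borel"
  by (intro borel_closed closed_Int closed_subspace subspace_P compact_imp_closed compact_hcball)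

lemma H_hcball_finite: "H (P \<inter> hcball d z s) < top"
proof -
  obtain r where r: "\<And>y. y \<in> hcball d z s \<Longrightarrow> norm y \<le> r"
    using compact_imp_bounded[OF compact_hcball[of z s]] unfolding bounded_iff by blast
  then have "hcball d z s \<subseteq> cball 0 r" by (auto simp: subset_eq)
  then have "hausdorff_outer (dim W) (P \<inter> hcball d z s) \<le> hausdorff_outer (dim P) (P \<inter> cball 0 r)"
    unfolding dim_P by (intro hausdorff_outer_mono) auto
  also have "\<dots> < top" by (rule hausdorff_outer_subspace_finite[OF subspace_P])
  finally show ?thesis by (simp add: emeasure_hausdorff_measure borel_P_hcball)
qed

text \<open>Closed balls about z with radii decreasing to 1 intersect in the unit ball, and each
  contains all unit balls with centre close to z; continuity from above gives upper
  semicontinuity.\<close>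

lemma H_hcball_usc:
  assumes "H (P \<inter> hcball d z 1) < c"
  shows "\<exists>\<delta>>0. \<forall>y. d z y < \<delta> \<longrightarrow> H (P \<inter> hcball d y 1) < c"
proof -
  define A where "A i = P \<inter> hcball d z (1 + 1 / real (Suc i))" for i
  have "range A \<subseteq> sets (hausdorff_measure (dim W))"
    unfolding A_def by (intro image_subsetI) (simp add: borel_P_hcball)
  moreover have "decseq A"
    unfolding A_def decseq_def hcball_def by (auto intro: order_trans simp: frac_le)
  moreover have "H (A i) \<noteq> \<infinity>" for i using H_hcball_finite by (auto simp: A_def less_top)
  ultimately have "(INF i. H (A i)) = H (\<Inter>i. A i)" by (rule INF_emeasure_decseq)
  also have "(\<Inter>i. A i) = P \<inter> hcball d z 1"
  proof -
    have "d z y \<le> 1" if "\<And>i. d z y \<le> 1 + 1 / real (Suc i)" for y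
    proof (rule field_le_epsilon)
      fix e :: real assume "0 < e"
      then obtain i where "inverse (real (Suc i)) < e" using reals_Archimedean by blast
      then show "d z y \<le> 1 + e" using that[of i] by (simp add: inverse_eq_divide)
    qed
    then show ?thesis by (auto simp: A_def hcball_def intro: add_increasing2)
  qed
  finally have "(INF i. H (A i)) < c" using assms by simp
  then obtain i where i: "H (A i) < c" by (auto simp: INF_less_iff)
  have "H (P \<inter> hcball d y 1) < c" if "d z y < 1 / real (Suc i)" for y
  proof -
    have "hcball d y 1 \<subseteq> hcball d z (1 + 1 / real (Suc i))"
    proof
      fix a assume "a \<in> hcball d y 1"
      then show "a \<in> hcball d z (1 + 1 / real (Suc i))" using that d_tri[of z a y] by (simp add: hcball_def)
    qed
    then have "H (P \<inter> hcball d y 1) \<le> H (A i)"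
      unfolding A_def by (intro emeasure_mono) (auto simp: borel_P_hcball)
    then show ?thesis using i by (rule le_less_trans)
  qed
  then show ?thesis by (intro exI[of _ "1 / real (Suc i)"]) auto
qed

text \<open>An upper semicontinuous function attains its maximum on a compact set, here by
  contradiction through a finite subcover. Attainment matters because
  \<open>spherical_factor\<close> is defined by \<open>GREATEST\<close>.\<close>

lemma ex_maximal_hcball:
  "\<exists>z\<in>hcball d 0 1. \<forall>y\<in>hcball d 0 1. H (P \<inter> hcball d y 1) \<le> H (P \<inter> hcball d z 1)"
proof (rule ccontr)
  define G where "G y = H (P \<inter> hcball d y 1)" for y
  assume "\<not> ?thesis"
  then have "\<forall>z\<in>hcball d 0 1. \<exists>y\<in>hcball d 0 1. G z < G y" by (auto simp: G_def not_le)
  then obtain b where b: "\<And>z. z \<in> hcball d 0 1 \<Longrightarrow> b z \<in> hcball d 0 1 \<and> G z < G (b z)" by metis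
  have "\<exists>\<delta>>0. \<forall>y. d z y < \<delta> \<longrightarrow> G y < G (b z)" if "z \<in> hcball d 0 1" for z
    using H_hcball_usc b[OF that] by (simp add: G_def)
  then obtain \<delta> where \<delta>: "\<And>z. z \<in> hcball d 0 1 \<Longrightarrow> \<delta> z > 0 \<and> (\<forall>y. d z y < \<delta> z \<longrightarrow> G y < G (b z))" by metis
  have "hcball d 0 1 \<subseteq> (\<Union>z\<in>hcball d 0 1. {y. d z y < \<delta> z})" using \<delta> by force
  then obtain C where C: "C \<subseteq> hcball d 0 1" "finite C" "hcball d 0 1 \<subseteq> (\<Union>z\<in>C. {y. d z y < \<delta> z})"
    by (rule compactE_image[OF compact_hcball open_d_ball])
  have "0 \<in> hcball d 0 1" by (simp add: hcball_def)
  then have "C \<noteq> {}" using C(3) by auto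
  then have "Max ((\<lambda>y. G (b y)) ` C) \<in> (\<lambda>y. G (b y)) ` C" using C(2) by (intro Max_in) auto
  then obtain z where "z \<in> C" "G (b z) = Max ((\<lambda>y. G (b y)) ` C)" by (metis imageE)
  moreover have "G (b y) \<le> Max ((\<lambda>y. G (b y)) ` C)" if "y \<in> C" for y using C(2) that by (intro Max_ge) auto
  ultimately have z: "z \<in> C" "\<And>y. y \<in> C \<Longrightarrow> G (b y) \<le> G (b z)" by auto
  have "b z \<in> hcball d 0 1" using b z(1) C(1) by blast
  then obtain y where "y \<in> C" "d y (b z) < \<delta> y" using C(3) by blast
  then have "G (b z) < G (b y)" using \<delta> C(1) by blast
  then show False using z(2)[OF \<open>y \<in> C\<close>] by simp
qed

lemma spherical_factor_P:
  assumes z: "z \<in> hcball d 0 1" and max: "\<And>y. y \<in> hcball d 0 1 \<Longrightarrow> H (P \<inter> hcball d y 1) \<le> H (P \<inter> hcball d z 1)"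
  shows "spherical_factor d P = H (P \<inter> hcball d z 1)"
  unfolding spherical_factor_def dim_P
  by (rule Greatest_equality) (use z max in auto)

section \<open>Measure of small balls that contain x, and the density\<close>

lemma ex_bound_pW: "\<exists>R\<ge>0. \<forall>q. N q \<le> 2 \<longrightarrow> N (pW q) \<le> R"
proof -
  have "compact ((\<lambda>q. N (pW q)) ` hcball d 0 2)"
    by (intro compact_continuous_image compact_hcball continuous_on_N continuous_on_pW continuous_on_id)
  then have "bounded ((\<lambda>q. N (pW q)) ` hcball d 0 2)" by (rule compact_imp_bounded)
  then obtain R where "\<forall>a\<in>(\<lambda>q. N (pW q)) ` hcball d 0 2. norm a \<le> R" unfolding bounded_iff by blast
  then have R: "norm (N (pW q)) \<le> R" if "q \<in> hcball d 0 2" for q using that by blast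
  have "N (pW q) \<le> max R 0" if "N q \<le> 2" for q
    using R[of q] that by (simp add: hcball_def hnorm_def d_sym)
  then show ?thesis by (intro exI[of _ "max R 0"]) auto
qed

text \<open>After rescaling, surface points lie within \<eta> of the points of P with the same
  coordinates, so the radii change by at most \<eta>. The threshold \<open>r0\<close> does not
  depend on the centre y, because all rescaled centres lie in the unit ball.\<close>

lemma graph_in_ball:
  assumes \<eta>: "0 < \<eta>"
  shows "\<exists>r0>0. \<forall>r y. 0 < r \<longrightarrow> r < r0 \<longrightarrow> d y x \<le> r \<longrightarrow>
    (\<forall>n\<in>U. \<Phi> n \<in> hcball d y r \<longrightarrow> \<bar>\<rho> (\<Phi> n) - \<rho> x\<bar> < \<eta> * \<rho> x) \<and>
    {n\<in>U. \<Phi> n \<in> hcball d y r} \<subseteq> \<tau> r ` {z\<in>W. g z \<in> hcball d (hdil (1 / r) (hmul (- x) y)) (1 + \<eta>)} \<and>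
    \<tau> r ` {z\<in>W. g z \<in> hcball d (hdil (1 / r) (hmul (- x) y)) (1 - \<eta>)} \<subseteq> {n\<in>U. \<Phi> n \<in> hcball d y r}"
proof -
  \<comment> \<open>A unit ball with centre in the unit ball stays within distance 2 of the origin;
    R bounds the W-coordinates of its points.\<close>
  obtain R where R: "0 \<le> R" "\<And>q. N q \<le> 2 \<Longrightarrow> N (pW q) \<le> R" using ex_bound_pW by blast
  from blow[OF \<eta> R(1)] obtain r1 where r1: "0 < r1" "\<And>r z. 0 < r \<Longrightarrow> r < r1 \<Longrightarrow> z \<in> W \<Longrightarrow> N z \<le> R \<Longrightarrow>
    \<tau> r z \<in> U \<and> d (hmul (- x) (\<Phi> (\<tau> r z))) (hdil r (g z)) \<le> \<eta> * r" by blast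
  have "0 < \<eta> * \<rho> x" using \<eta> J_pos by simp
  from ratio_continuous[OF x_S this] obtain \<delta> where \<delta>: "0 < \<delta>"
    "\<And>y. d x y < \<delta> \<Longrightarrow> \<bar>\<rho> y - \<rho> x\<bar> < \<eta> * \<rho> x" unfolding \<rho>_def by blast
  define r0 where "r0 = min r1 (\<delta> / 2)"
  show ?thesis
  proof (intro exI[of _ r0] conjI allI impI ballI subsetI)
    show "0 < r0" using r1 \<delta> by (simp add: r0_def)
    fix r y assume r: "0 < r" "r < r0" and y: "d y x \<le> r"
    define z0 where "z0 = hdil (1 / r) (hmul (- x) y)"
    have y_z0: "hmul (- x) y = hdil r z0" using r by (simp add: z0_def hdil_hdil)
    have Nz0: "N z0 \<le> 1" using y r by (simp add: z0_def N_dil d_sym flip: d_N)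
    have dil: "d z0 (g z) = (1 / r) * d (hmul (- x) y) (hdil r (g z))" for z
      unfolding y_z0 using r d_dil[OF r(1)] by simp
    have near: "d x (\<Phi> n) \<le> 2 * r" if "\<Phi> n \<in> hcball d y r" for n
      using that y d_tri[of x "\<Phi> n" y] by (simp add: hcball_def d_sym)
    show "\<bar>\<rho> (\<Phi> n) - \<rho> x\<bar> < \<eta> * \<rho> x" if "\<Phi> n \<in> hcball d y r" for n
      using near[OF that] r by (intro \<delta>(2)) (simp add: r0_def)
    show "n \<in> \<tau> r ` {z\<in>W. g z \<in> hcball d (hdil (1 / r) (hmul (- x) y)) (1 + \<eta>)}"
      if "n \<in> {n\<in>U. \<Phi> n \<in> hcball d y r}" for n
    proof -
      have n: "n \<in> U" "\<Phi> n \<in> hcball d y r" using that by auto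
      \<comment> \<open>The rescaled surface point; its W-factor is the coordinate z with
        \<open>\<tau> r z = n\<close>.\<close>
      define q where "q = hdil (1 / r) (hmul (- x) (\<Phi> n))"
      define z where "z = pW q"
      have "N q = (1 / r) * d x (\<Phi> n)" using r by (simp add: q_def N_dil flip: d_N)
      also have "\<dots> \<le> 2" using near[OF n(2)] r by (simp add: field_simps)
      finally have z: "z \<in> W" "N z \<le> R" using R(2) pW_W by (auto simp: z_def)
      have pVq: "pV q = hdil (1 / r) (\<phi> n - \<phi> w0)"
        using n(1) hdil_H1[OF V_H1[OF subspace_diff[OF subspace_V \<phi>_V[OF n(1)] \<phi>_V[OF w0]]], of "1 / r"]
        by (simp add: q_def pV_hdil pV_hmul[of "- x"] pV_uminus pV_x)
      have "hdil r z = hmul (hdil r q) (- (\<phi> n - \<phi> w0))"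
        using r by (simp add: z_def pW_def hdil_hmul hdil_uminus pVq hdil_hdil)
      also have "\<dots> = hmul (hmul (- x) (\<Phi> n)) (hmul (- \<phi> n) (\<phi> w0))"
        using r V_hmul[OF subspace_neg[OF subspace_V \<phi>_V[OF n(1)]] \<phi>_V[OF w0]] by (simp add: q_def hdil_hdil)
      also have "\<dots> = hmul (hmul (- x) n) (\<phi> w0)" by (simp add: hmul_assoc)
      finally have \<tau>z: "\<tau> r z = n" by (simp add: \<tau>_eq hmul_assoc)
      have "d (hmul (- x) y) (hdil r (g z)) \<le> d (hmul (- x) y) (hmul (- x) (\<Phi> n)) + d (hmul (- x) (\<Phi> n)) (hdil r (g z))"
        by (rule d_tri)
      also have "\<dots> \<le> r + \<eta> * r"
        using r1(2)[OF r(1) _ z] r n(2) by (intro add_mono) (auto simp: \<tau>z r0_def hcball_def)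
      finally have "d z0 (g z) \<le> (1 / r) * (r + \<eta> * r)" unfolding dil using r by (intro mult_left_mono) auto
      also have "\<dots> = 1 + \<eta>" using r by (simp add: field_simps)
      finally show ?thesis using z \<tau>z by (auto simp: hcball_def z0_def)
    qed
    show "n \<in> {n\<in>U. \<Phi> n \<in> hcball d y r}"
      if n: "n \<in> \<tau> r ` {z\<in>W. g z \<in> hcball d (hdil (1 / r) (hmul (- x) y)) (1 - \<eta>)}" for n
    proof -
      obtain z where z: "z \<in> W" "d z0 (g z) \<le> 1 - \<eta>" "n = \<tau> r z" using n by (auto simp: hcball_def z0_def)
      have "N (g z) \<le> N z0 + d z0 (g z)" using d_tri[of 0 "g z" z0] by (simp add: hnorm_def d_sym)
      also have "\<dots> \<le> 2" using Nz0 z(2) \<eta> by simp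
      finally have "N z \<le> R" using R(2)[of "g z"] pW_g[OF z(1)] by simp
      then have *: "n \<in> U" "d (hmul (- x) (\<Phi> n)) (hdil r (g z)) \<le> \<eta> * r"
        using r1(2)[OF r(1) _ z(1)] r z(3) by (auto simp: r0_def)
      have "d (hmul (- x) y) (hdil r (g z)) = r * d z0 (g z)" using r by (simp add: dil)
      also have "\<dots> \<le> r * (1 - \<eta>)" using z(2) r by (intro mult_left_mono) auto
      finally have "d (hmul (- x) y) (hdil r (g z)) \<le> r * (1 - \<eta>)" .
      then have "d (hmul (- x) y) (hmul (- x) (\<Phi> n)) \<le> r * (1 - \<eta>) + \<eta> * r"
        using d_tri[of "hmul (- x) y" "hmul (- x) (\<Phi> n)" "hdil r (g z)"] *(2) by (simp add: d_sym del: d_left)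
      then have "d y (\<Phi> n) \<le> r" by (simp add: algebra_simps)
      then show ?thesis using *(1) by (simp add: hcball_def)
    qed
  qed
qed

text \<open>The integrand is within a relative error \<eta> of its value at x, and the domain lies
  between two images under \<tau> of known measure. The factor
  \<open>vol (join v w) * \<rho> x\<close> then converts measure in W into measure in P.\<close>

lemma measure_window:
  assumes \<mu>: "\<And>B. B \<in> sets borel \<Longrightarrow> \<mu> B = ennreal (vol (join v w)) *
      (\<integral>\<^sup>+n\<in>{n\<in>U. \<Phi> n \<in> B}. ennreal (J_H d f (\<Phi> n) / J_V d V f (\<Phi> n)) \<partial>hausdorff_measure (dim W))"
    and \<eta>: "0 < \<eta>" "\<eta> < 1"
  shows "\<exists>r0>0. \<forall>r y. 0 < r \<longrightarrow> r < r0 \<longrightarrow> d y x \<le> r \<longrightarrow>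
    \<mu> (hcball d y r) \<le> ennreal (1 + \<eta>) * H (P \<inter> hcball d (hdil (1 / r) (hmul (- x) y)) (1 + \<eta>)) * ennreal (r ^ Q) \<and>
    ennreal (1 - \<eta>) * H (P \<inter> hcball d (hdil (1 / r) (hmul (- x) y)) (1 - \<eta>)) * ennreal (r ^ Q) \<le> \<mu> (hcball d y r)"
proof -
  obtain r0 where r0: "0 < r0" "\<And>r y. 0 < r \<Longrightarrow> r < r0 \<Longrightarrow> d y x \<le> r \<Longrightarrow>
    (\<forall>n\<in>U. \<Phi> n \<in> hcball d y r \<longrightarrow> \<bar>\<rho> (\<Phi> n) - \<rho> x\<bar> < \<eta> * \<rho> x) \<and>
    {n\<in>U. \<Phi> n \<in> hcball d y r} \<subseteq> \<tau> r ` {z\<in>W. g z \<in> hcball d (hdil (1 / r) (hmul (- x) y)) (1 + \<eta>)} \<and>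
    \<tau> r ` {z\<in>W. g z \<in> hcball d (hdil (1 / r) (hmul (- x) y)) (1 - \<eta>)} \<subseteq> {n\<in>U. \<Phi> n \<in> hcball d y r}"
    using graph_in_ball[OF \<eta>(1)] by blast
  have "\<mu> (hcball d y r) \<le> ennreal (1 + \<eta>) * H (P \<inter> hcball d (hdil (1 / r) (hmul (- x) y)) (1 + \<eta>)) * ennreal (r ^ Q) \<and>
    ennreal (1 - \<eta>) * H (P \<inter> hcball d (hdil (1 / r) (hmul (- x) y)) (1 - \<eta>)) * ennreal (r ^ Q) \<le> \<mu> (hcball d y r)"
    if r: "0 < r" "r < r0" and y: "d y x \<le> r" for r y
  proof -
    define E where "E = {n\<in>U. \<Phi> n \<in> hcball d y r}"
    define A where "A t = {z\<in>W. g z \<in> hcball d (hdil (1 / r) (hmul (- x) y)) t}" for t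
    define I where "I = (\<integral>\<^sup>+n. ennreal (\<rho> (\<Phi> n)) * indicator E n \<partial>hausdorff_measure (dim W))"
    have "hcball d y r \<in> sets borel" by (rule borel_compact[OF compact_hcball])
    then have \<mu>_eq: "\<mu> (hcball d y r) = ennreal (vol (join v w)) * I"
      by (simp add: \<mu> I_def E_def \<rho>_def)
    have cA: "compact (A t)" for t unfolding A_def by (rule compact_preimage_g[OF compact_hcball])
    have AW: "A t \<subseteq> W" for t by (auto simp: A_def)
    have "continuous_on UNIV (\<tau> r)" unfolding \<tau>_eq[abs_def] by (intro continuous_intros)
    then have "compact (\<tau> r ` A t)" for t by (rule compact_continuous_image[OF continuous_on_subset cA]) simp
    then have bor: "\<tau> r ` A t \<in> sets (hausdorff_measure (dim W))" for t by (simp add: borel_compact)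
    have H\<tau>: "H (\<tau> r ` A t) = ennreal (r ^ Q) * H (A t)" for t
      unfolding \<tau>_def[abs_def] by (rule hausdorff_translate_dilate[OF r(1) cA AW])
    have HA: "H (P \<inter> hcball d (hdil (1 / r) (hmul (- x) y)) t) = ennreal (vol (join v w) * \<rho> x) * H (A t)" for t
      unfolding A_def by (rule hausdorff_graph[OF compact_hcball, symmetric])
    have val: "ennreal (vol (join v w)) * (ennreal (c * \<rho> x) * H (\<tau> r ` A t))
        = ennreal c * H (P \<inter> hcball d (hdil (1 / r) (hmul (- x) y)) t) * ennreal (r ^ Q)" if "0 \<le> c" for c t
    proof -
      have "ennreal (c * \<rho> x) = ennreal c * ennreal (\<rho> x)"
        "ennreal (vol (join v w) * \<rho> x) = ennreal (vol (join v w)) * ennreal (\<rho> x)"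
        using that J_pos(3) vol_nonneg by (simp_all add: ennreal_mult)
      then show ?thesis by (simp only: H\<tau> HA mult_ac)
    qed
    have \<rho>: "\<bar>\<rho> (\<Phi> n) - \<rho> x\<bar> < \<eta> * \<rho> x" if "n \<in> E" for n using r0(2)[OF r y] that by (auto simp: E_def)
    have sub: "E \<subseteq> \<tau> r ` A (1 + \<eta>)" "\<tau> r ` A (1 - \<eta>) \<subseteq> E" using r0(2)[OF r y] by (auto simp: E_def A_def)
    \<comment> \<open>\<open>nn_integral\<close> is monotone for arbitrary functions, so
      measurability of \<open>E\<close> and of the integrand does not have to be shown.\<close>
    have "I \<le> (\<integral>\<^sup>+n. ennreal ((1 + \<eta>) * \<rho> x) * indicator (\<tau> r ` A (1 + \<eta>)) n \<partial>hausdorff_measure (dim W))"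
      unfolding I_def
    proof (intro nn_integral_mono)
      fix n
      show "ennreal (\<rho> (\<Phi> n)) * indicator E n \<le> ennreal ((1 + \<eta>) * \<rho> x) * indicator (\<tau> r ` A (1 + \<eta>)) n"
      proof (cases "n \<in> E")
        case True
        then have "n \<in> \<tau> r ` A (1 + \<eta>)" using sub by blast
        moreover have "\<rho> (\<Phi> n) \<le> (1 + \<eta>) * \<rho> x" using \<rho>[OF True] by (simp add: algebra_simps)
        ultimately show ?thesis using True by (simp add: ennreal_leI)
      qed simp
    qed
    also have "\<dots> = ennreal ((1 + \<eta>) * \<rho> x) * H (\<tau> r ` A (1 + \<eta>))"
      by (rule nn_integral_cmult_indicator[OF bor])
    finally have up: "\<mu> (hcball d y r) \<le> ennreal (vol (join v w)) * (ennreal ((1 + \<eta>) * \<rho> x) * H (\<tau> r ` A (1 + \<eta>)))"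
      unfolding \<mu>_eq by (rule mult_left_mono) simp
    have "ennreal ((1 - \<eta>) * \<rho> x) * H (\<tau> r ` A (1 - \<eta>))
        = (\<integral>\<^sup>+n. ennreal ((1 - \<eta>) * \<rho> x) * indicator (\<tau> r ` A (1 - \<eta>)) n \<partial>hausdorff_measure (dim W))"
      by (rule nn_integral_cmult_indicator[OF bor, symmetric])
    also have "\<dots> \<le> I"
      unfolding I_def
    proof (intro nn_integral_mono)
      fix n
      show "ennreal ((1 - \<eta>) * \<rho> x) * indicator (\<tau> r ` A (1 - \<eta>)) n \<le> ennreal (\<rho> (\<Phi> n)) * indicator E n"
      proof (cases "n \<in> \<tau> r ` A (1 - \<eta>)")
        case True
        then have "n \<in> E" using sub by blast
        moreover have "(1 - \<eta>) * \<rho> x \<le> \<rho> (\<Phi> n)" using \<rho>[OF \<open>n \<in> E\<close>] by (simp add: algebra_simps)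
        ultimately show ?thesis using True by (simp add: ennreal_leI)
      qed simp
    qed
    finally have low: "ennreal (vol (join v w)) * (ennreal ((1 - \<eta>) * \<rho> x) * H (\<tau> r ` A (1 - \<eta>))) \<le> \<mu> (hcball d y r)"
      unfolding \<mu>_eq by (rule mult_left_mono) simp
    show ?thesis using up low \<eta> by (simp add: val)
  qed
  then show ?thesis using r0(1) by blast
qed

text \<open>The density is squeezed between the multiples \<open>(1 - \<eta>) ^ Suc Q\<close> and
  \<open>(1 + \<eta>) ^ Suc Q\<close> of the maximal section: one factor stems from the integrand,
  the other Q from dilating the window to radius 1.\<close>

lemma federer_density_graph:
  assumes \<mu>: "\<And>B. B \<in> sets borel \<Longrightarrow> \<mu> B = ennreal (vol (join v w)) *
      (\<integral>\<^sup>+n\<in>{n\<in>U. \<Phi> n \<in> B}. ennreal (J_H d f (\<Phi> n) / J_V d V f (\<Phi> n)) \<partial>hausdorff_measure (dim W))"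
  shows "federer_density d (real Q) \<mu> x = spherical_factor d (Tan S x)"
proof -
  obtain zm where zm: "zm \<in> hcball d 0 1" "\<And>y. y \<in> hcball d 0 1 \<Longrightarrow> H (P \<inter> hcball d y 1) \<le> H (P \<inter> hcball d zm 1)"
    using ex_maximal_hcball by blast
  obtain \<beta> where \<beta>: "0 \<le> \<beta>" "H (P \<inter> hcball d zm 1) = ennreal \<beta>"
    using H_hcball_finite[of zm 1] by (cases "H (P \<inter> hcball d zm 1)") auto
  have hc: "z \<in> hcball d 0 1 \<longleftrightarrow> N z \<le> 1" for z by (simp add: hcball_def hnorm_def d_sym)
  define ratio where "ratio y r = ennreal (2 powr real Q) * \<mu> (hcball d y r) / ennreal (hdiam d (hcball d y r) powr real Q)" for y r
  have ratio: "ratio y r = \<mu> (hcball d y r) / ennreal (r ^ Q)" if r: "0 < r" for y r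
  proof -
    have "hdiam d (hcball d y r) powr real Q = 2 ^ Q * r ^ Q"
      using r by (simp add: hdiam_hcball powr_realpow power_mult_distrib)
    then have "ratio y r = (\<mu> (hcball d y r) * ennreal (2 ^ Q)) / (ennreal (r ^ Q) * ennreal (2 ^ Q))"
      using r by (simp add: ratio_def powr_realpow ennreal_mult mult.commute)
    also have "\<dots> = \<mu> (hcball d y r) / ennreal (r ^ Q)"
      by (rule divide_mult_eq) auto
    finally show ?thesis .
  qed
  have cancel: "c * ennreal (r ^ Q) / ennreal (r ^ Q) = c" if "0 < r" for c and r :: real
    using that by (intro mult_divide_eq_ennreal) auto
  have scale: "H (P \<inter> hcball d z t) = ennreal (t ^ Q) * H (P \<inter> hcball d (hdil (1 / t) z) 1)" if "0 < t" for t z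
    using hausdorff_hcball_dilate[OF that, of "hdil (1 / t) z" 1] that by (simp add: hdil_hdil)
  have upper: "federer_density d (real Q) \<mu> x \<le> ennreal ((1 + \<eta>) ^ Suc Q * \<beta>)" if \<eta>: "0 < \<eta>" "\<eta> < 1" for \<eta>
  proof -
    obtain r0 where r0: "0 < r0" "\<And>r y. 0 < r \<Longrightarrow> r < r0 \<Longrightarrow> d y x \<le> r \<Longrightarrow>
      \<mu> (hcball d y r) \<le> ennreal (1 + \<eta>) * H (P \<inter> hcball d (hdil (1 / r) (hmul (- x) y)) (1 + \<eta>)) * ennreal (r ^ Q)"
      using measure_window[OF \<mu> \<eta>] by blast
    have "ratio y r \<le> ennreal ((1 + \<eta>) ^ Suc Q * \<beta>)" if r: "0 < r" "r < r0" and y: "d y x \<le> r" for y r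
    proof -
      \<comment> \<open>Shrinking the window to radius 1 keeps its centre in the unit ball, where
        \<beta> bounds the section.\<close>
      define z where "z = hdil (1 / (1 + \<eta>)) (hdil (1 / r) (hmul (- x) y))"
      have "N z = (1 / (1 + \<eta>)) * ((1 / r) * d x y)" using r \<eta> by (simp add: z_def N_dil flip: d_N)
      also have "\<dots> \<le> 1 * 1" using r \<eta> y by (intro mult_mono) (auto simp: d_sym)
      finally have "H (P \<inter> hcball d z 1) \<le> ennreal \<beta>" using zm(2)[of z] \<beta> hc by simp
      have "ratio y r \<le> ennreal (1 + \<eta>) * H (P \<inter> hcball d (hdil (1 / r) (hmul (- x) y)) (1 + \<eta>)) * ennreal (r ^ Q) / ennreal (r ^ Q)"
        unfolding ratio[OF r(1)] by (rule divide_right_mono_ennreal[OF r0(2)[OF r y]])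
      also have "\<dots> = ennreal (1 + \<eta>) * (ennreal ((1 + \<eta>) ^ Q) * H (P \<inter> hcball d z 1))"
        unfolding cancel[OF r(1)] using \<eta> by (subst scale) (simp_all add: z_def)
      also have "\<dots> \<le> ennreal (1 + \<eta>) * (ennreal ((1 + \<eta>) ^ Q) * ennreal \<beta>)"
        by (intro mult_left_mono \<open>H (P \<inter> hcball d z 1) \<le> ennreal \<beta>\<close>) auto
      also have "\<dots> = ennreal ((1 + \<eta>) ^ Suc Q * \<beta>)" using \<eta> \<beta>(1) by (simp add: ennreal_mult mult.assoc)
      finally show ?thesis .
    qed
    then have "(SUP (y, r)\<in>{(y, r). x \<in> hcball d y r \<and> 0 < r \<and> r < r0}. ratio y r) \<le> ennreal ((1 + \<eta>) ^ Suc Q * \<beta>)"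
      by (intro SUP_least) (auto simp: hcball_def)
    then show ?thesis unfolding federer_density_def ratio_def using r0(1) by (intro INF_lower2[of r0]) auto
  qed
  have lower: "ennreal ((1 - \<eta>) ^ Suc Q * \<beta>) \<le> federer_density d (real Q) \<mu> x" if \<eta>: "0 < \<eta>" "\<eta> < 1" for \<eta>
    unfolding federer_density_def
  proof (rule INF_greatest)
    fix \<epsilon> :: real assume \<epsilon>: "\<epsilon> \<in> {0<..}"
    obtain r0 where r0: "0 < r0" "\<And>r y. 0 < r \<Longrightarrow> r < r0 \<Longrightarrow> d y x \<le> r \<Longrightarrow>
      ennreal (1 - \<eta>) * H (P \<inter> hcball d (hdil (1 / r) (hmul (- x) y)) (1 - \<eta>)) * ennreal (r ^ Q) \<le> \<mu> (hcball d y r)"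
      using measure_window[OF \<mu> \<eta>] by blast
    define r where "r = min r0 \<epsilon> / 2"
    have r: "0 < r" "r < r0" "r < \<epsilon>" using r0(1) \<epsilon> by (auto simp: r_def)
    \<comment> \<open>Chosen such that after rescaling the inner window is exactly the dilate by 1 -
      \<eta> of the maximal ball.\<close>
    define y where "y = hmul x (hdil r (hdil (1 - \<eta>) zm))"
    have "d x y = r * ((1 - \<eta>) * N zm)" using r \<eta> by (simp add: y_def d_hmul_right N_dil)
    also have "\<dots> \<le> r * (1 * 1)" using r \<eta> zm(1) hc by (intro mult_left_mono mult_mono) auto
    finally have y: "d y x \<le> r" by (simp add: d_sym)
    have z: "hdil (1 / r) (hmul (- x) y) = hdil (1 - \<eta>) zm" using r by (simp add: y_def hdil_hdil)
    have "ennreal ((1 - \<eta>) ^ Suc Q * \<beta>) = ennreal (1 - \<eta>) * (ennreal ((1 - \<eta>) ^ Q) * ennreal \<beta>)"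
      using \<eta> \<beta>(1) by (simp add: ennreal_mult mult.assoc)
    also have "\<dots> = ennreal (1 - \<eta>) * H (P \<inter> hcball d (hdil (1 / r) (hmul (- x) y)) (1 - \<eta>)) * ennreal (r ^ Q) / ennreal (r ^ Q)"
      unfolding cancel[OF r(1)] z using \<eta> by (subst scale) (simp_all add: hdil_hdil \<beta>(2))
    also have "\<dots> \<le> ratio y r"
      unfolding ratio[OF r(1)] by (rule divide_right_mono_ennreal[OF r0(2)[OF r(1,2) y]])
    also have "\<dots> \<le> (SUP (y, r)\<in>{(y, r). x \<in> hcball d y r \<and> 0 < r \<and> r < \<epsilon>}. ratio y r)"
      using r y by (intro SUP_upper2[of "(y, r)"]) (auto simp: hcball_def)
    finally show "ennreal ((1 - \<eta>) ^ Suc Q * \<beta>) \<le> (SUP (y, r)\<in>{(y, r). x \<in> hcball d y r \<and> 0 < r \<and> r < \<epsilon>}.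
        ennreal (2 powr real Q) * \<mu> (hcball d y r) / ennreal (hdiam d (hcball d y r) powr real Q))"
      unfolding ratio_def .
  qed
  have ev: "eventually (\<lambda>\<eta>. 0 < \<eta> \<and> \<eta> < 1) (at_right (0::real))"
    unfolding eventually_at_right_field by (intro exI[of _ 1]) auto
  have lim: "((\<lambda>\<eta>. ennreal ((1 + \<eta>) ^ Suc Q * \<beta>)) \<longlongrightarrow> ennreal ((1 + 0) ^ Suc Q * \<beta>)) (at_right 0)"
    "((\<lambda>\<eta>. ennreal ((1 - \<eta>) ^ Suc Q * \<beta>)) \<longlongrightarrow> ennreal ((1 - 0) ^ Suc Q * \<beta>)) (at_right 0)"
    by (intro tendsto_ennrealI tendsto_intros)+
  have "federer_density d (real Q) \<mu> x \<le> ennreal ((1 + 0) ^ Suc Q * \<beta>)"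
    by (rule tendsto_lowerbound[OF lim(1) eventually_mono[OF ev] trivial_limit_at_right_real]) (use upper in blast)
  moreover have "ennreal ((1 - 0) ^ Suc Q * \<beta>) \<le> federer_density d (real Q) \<mu> x"
    by (rule tendsto_upperbound[OF lim(2) eventually_mono[OF ev] trivial_limit_at_right_real]) (use lower in blast)
  ultimately have "federer_density d (real Q) \<mu> x = ennreal \<beta>" by simp
  then show ?thesis using spherical_factor_P[OF zm] by (simp add: Tan_eq \<beta>(2))
qed

end

text \<open>A fibre of V may meet the level set more than once, so a parametrization exists near
  each point, and globally whenever the projection to W is injective on S. The density formula is
  stated for every parametrized piece; O' = UNIV is the global case.\<close>

theorem theorem3p2:
  fixes W V \<Omega> S :: "('n::finite) heis set"
    and d :: "'n heis \<Rightarrow> 'n heis \<Rightarrow> real"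
    and f :: "'n heis \<Rightarrow> real^('k::finite)"
    and x0 :: "'n heis"
    and v w :: "nat \<Rightarrow> 'n heis"
  assumes "semidirect W V" and "dim V = CARD('k)"
    and "homogeneous_distance d"
    and "open \<Omega>" and "C1h d \<Omega> f"
    and "x0 \<in> \<Omega>" and "S = {x\<in>\<Omega>. f x = f x0}"
    and "\<forall>x\<in>S. J_V d V f x > 0"
    and "orthonormal_basis_of {1..CARD('k)} v V"
    and "orthonormal_basis_of {CARD('k)+1..2*CARD('n)+1} w W"
    and "w (2*CARD('n)+1) = e_last"
  shows
    "(\<forall>x\<in>S. \<exists>O'. open O' \<and> x \<in> O' \<and> (\<exists>U \<phi>. H_parametrized TYPE('k) d W V (S \<inter> O') U \<phi>)) \<and>
     (inj_on (proj_W W V) S \<longrightarrow> (\<exists>U \<phi>. H_parametrized TYPE('k) d W V S U \<phi>)) \<and>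
     (\<forall>O' U \<phi> \<mu>.
        open O' \<and> H_parametrized TYPE('k) d W V (S \<inter> O') U \<phi> \<and>
        (\<forall>B\<in>sets borel. \<mu> B =
           ennreal (mv_norm {1..2*CARD('n)+1}
             (wedge {1..2*CARD('n)+1} (\<lambda>i. if i \<le> CARD('k) then v i else w i))) *
           (\<integral>\<^sup>+n\<in>{n\<in>U. hmul n (\<phi> n) \<in> B}.
              ennreal (J_H d f (hmul n (\<phi> n)) / J_V d V f (hmul n (\<phi> n)))
              \<partial>hausdorff_measure (2*CARD('n)+1-CARD('k)))) \<longrightarrow>
        (\<forall>x\<in>S \<inter> O'.
           federer_density d (real (2*CARD('n)+2-CARD('k))) \<mu> x = spherical_factor d (Tan S x)))"
proof -
  interpret level_set d W V \<Omega> S f x0 v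
    by (intro level_set.intro factorization.intro homdist.intro factorization_axioms.intro level_set_axioms.intro assms)
  have "\<forall>x\<in>S. \<exists>O'. open O' \<and> x \<in> O' \<and> (\<exists>U \<phi>. H_parametrized TYPE('k) d W V (S \<inter> O') U \<phi>)"
  proof
    fix x assume "x \<in> S"
    then obtain O' where O': "open O'" "x \<in> O'" "inj_on (proj_W W V) (S \<inter> O')" using local_injective by blast
    show "\<exists>O'. open O' \<and> x \<in> O' \<and> (\<exists>U \<phi>. H_parametrized TYPE('k) d W V (S \<inter> O') U \<phi>)"
      by (rule exI[of _ O'], intro conjI O' ex_H_parametrized)
  qed
  moreover have "inj_on (proj_W W V) S \<longrightarrow> (\<exists>U \<phi>. H_parametrized TYPE('k) d W V S U \<phi>)"
    using ex_H_parametrized[OF open_UNIV] unfolding Int_UNIV_right by (rule impI)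
  moreover have "federer_density d (real (2*CARD('n)+2-CARD('k))) \<mu> x = spherical_factor d (Tan S x)"
    if O': "open O'" and par: "H_parametrized TYPE('k) d W V (S \<inter> O') U \<phi>"
      and \<mu>: "\<forall>B\<in>sets borel. \<mu> B =
           ennreal (mv_norm {1..2*CARD('n)+1}
             (wedge {1..2*CARD('n)+1} (\<lambda>i. if i \<le> CARD('k) then v i else w i))) *
           (\<integral>\<^sup>+n\<in>{n\<in>U. hmul n (\<phi> n) \<in> B}.
              ennreal (J_H d f (hmul n (\<phi> n)) / J_V d V f (hmul n (\<phi> n)))
              \<partial>hausdorff_measure (2*CARD('n)+1-CARD('k)))"
      and x: "x \<in> S \<inter> O'" for O' U \<phi> \<mu> x
  proof -
    have gr: "U \<subseteq> W" "\<phi> ` U \<subseteq> V" "S \<inter> O' = {hmul u (\<phi> u) |u. u \<in> U}"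
      using par openin_imp_subset unfolding H_parametrized_def by blast+
    interpret framed_graph d W V \<Omega> S f x0 v O' U \<phi> w
      by unfold_locales (fact O' gr assms)+
    obtain w0 where w0: "w0 \<in> U" "x = hmul w0 (\<phi> w0)" using x gr(3) by blast
    obtain L where L: "linear L" "\<And>z. L z \<in> V" "\<And>z. D (\<Phi> w0) (L z) = - D (\<Phi> w0) z"
      "\<And>t z. 0 < t \<Longrightarrow> L (hdil t z) = t *\<^sub>R L z" "\<And>y z. L (hmul y z) = L y + L z"
      "\<And>e. 0 < e \<Longrightarrow> \<exists>\<delta>>0. \<forall>w'\<in>U. d w0 w' < \<delta> \<longrightarrow> (\<forall>u\<in>U. \<forall>w. w = hmul (hmul (- \<Phi> w') u) (\<phi> w') \<longrightarrow> N w < \<delta> \<longrightarrow>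
         d (L w) (\<phi> u - \<phi> w') \<le> e * N w)"
      by (rule intrinsic_differential[OF w0(1)]) (rule that)
    interpret B: blow_up d W V \<Omega> S f x0 v O' U \<phi> w w0 L
      by (intro blow_up.intro framed_graph_axioms blow_up_axioms.intro w0(1) L)
    have "dim W = 2*CARD('n)+1-CARD('k)" using dim_W_V dimV by simp
    moreover have "join v w = (\<lambda>i. if i \<le> CARD('k) then v i else w i)" by (simp add: join_def fun_eq_iff)
    ultimately have "\<mu> B = ennreal (vol (join v w)) *
        (\<integral>\<^sup>+n\<in>{n\<in>U. hmul n (\<phi> n) \<in> B}. ennreal (J_H d f (hmul n (\<phi> n)) / J_V d V f (hmul n (\<phi> n))) \<partial>hausdorff_measure (dim W))"
      if "B \<in> sets borel" for B
      using bspec[OF \<mu> that] by (simp only: vol_def I0_def)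
    from B.federer_density_graph[OF this] show ?thesis by (simp only: Q_def B.x_def w0(2))
  qed
  ultimately show ?thesis by blast
qed

end
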